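(* Let $X$ be a connected and locally relatively 1-connected topological space. Then for any group $G$ there is an isomorphism of groups $$H^0(X;G_X\xrightarrow{\mathrm{ad}}\mathrm{Aut}(G_X))\xrightarrow{\ \sim\ }\mathrm{Hom}(\pi_1(X),Z(G))\rtimes\mathrm{Out}(G).$$
   Context: A topological space $X$ is locally relatively 1-connected if each point $x\in X$ has a fundamental system of arcwise connected neighborhoods $U$ such that each loop $\gamma$ in $U$ is homotopic in $X$ to a constant path. $G$ is a not necessarily commutative group, $Z(G)$ its center, $\mathrm{ad}(g)(h)=ghg^{-1}$, and $\mathrm{Out}(G)=\mathrm{Aut}(G)/\mathrm{ad}(G)$ the group of outer automorphisms, which acts on the left on the group $\mathrm{Hom}(\pi_1(X),Z(G))$ of group homomorphisms by composition. $\pi_1(X)$ is taken at a fixed base point. $G_X$ is the constant sheaf of groups on $X$ with stalk $G$. $H^0(X;G_X\xrightarrow{\mathrm{ad}}\mathrm{Aut}(G_X))$ is the $0$-th (hyper)cohomology group of $X$ with values in the sheaf of crossed modules $G_X\to\mathrm{Aut}(G_X)$ ($G_X$ in degree $-1$, $\mathrm{Aut}(G_X)$ in degree $0$); it is isomorphic to the group of isomorphism classes of $G_X$-bitorsors on $X$ (right $G_X$-torsors with an additional compatible structure of left $G_X$-torsor), with group law given by the contracted product. *)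

theory Defs
  imports "HOL-Analysis.Analysis" "HOL-Algebra.Algebra"
begin

section \<open>Topology\<close>

text \<open>A topological space \<open>X\<close> is represented by a type \<open>'a\<close> of class \<open>topological_space\<close>, so that
  \<open>X = UNIV\<close>. Neighbourhoods need not be open, ``arcwise connected'' means path connected, and
  null-homotopies of loops are relative to the end points.\<close>

definition locally_relatively_1_connected :: "'a::topological_space itself \<Rightarrow> bool"
  where "locally_relatively_1_connected _ \<longleftrightarrow>
    (\<forall>(x::'a) N. open N \<and> x \<in> N \<longrightarrow>
      (\<exists>U. x \<in> interior U \<and> U \<subseteq> N \<and> path_connected U \<and>
        (\<forall>\<gamma>. path \<gamma> \<and> path_image \<gamma> \<subseteq> U \<and> pathfinish \<gamma> = pathstart \<gamma> \<longrightarrow>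
          homotopic_paths UNIV \<gamma> (\<lambda>_. pathstart \<gamma>))))"

definition loop_homotopy :: "'a::topological_space \<Rightarrow> ((real \<Rightarrow> 'a) \<times> (real \<Rightarrow> 'a)) set"
  where "loop_homotopy x0 =
    {(p, q). pathstart p = x0 \<and> pathfinish p = x0 \<and> homotopic_paths UNIV p q}"

definition fundamental_group :: "'a::topological_space \<Rightarrow> (real \<Rightarrow> 'a) set monoid"
  where "fundamental_group x0 =
    \<lparr>carrier = {p. path p \<and> pathstart p = x0 \<and> pathfinish p = x0} // loop_homotopy x0,
     mult = (\<lambda>A B. \<Union>p\<in>A. \<Union>q\<in>B. loop_homotopy x0 `` {p +++ q}),
     one = loop_homotopy x0 `` {\<lambda>_. x0}\<rparr>"


section \<open>Groups\<close>

definition center_group :: "('g, 'm) monoid_scheme \<Rightarrow> ('g, 'm) monoid_scheme"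
  where "center_group G =
    G\<lparr>carrier := {z \<in> carrier G. \<forall>g\<in>carrier G. z \<otimes>\<^bsub>G\<^esub> g = g \<otimes>\<^bsub>G\<^esub> z}\<rparr>"

definition inner_aut :: "('g, 'm) monoid_scheme \<Rightarrow> 'g \<Rightarrow> 'g \<Rightarrow> 'g"
  where "inner_aut G g = (\<lambda>h\<in>carrier G. g \<otimes>\<^bsub>G\<^esub> h \<otimes>\<^bsub>G\<^esub> inv\<^bsub>G\<^esub> g)"

definition Out :: "('g, 'm) monoid_scheme \<Rightarrow> ('g \<Rightarrow> 'g) set monoid"
  where "Out G = AutoGroup G Mod (inner_aut G ` carrier G)"

definition hom_group ::
    "('p, 'm) monoid_scheme \<Rightarrow> ('g, 'n) monoid_scheme \<Rightarrow> ('p \<Rightarrow> 'g) monoid"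
  where "hom_group P A =
    \<lparr>carrier = hom P A \<inter> extensional (carrier P),
     mult = (\<lambda>f f'. \<lambda>x\<in>carrier P. f x \<otimes>\<^bsub>A\<^esub> f' x),
     one = (\<lambda>x\<in>carrier P. \<one>\<^bsub>A\<^esub>)\<rparr>"

text \<open>The action of an outer automorphism by composition, on maps with values in the center. Inner
  automorphisms fix the center pointwise, so the chosen representative is irrelevant.\<close>

definition out_action ::
    "('p, 'm) monoid_scheme \<Rightarrow> ('g \<Rightarrow> 'g) set \<Rightarrow> ('p \<Rightarrow> 'g) \<Rightarrow> 'p \<Rightarrow> 'g"
  where "out_action P a f = compose (carrier P) (SOME \<alpha>. \<alpha> \<in> a) f"

definition semidirect ::
    "('n, 'k) monoid_scheme \<Rightarrow> ('h, 'l) monoid_scheme \<Rightarrow> ('h \<Rightarrow> 'n \<Rightarrow> 'n) \<Rightarrow> ('n \<times> 'h) monoid"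
  where "semidirect N H act =
    \<lparr>carrier = carrier N \<times> carrier H,
     mult = (\<lambda>(n, h) (n', h'). (n \<otimes>\<^bsub>N\<^esub> act h n', h \<otimes>\<^bsub>H\<^esub> h')),
     one = (\<one>\<^bsub>N\<^esub>, \<one>\<^bsub>H\<^esub>)\<rparr>"


section \<open>Sheaves of groups and of crossed modules\<close>

text \<open>\<open>sect F U\<close> is the group of sections over the open set \<open>U\<close>, and \<open>rs F U V\<close> is the restriction
  from \<open>U\<close> to \<open>V\<close>. These records carry only the data; the laws hold for the instances used.\<close>

record ('a, 's) group_presheaf =
  sect :: "'a set \<Rightarrow> 's monoid"
  rs :: "'a set \<Rightarrow> 'a set \<Rightarrow> 's \<Rightarrow> 's"

text \<open>A crossed module \<open>lower \<rightarrow> upper\<close>, in degrees \<open>-1\<close> and \<open>0\<close>, with boundary \<open>bd\<close> and left action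
  \<open>act\<close> of \<open>upper\<close> on \<open>lower\<close>.\<close>

record ('a, 's, 't) xmod_presheaf =
  lower :: "('a, 's) group_presheaf"
  upper :: "('a, 't) group_presheaf"
  bd :: "'a set \<Rightarrow> 's \<Rightarrow> 't"
  act :: "'a set \<Rightarrow> 't \<Rightarrow> 's \<Rightarrow> 's"

text \<open>Sections of the constant sheaf are the locally constant functions, i.e. the continuous
  functions into the discrete space \<open>G\<close>.\<close>

definition const_sheaf ::
    "('g, 'm) monoid_scheme \<Rightarrow> ('a::topological_space, 'a \<Rightarrow> 'g) group_presheaf"
  where "const_sheaf G =
    \<lparr>sect = (\<lambda>U.
       \<lparr>carrier = {s \<in> extensional U.
          continuous_map (top_of_set U) (discrete_topology (carrier G)) s},
        mult = (\<lambda>s t. \<lambda>x\<in>U. s x \<otimes>\<^bsub>G\<^esub> t x),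
        one = (\<lambda>x\<in>U. \<one>\<^bsub>G\<^esub>)\<rparr>),
     rs = (\<lambda>U V s. restrict s V)\<rparr>"

abbreviation opens_in :: "'a::topological_space set \<Rightarrow> 'a set set"
  where "opens_in U \<equiv> {V. open V \<and> V \<subseteq> U}"

text \<open>The sheaf \<open>Aut(F)\<close>: its sections over \<open>U\<close> are the automorphisms of the restriction of \<open>F\<close> to
  \<open>U\<close>, i.e. families of group automorphisms of all \<open>F(V)\<close>, \<open>V \<subseteq> U\<close> open, compatible with restriction.\<close>

definition aut_sheaf ::
    "('a::topological_space, 's) group_presheaf \<Rightarrow> ('a, 'a set \<Rightarrow> 's \<Rightarrow> 's) group_presheaf"
  where "aut_sheaf F =
    \<lparr>sect = (\<lambda>U.
       \<lparr>carrier = {\<alpha> \<in> (\<Pi>\<^sub>E V\<in>opens_in U. carrier (AutoGroup (sect F V))).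
          \<forall>V\<in>opens_in U. \<forall>W\<in>opens_in V. \<forall>s\<in>carrier (sect F V).
            \<alpha> W (rs F V W s) = rs F V W (\<alpha> V s)},
        mult = (\<lambda>\<alpha> \<beta>. \<lambda>V\<in>opens_in U. \<alpha> V \<otimes>\<^bsub>AutoGroup (sect F V)\<^esub> \<beta> V),
        one = (\<lambda>V\<in>opens_in U. \<one>\<^bsub>AutoGroup (sect F V)\<^esub>)\<rparr>),
     rs = (\<lambda>U V \<alpha>. restrict \<alpha> (opens_in V))\<rparr>"

definition ad_xmod ::
    "('a::topological_space, 's) group_presheaf \<Rightarrow> ('a, 's, 'a set \<Rightarrow> 's \<Rightarrow> 's) xmod_presheaf"
  where "ad_xmod F =
    \<lparr>lower = F,
     upper = aut_sheaf F,
     bd = (\<lambda>U s. \<lambda>V\<in>opens_in U. inner_aut (sect F V) (rs F U V s)),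
     act = (\<lambda>U \<alpha> s. \<alpha> U s)\<rparr>"


section \<open>Cohomology in degree 0\<close>

text \<open>\<open>H\<^sup>0(X; M)\<close> is computed by Cech cocycles modulo coboundaries, in the colimit over all open
  coverings. As in Godement, coverings are indexed by the points of the space (\<open>x \<in> U x\<close>), which are
  cofinal among all coverings. A cocycle \<open>(U, \<phi>, g)\<close> consists of sections \<open>\<phi> x\<close> of \<open>upper\<close> over \<open>U x\<close>
  and \<open>g x y\<close> of \<open>lower\<close> over \<open>U x \<inter> U y\<close> with
  \<open>\<phi> x = bd (g x y) \<cdot> \<phi> y\<close> on double and \<open>g x y \<cdot> g y z = g x z\<close> on triple intersections.\<close>

definition pointed_cover :: "('a::topological_space \<Rightarrow> 'a set) \<Rightarrow> bool"
  where "pointed_cover U \<longleftrightarrow> (\<forall>x. open (U x) \<and> x \<in> U x)"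

record ('a, 's, 't) cochain =
  cov :: "'a \<Rightarrow> 'a set"
  zer :: "'a \<Rightarrow> 't"
  trn :: "'a \<Rightarrow> 'a \<Rightarrow> 's"

definition cocycles ::
    "('a::topological_space, 's, 't) xmod_presheaf \<Rightarrow> ('a, 's, 't) cochain set"
  where "cocycles M = {c.
    (let L = lower M; H = upper M; U = cov c; \<phi> = zer c; g = trn c in
      pointed_cover U \<and>
      (\<forall>x. \<phi> x \<in> carrier (sect H (U x))) \<and>
      (\<forall>x y. g x y \<in> carrier (sect L (U x \<inter> U y))) \<and>
      (\<forall>x y. let W = U x \<inter> U y in
        rs H (U x) W (\<phi> x) = bd M W (g x y) \<otimes>\<^bsub>sect H W\<^esub> rs H (U y) W (\<phi> y)) \<and>
      (\<forall>x y z. let W = U x \<inter> U y \<inter> U z in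
        rs L (U x \<inter> U y) W (g x y) \<otimes>\<^bsub>sect L W\<^esub> rs L (U y \<inter> U z) W (g y z)
          = rs L (U x \<inter> U z) W (g x z)))}"

text \<open>Two cocycles are cohomologous if on some common refinement \<open>W\<close> there are sections \<open>h x\<close> of
  \<open>lower\<close> with \<open>\<phi>' x = bd (h x) \<cdot> \<phi> x\<close> and \<open>g' x y = h x \<cdot> g x y \<cdot> (h y)\<inverse>\<close>.\<close>

definition cohomologous ::
    "('a::topological_space, 's, 't) xmod_presheaf
      \<Rightarrow> (('a, 's, 't) cochain \<times> ('a, 's, 't) cochain) set"
  where "cohomologous M = {(c, c'). c \<in> cocycles M \<and> c' \<in> cocycles M \<and>
    (let L = lower M; H = upper M; U = cov c; U' = cov c' in
      (\<exists>W h. pointed_cover W \<and>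
        (\<forall>x. W x \<subseteq> U x \<inter> U' x \<and> h x \<in> carrier (sect L (W x)) \<and>
          rs H (U' x) (W x) (zer c' x)
            = bd M (W x) (h x) \<otimes>\<^bsub>sect H (W x)\<^esub> rs H (U x) (W x) (zer c x)) \<and>
        (\<forall>x y. let V = W x \<inter> W y in
          rs L (U' x \<inter> U' y) V (trn c' x y)
            = rs L (W x) V (h x) \<otimes>\<^bsub>sect L V\<^esub> rs L (U x \<inter> U y) V (trn c x y)
                \<otimes>\<^bsub>sect L V\<^esub> inv\<^bsub>sect L V\<^esub> (rs L (W y) V (h y)))))}"

text \<open>The group law is
  \<open>(\<phi>, g) \<cdot> (\<psi>, k) = (\<lambda>x. \<phi> x \<cdot> \<psi> x, \<lambda>x y. g x y \<cdot> act (\<phi> y) (k x y))\<close> on the common refinement; for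
  \<open>F \<rightarrow> Aut(F)\<close> it corresponds to the contracted product of bitorsors.\<close>

definition cocycle_mult ::
    "('a::topological_space, 's, 't) xmod_presheaf
      \<Rightarrow> ('a, 's, 't) cochain \<Rightarrow> ('a, 's, 't) cochain \<Rightarrow> ('a, 's, 't) cochain"
  where "cocycle_mult M c d =
    (let L = lower M; H = upper M; U = cov c; V = cov d; W = (\<lambda>x. U x \<inter> V x) in
      \<lparr>cov = W,
       zer = (\<lambda>x. rs H (U x) (W x) (zer c x) \<otimes>\<^bsub>sect H (W x)\<^esub> rs H (V x) (W x) (zer d x)),
       trn = (\<lambda>x y. let D = W x \<inter> W y in
         rs L (U x \<inter> U y) D (trn c x y) \<otimes>\<^bsub>sect L D\<^esub>
           act M D (rs H (U y) D (zer c y)) (rs L (V x \<inter> V y) D (trn d x y)))\<rparr>)"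

definition cocycle_one ::
    "('a::topological_space, 's, 't) xmod_presheaf \<Rightarrow> ('a, 's, 't) cochain"
  where "cocycle_one M =
    \<lparr>cov = (\<lambda>_. UNIV),
     zer = (\<lambda>_. \<one>\<^bsub>sect (upper M) UNIV\<^esub>),
     trn = (\<lambda>_ _. \<one>\<^bsub>sect (lower M) UNIV\<^esub>)\<rparr>"

definition H0 ::
    "('a::topological_space, 's, 't) xmod_presheaf \<Rightarrow> ('a, 's, 't) cochain set monoid"
  where "H0 M =
    \<lparr>carrier = cocycles M // cohomologous M,
     mult = (\<lambda>A B. \<Union>c\<in>A. \<Union>d\<in>B. cohomologous M `` {cocycle_mult M c d}),
     one = cohomologous M `` {cocycle_one M}\<rparr>"

end

theory Submission
  imports Defs
begin

text \<open>A cocycle \<open>(U, \<phi>, g)\<close> glues trivial bitorsors over the open sets \<open>U x\<close>. Since the covering is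
  indexed by the points of the space, the fibre over a point \<open>p\<close> has a preferred trivialisation,
  that of the chart \<open>U p\<close>. In these trivialisations the right torsor becomes the function
  \<open>D p q = g p q (q)\<close>, which satisfies \<open>D p r = D p q \<cdot> D q r\<close> for \<open>q\<close> near \<open>p\<close> and \<open>r\<close> near \<open>q\<close>,
  and the left structure becomes a family of automorphisms \<open>a p\<close> of \<open>G\<close>, the stalks of \<open>\<phi> p\<close> at \<open>p\<close>,
  with \<open>a p = ad (D p q) \<circ> a q\<close> for \<open>q\<close> near \<open>p\<close>. (On a locally connected space an automorphism of
  the constant sheaf is the same as a locally constant family of automorphisms of \<open>G\<close>.)

  Such a \<open>D\<close> has a parallel transport \<open>T\<close> along paths, multiplicative and invariant under homotopy,
  because flat sections exist over an interval and over a square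
  (\<open>flat_square\<close>, \<open>transport_homotopic\<close>). Transporting \<open>a\<close> around a loop \<open>\<gamma>\<close> at \<open>p\<close> gives
  \<open>a p = ad (T \<gamma>) \<circ> a p\<close>, and \<open>a p\<close> is onto, so \<open>T \<gamma>\<close> is central (\<open>transport_loop_central\<close>). Thus a
  cocycle has an invariant: the monodromy homomorphism \<open>\<pi>\<^sub>1(X) \<rightarrow> Z(G)\<close> together with the outer class of
  \<open>a\<close> at the base point. The transport of a product is \<open>T \<gamma> \<cdot> a (T' \<gamma>)\<close> (\<open>transport_product\<close>), and this is
  the multiplication of the semidirect product.

  The invariant is a bijection on cohomology classes. If two cocycles have the same invariant, then
  \<open>e p = (T' \<gamma>)\<inverse> \<cdot> h \<cdot> T \<gamma>\<close>, with \<open>\<gamma>\<close> a path from the base point to \<open>p\<close> and \<open>ad h\<close> carrying one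
  automorphism at the base point to the other, does not depend on \<open>\<gamma>\<close> and is a coboundary between them
  (\<open>invariant_eq_imp_cohomologous\<close>). Conversely, a homomorphism \<open>m\<close> into the center extends to a
  functor \<open>M\<close> on all paths (\<open>extend_to_path_functor\<close>); if the loops in \<open>N x\<close> are null-homotopic, the
  value of \<open>M\<close> on a path inside \<open>N x\<close> depends only on the end points of the path, and the values on
  paths from \<open>x\<close> to \<open>q\<close> inside \<open>N x\<close> and on to \<open>y\<close> inside \<open>N y\<close> are the transition functions of a
  cocycle with monodromy \<open>m\<close> (\<open>invariant_surj\<close>). The group structure on \<open>H\<^sup>0\<close> is then transported
  along this bijection.\<close>

section \<open>Local systems and parallel transport\<close>

lemma continuous_on_eventually_nhds:
  assumes "continuous_on S f" "z \<in> S" "eventually P (nhds (f z))"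
  shows "\<forall>\<^sub>F w in nhds z. w \<in> S \<longrightarrow> P (f w)"
  using assms unfolding eventually_nhds continuous_on_topological by metis

lemma eventually_constant_on_connected:
  assumes S: "connected S" and f: "\<And>z. z \<in> S \<Longrightarrow> \<forall>\<^sub>F w in nhds z. w \<in> S \<longrightarrow> f w = f z"
    and "x \<in> S" "y \<in> S"
  shows "f x = f y"
proof -
  have "f constant_on S"
  proof (rule locally_constant_imp_constant[OF S])
    fix a assume a: "a \<in> S"
    from f[OF this, unfolded eventually_nhds]
    obtain T where T: "open T" "a \<in> T" "\<forall>w\<in>T. w \<in> S \<longrightarrow> f w = f a" by metis
    with a have "\<forall>w\<in>S \<inter> T. f w = f a" by blast
    with a T openin_open_Int[OF T(1)]
    show "\<exists>T. openin (top_of_set S) T \<and> a \<in> T \<and> (\<forall>x\<in>T. f x = f a)" by blast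
  qed
  with assms show ?thesis unfolding constant_on_def by metis
qed

context group
begin

lemma cancel_inv_left: "x \<in> carrier G \<Longrightarrow> y \<in> carrier G \<Longrightarrow> inv x \<otimes> (x \<otimes> y) = y"
  by (simp add: m_assoc[symmetric])

lemma cancel_left_inv: "x \<in> carrier G \<Longrightarrow> y \<in> carrier G \<Longrightarrow> x \<otimes> (inv x \<otimes> y) = y"
  by (simp add: m_assoc[symmetric])

lemmas group_cancel = cancel_inv_left cancel_left_inv

end

text \<open>A locally constant right torsor with a point \<open>u p\<close> chosen in every fibre: after transport to a
  nearby point \<open>q\<close>, \<open>u p\<close> becomes a point of the fibre there, and \<open>u q = u p \<cdot> D p q\<close>. Only the germ of
  \<open>D p\<close> at \<open>p\<close> carries information; the values at distant points are arbitrary.\<close>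
locale local_system = group G for G :: "('g, 'm) monoid_scheme" (structure) +
  fixes D :: "'a::topological_space \<Rightarrow> 'a \<Rightarrow> 'g"
  assumes D_closed [simp, intro]: "D p q \<in> carrier G"
    and D_refl [simp]: "D p p = \<one>"
    and D_cocycle: "\<forall>\<^sub>F q in nhds p. \<forall>\<^sub>F r in nhds q. D p r = D p q \<otimes> D q r"

text \<open>A flat section \<open>y\<close>, over \<open>S\<close>, of the pullback of the torsor along \<open>f\<close>, encoded by the elements that
  carry it to the chosen points: \<open>u (f z) = y z \<cdot> s z\<close>. Working with pullbacks makes paths and
  homotopies instances of one notion.\<close>
definition flat where
  "flat G D f S s \<longleftrightarrow>
    (\<forall>z\<in>S. s z \<in> carrier G \<and> (\<forall>\<^sub>F w in nhds z. w \<in> S \<longrightarrow> s w = s z \<otimes>\<^bsub>G\<^esub> D (f z) (f w)))"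

lemma flatD:
  assumes "flat G D f S s" "z \<in> S"
  shows "s z \<in> carrier G" "\<forall>\<^sub>F w in nhds z. w \<in> S \<longrightarrow> s w = s z \<otimes>\<^bsub>G\<^esub> D (f z) (f w)"
  using assms by (auto simp: flat_def)

lemma flat_subset: "flat G D f S s \<Longrightarrow> T \<subseteq> S \<Longrightarrow> flat G D f T s"
  unfolding flat_def by (blast intro: eventually_mono)

lemma flat_cong:
  assumes s: "flat G D f S s" and f: "\<And>z. z \<in> S \<Longrightarrow> f z = g z"
  shows "flat G D g S s"
  unfolding flat_def
proof (intro ballI conjI)
  fix z assume z: "z \<in> S"
  show "s z \<in> carrier G" by (rule flatD(1)[OF s z])
  show "\<forall>\<^sub>F w in nhds z. w \<in> S \<longrightarrow> s w = s z \<otimes>\<^bsub>G\<^esub> D (g z) (g w)"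
    using flatD(2)[OF s z] by eventually_elim (metis f z)
qed

lemma flat_compose:
  assumes s: "flat G D f S s" and h: "continuous_on T h" "h ` T \<subseteq> S"
  shows "flat G D (\<lambda>z. f (h z)) T (\<lambda>z. s (h z))"
  unfolding flat_def
proof (intro ballI conjI)
  fix z assume z: "z \<in> T"
  with h have hz: "h z \<in> S" by auto
  show "s (h z) \<in> carrier G" using flatD(1)[OF s hz] .
  have "\<forall>\<^sub>F w in nhds z. w \<in> T \<longrightarrow> (h w \<in> S \<longrightarrow> s (h w) = s (h z) \<otimes>\<^bsub>G\<^esub> D (f (h z)) (f (h w)))"
    by (rule continuous_on_eventually_nhds[OF h(1) z flatD(2)[OF s hz]])
  then show "\<forall>\<^sub>F w in nhds z. w \<in> T \<longrightarrow> s (h w) = s (h z) \<otimes>\<^bsub>G\<^esub> D (f (h z)) (f (h w))"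
    by eventually_elim (use h in auto)
qed

context local_system
begin

lemma flat_lmult:
  assumes "flat G D f S s" "k \<in> carrier G"
  shows "flat G D f S (\<lambda>z. k \<otimes> s z)"
  unfolding flat_def
proof (intro ballI conjI)
  fix z assume z: "z \<in> S"
  note s = flatD[OF assms(1) z]
  show "k \<otimes> s z \<in> carrier G" using s assms by simp
  show "\<forall>\<^sub>F w in nhds z. w \<in> S \<longrightarrow> k \<otimes> s w = k \<otimes> s z \<otimes> D (f z) (f w)"
    using s(2) by eventually_elim (use s assms in \<open>auto simp: m_assoc\<close>)
qed

text \<open>The quotient of two flat sections is locally constant.\<close>
lemma flat_unique:
  assumes S: "connected S" and s: "flat G D f S s" and t: "flat G D f S t"
    and x: "x \<in> S" "s x = t x" and y: "y \<in> S"
  shows "s y = t y"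
proof -
  have "s x \<otimes> inv t x = s y \<otimes> inv t y"
  proof (rule eventually_constant_on_connected[OF S _ x(1) y])
    fix z assume z: "z \<in> S"
    show "\<forall>\<^sub>F w in nhds z. w \<in> S \<longrightarrow> s w \<otimes> inv t w = s z \<otimes> inv t z"
      using flatD(2)[OF s z] flatD(2)[OF t z]
      by eventually_elim (use flatD(1)[OF s z] flatD(1)[OF t z] in
          \<open>auto simp: inv_mult_group m_assoc group_cancel\<close>)
  qed
  with x flatD(1)[OF t] have "s y \<otimes> inv t y = \<one>" by simp
  with y flatD(1)[OF s] flatD(1)[OF t] show ?thesis
    by (metis inv_closed inv_equality inv_inv)
qed

text \<open>Near \<open>z\<close>, the cocycle law says that \<open>D (f z)\<close> itself is a flat section.\<close>
lemma flat_local: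
  assumes f: "continuous_on S f" and z: "z \<in> S"
  obtains T where "open T" "z \<in> T" "flat G D f (S \<inter> T) (\<lambda>w. D (f z) (f w))"
proof -
  have "\<forall>\<^sub>F w in nhds z. w \<in> S \<longrightarrow> (\<forall>\<^sub>F r in nhds (f w). D (f z) r = D (f z) (f w) \<otimes> D (f w) r)"
    by (rule continuous_on_eventually_nhds[OF f z D_cocycle])
  from iffD1[OF eventually_nhds this] obtain T where T: "open T" "z \<in> T"
    "\<And>w. w \<in> T \<Longrightarrow> w \<in> S \<Longrightarrow> \<forall>\<^sub>F r in nhds (f w). D (f z) r = D (f z) (f w) \<otimes> D (f w) r"
    by auto
  have "flat G D f (S \<inter> T) (\<lambda>w. D (f z) (f w))"
    unfolding flat_def
  proof (intro ballI conjI)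
    fix w assume w: "w \<in> S \<inter> T"
    show "D (f z) (f w) \<in> carrier G" by simp
    show "\<forall>\<^sub>F v in nhds w. v \<in> S \<inter> T \<longrightarrow> D (f z) (f v) = D (f z) (f w) \<otimes> D (f w) (f v)"
      using continuous_on_eventually_nhds[OF f _ T(3)[of w]] w by (auto elim: eventually_mono)
  qed
  with T that show ?thesis by blast
qed

text \<open>On a connected overlap the two sections differ by a constant factor on the left, which can be
  moved into one of them. Closedness ensures that a point outside one piece has a neighbourhood
  that misses this piece, so flatness has to be checked in each piece separately.\<close>
lemma flat_glue:
  assumes cl: "closed A" "closed B" and conn: "connected (A \<inter> B)"
    and s: "flat G D f A s" and t: "flat G D f B t"
  obtains u where "flat G D f (A \<union> B) u"
proof -
  obtain k where k: "k \<in> carrier G" "\<And>z. z \<in> A \<inter> B \<Longrightarrow> s z = k \<otimes> t z"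
  proof (cases "A \<inter> B = {}")
    case True
    with that[of \<one>] show ?thesis by simp
  next
    case False
    then obtain z0 where z0: "z0 \<in> A \<inter> B" by auto
    define k where "k = s z0 \<otimes> inv t z0"
    have c: "s z0 \<in> carrier G" "t z0 \<in> carrier G"
      using z0 flatD(1)[OF s] flatD(1)[OF t] by auto
    then have k: "k \<in> carrier G" by (simp add: k_def)
    have "s z = k \<otimes> t z" if "z \<in> A \<inter> B" for z
      by (rule flat_unique[OF conn flat_subset[OF s] flat_subset[OF flat_lmult[OF t k]] z0])
         (use c that in \<open>auto simp: k_def m_assoc\<close>)
    with k that show ?thesis by blast
  qed
  define u where "u z = (if z \<in> A then s z else k \<otimes> t z)" for z
  have uA: "u z = s z" if "z \<in> A" for z using that by (simp add: u_def)
  have uB: "u z = k \<otimes> t z" if "z \<in> B" for z using that k by (auto simp: u_def)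
  note t' = flat_lmult[OF t k(1)]
  have "flat G D f (A \<union> B) u"
    unfolding flat_def
  proof (intro ballI conjI)
    fix z assume z: "z \<in> A \<union> B"
    show "u z \<in> carrier G"
      using z flatD(1)[OF s] flatD(1)[OF t'] uA uB by auto
    have A: "\<forall>\<^sub>F w in nhds z. w \<in> A \<longrightarrow> u w = u z \<otimes> D (f z) (f w)"
    proof (cases "z \<in> A")
      case True
      with flatD(2)[OF s True] show ?thesis by (simp add: uA)
    next
      case False
      with cl have "\<forall>\<^sub>F w in nhds z. w \<in> - A" by (intro eventually_nhds_in_open) auto
      then show ?thesis by eventually_elim auto
    qed
    have B: "\<forall>\<^sub>F w in nhds z. w \<in> B \<longrightarrow> u w = u z \<otimes> D (f z) (f w)"
    proof (cases "z \<in> B")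
      case True
      with flatD(2)[OF t' True] show ?thesis by (simp add: uB)
    next
      case False
      with cl have "\<forall>\<^sub>F w in nhds z. w \<in> - B" by (intro eventually_nhds_in_open) auto
      then show ?thesis by eventually_elim auto
    qed
    show "\<forall>\<^sub>F w in nhds z. w \<in> A \<union> B \<longrightarrow> u w = u z \<otimes> D (f z) (f w)"
      using A B by eventually_elim auto
  qed
  with that show ?thesis .
qed

text \<open>Sections over adjacent rectangles can be glued because rectangles meet along a segment, so
  bisection applies. It is used in one coordinate at a time: here along a strip whose width \<open>d\<close> may
  shrink in each step, and below across the strips.\<close>
lemma flat_strip:
  fixes f :: "real \<times> real \<Rightarrow> 'a"
  assumes f: "continuous_on ({0..1} \<times> {0..1}) f" and x: "x \<in> {0..1}"
  obtains d s where "d > 0" "flat G D f (({0..1} \<inter> {x-d..x+d}) \<times> {0..1}) s"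
proof -
  define Q where "Q c e \<longleftrightarrow>
    (\<exists>d>0. \<exists>s. flat G D f (({0..1} \<inter> {x-d..x+d}) \<times> ({0..1} \<inter> {c..e})) s)" for c e
  have "(0::real) \<le> 1" by simp
  then have "Q 0 1"
  proof (induction rule: Bolzano)
    case (trans a b c)
    then obtain d d' s s' where d: "d > 0" "d' > 0"
      and s: "flat G D f (({0..1} \<inter> {x-d..x+d}) \<times> ({0..1} \<inter> {a..b})) s"
      and s': "flat G D f (({0..1} \<inter> {x-d'..x+d'}) \<times> ({0..1} \<inter> {b..c})) s'"
      unfolding Q_def by blast
    (* Both sections are restricted to the narrower strip before they are glued. *)
    define m where "m = min d d'"
    define I where "I = {0..1} \<inter> {x-m..x+m}"
    have t: "flat G D f (I \<times> ({0..1} \<inter> {a..b})) s" "flat G D f (I \<times> ({0..1} \<inter> {b..c})) s'"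
      by (rule flat_subset[OF s] flat_subset[OF s']; auto simp: I_def m_def)+
    have eq: "I \<times> ({0..1} \<inter> {a..b}) \<inter> I \<times> ({0..1} \<inter> {b..c}) = I \<times> ({0..1} \<inter> {a..b} \<inter> {b..c})"
      by auto
    have conn: "connected (I \<times> ({0..1} \<inter> {a..b}) \<inter> I \<times> ({0..1} \<inter> {b..c}))"
      unfolding eq unfolding I_def
      by (intro convex_connected convex_Times convex_Int convex_real_interval)
    have "closed (I \<times> ({0..1} \<inter> {y..z}))" for y z :: real
      unfolding I_def by (intro closed_Times closed_Int closed_atLeastAtMost)
    from flat_glue[OF this this conn t] obtain u where
      "flat G D f (I \<times> ({0..1} \<inter> {a..b}) \<union> I \<times> ({0..1} \<inter> {b..c})) u" .
    moreover have "I \<times> ({0..1} \<inter> {a..c}) \<subseteq> I \<times> ({0..1} \<inter> {a..b}) \<union> I \<times> ({0..1} \<inter> {b..c})"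
      by auto
    ultimately have "flat G D f (I \<times> ({0..1} \<inter> {a..c})) u" using flat_subset by blast
    with d show ?case unfolding Q_def I_def by (intro exI[of _ m]) (auto simp: m_def)
  next
    case (local y)
    with x have z: "(x, y) \<in> {0..1} \<times> {0..1}" by auto
    obtain T where T: "open T" "(x, y) \<in> T"
      "flat G D f (({0..1} \<times> {0..1}) \<inter> T) (\<lambda>w. D (f (x, y)) (f w))"
      using flat_local[OF f z] .
    then obtain A B where AB: "open A" "open B" "x \<in> A" "y \<in> B" "A \<times> B \<subseteq> T"
      by (metis mem_Sigma_iff open_prod_elim)
    then obtain d e where de: "d > 0" "cball x d \<subseteq> A" "e > 0" "cball y e \<subseteq> B"
      by (meson open_contains_cball)
    have "Q a b" if ab: "a \<le> y" "y \<le> b" "b - a < e" for a b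
      unfolding Q_def
    proof (intro exI[of _ d] conjI exI)
      show "flat G D f (({0..1} \<inter> {x-d..x+d}) \<times> ({0..1} \<inter> {a..b})) (\<lambda>w. D (f (x, y)) (f w))"
      proof (rule flat_subset[OF T(3)])
        have "{x-d..x+d} \<subseteq> cball x d" "{a..b} \<subseteq> cball y e"
          using ab by (auto simp: dist_real_def)
        with AB de show "({0..1} \<inter> {x-d..x+d}) \<times> ({0..1} \<inter> {a..b}) \<subseteq> ({0..1} \<times> {0..1}) \<inter> T"
          by blast
      qed
    qed (use de in auto)
    with de show ?case by blast
  qed
  with that show ?thesis unfolding Q_def by auto
qed

lemma flat_square:
  fixes f :: "real \<times> real \<Rightarrow> 'a"
  assumes f: "continuous_on ({0..1} \<times> {0..1}) f"
  obtains s where "flat G D f ({0..1} \<times> {0..1}) s"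
proof -
  define P where "P a b \<longleftrightarrow> (\<exists>s. flat G D f (({0..1} \<inter> {a..b}) \<times> {0..1}) s)" for a b
  have "(0::real) \<le> 1" by simp
  then have "P 0 1"
  proof (induction rule: Bolzano)
    case (trans a b c)
    then obtain s s' where s: "flat G D f (({0..1} \<inter> {a..b}) \<times> {0..1}) s"
      "flat G D f (({0..1} \<inter> {b..c}) \<times> {0..1}) s'" unfolding P_def by blast
    have eq: "({0..1} \<inter> {a..b}) \<times> {0..1} \<inter> ({0..1} \<inter> {b..c}) \<times> {0..1}
        = ({0..1} \<inter> {a..b} \<inter> {b..c}) \<times> {0..1::real}"
      by auto
    have conn: "connected (({0..1} \<inter> {a..b}) \<times> {0..1::real} \<inter> ({0..1} \<inter> {b..c}) \<times> {0..1})"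
      unfolding eq by (intro convex_connected convex_Times convex_Int convex_real_interval)
    have "closed (({0..1} \<inter> {y..z}) \<times> {0..1::real})" for y z :: real
      by (intro closed_Times closed_Int closed_atLeastAtMost)
    from flat_glue[OF this this conn s] obtain u where
      "flat G D f (({0..1} \<inter> {a..b}) \<times> {0..1} \<union> ({0..1} \<inter> {b..c}) \<times> {0..1}) u" .
    then have "flat G D f (({0..1} \<inter> {a..c}) \<times> {0..1}) u"
      by (rule flat_subset) auto
    then show ?case unfolding P_def by blast
  next
    case (local x)
    then obtain d s where d: "d > 0" and s: "flat G D f (({0..1} \<inter> {x-d..x+d}) \<times> {0..1}) s"
      using flat_strip[OF f, of x] by auto
    have "P a b" if "a \<le> x" "x \<le> b" "b - a < d" for a b
      unfolding P_def
      by (intro exI[of _ s] flat_subset[OF s]) (use that in auto)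
    with d show ?case by blast
  qed
  with that show ?thesis unfolding P_def by auto
qed

end

text \<open>The flat section along \<open>p\<close> that starts at the unit is unique; for a path it also exists.\<close>
definition transport where
  "transport G D p = (THE g. \<exists>s. flat G D p {0..1::real} s \<and> s 0 = \<one>\<^bsub>G\<^esub> \<and> s 1 = g)"

context local_system
begin

lemma flat_path:
  assumes "path p"
  obtains s where "flat G D p {0..1} s" "s 0 = \<one>"
proof -
  have "continuous_on ({0..1} \<times> {0..1}) (\<lambda>z::real \<times> real. p (snd z))"
    by (rule continuous_on_compose2[OF assms[unfolded path_def]]) (auto intro!: continuous_intros)
  from flat_square[OF this] obtain s
    where s: "flat G D (\<lambda>z::real \<times> real. p (snd z)) ({0..1} \<times> {0..1}) s" .
  have s': "flat G D p {0..1} (\<lambda>t. s (0::real, t))"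
    using flat_compose[OF s, of "{0..1}" "\<lambda>t. (0, t)"] by (simp add: continuous_on_Pair image_subset_iff)
  have c: "s (0, 0) \<in> carrier G" using flatD(1)[OF s, of "(0, 0)"] by simp
  show ?thesis
    by (rule that[OF flat_lmult[OF s', of "inv s (0, 0)"]]) (use c in auto)
qed

lemma transport_eqI:
  assumes s: "flat G D p {0..1} s" "s 0 = \<one>"
  shows "transport G D p = s 1"
  unfolding transport_def
proof (rule the_equality)
  fix g assume "\<exists>s. flat G D p {0..1} s \<and> s 0 = \<one> \<and> s 1 = g"
  then obtain t where "flat G D p {0..1} t" "t 0 = \<one>" "t 1 = g" by blast
  with s flat_unique[OF connected_Icc, of p 0 1 t s 0 1] show "g = s 1" by simp
qed (use s in blast)

lemma transport_flat:
  assumes s: "flat G D p {0..1} s"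
  shows "s 1 = s 0 \<otimes> transport G D p"
proof -
  have c: "s 0 \<in> carrier G" "s 1 \<in> carrier G" using flatD(1)[OF s] by auto
  have "transport G D p = inv s 0 \<otimes> s 1"
    by (rule transport_eqI[OF flat_lmult[OF s]]) (use c in auto)
  with c show ?thesis by (simp add: m_assoc[symmetric])
qed

lemma transport_closed [simp]: "path p \<Longrightarrow> transport G D p \<in> carrier G"
  by (metis flat_path transport_eqI flatD(1) atLeastAtMost_iff order_refl zero_le_one)

lemma transport_const: "transport G D (\<lambda>_. x) = \<one>"
  by (rule transport_eqI) (auto simp: flat_def)

lemma transport_short:
  assumes N: "flat G D (\<lambda>q. q) N (D p)" and e: "path e" "path_image e \<subseteq> N" "pathstart e = p"
  shows "transport G D e = D p (pathfinish e)"
proof -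
  have "flat G D e {0..1} (\<lambda>t. D p (e t))"
    using flat_compose[OF N, of "{0..1}" e] e by (auto simp: path_def path_image_def)
  from transport_eqI[OF this] e show ?thesis by (simp add: pathfinish_def pathstart_def)
qed

lemma transport_join:
  assumes p: "path p" "path q" "pathfinish p = pathstart q"
  shows "transport G D (p +++ q) = transport G D p \<otimes> transport G D q"
proof -
  obtain s where s: "flat G D (p +++ q) {0..1} s" "s 0 = \<one>"
    using flat_path[of "p +++ q"] p by auto
  have "flat G D (\<lambda>t. (p +++ q) (t/2)) {0..1} (\<lambda>t. s (t/2))"
    by (rule flat_compose[OF s(1)]) (auto intro!: continuous_intros)
  then have "flat G D p {0..1} (\<lambda>t. s (t/2))"
    by (rule flat_cong) (auto simp: joinpaths_def)
  then have 1: "transport G D p = s (1/2)"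
    by (subst transport_eqI) (use s in auto)
  have j: "(p +++ q) ((t+1)/2) = q t" if "t \<in> {0..1}" for t
  proof (cases "t = 0")
    case True
    with p show ?thesis by (simp add: joinpaths_def pathstart_def pathfinish_def)
  qed (use that in \<open>auto simp: joinpaths_def field_simps\<close>)
  have "flat G D (\<lambda>t. (p +++ q) ((t+1)/2)) {0..1} (\<lambda>t. s ((t+1)/2))"
    by (rule flat_compose[OF s(1)]) (auto intro!: continuous_intros)
  then have "flat G D q {0..1} (\<lambda>t. s ((t+1)/2))"
    by (rule flat_cong) (rule j)
  from transport_flat[OF this] have "s 1 = s (1/2) \<otimes> transport G D q" by simp
  with 1 transport_eqI[OF s] show ?thesis by simp
qed

text \<open>The homotopy moves neither end point, so a flat section over the square is constant on the two
  edges that correspond to the end points. The other two edges then have the same transport.\<close>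
lemma transport_homotopic:
  assumes "homotopic_paths S p q"
  shows "transport G D p = transport G D q"
proof -
  obtain h :: "real \<times> real \<Rightarrow> 'a" where h: "continuous_on ({0..1} \<times> {0..1}) h"
    "\<And>x. x \<in> {0..1} \<Longrightarrow> h (0, x) = p x" "\<And>x. x \<in> {0..1} \<Longrightarrow> h (1, x) = q x"
    "\<And>t. t \<in> {0..1} \<Longrightarrow> h (t, 0) = pathstart p" "\<And>t. t \<in> {0..1} \<Longrightarrow> h (t, 1) = pathfinish p"
    using assms unfolding homotopic_paths by (auto simp: pathstart_def pathfinish_def)
  obtain s where s: "flat G D h ({0..1} \<times> {0..1}) s" using flat_square[OF h(1)] .
  have c: "s (t, x) \<in> carrier G" if "t \<in> {0..1}" "x \<in> {0..1}" for t x
    using flatD(1)[OF s] that by auto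
  (* Applied to x = 0 and x = 1, where the homotopy is constant in t. *)
  have side: "s (1, x) = s (0, x)" if x: "x \<in> {0..1}" "\<And>t. t \<in> {0..1} \<Longrightarrow> h (t, x) = h (0, x)" for x
  proof -
    have "flat G D (\<lambda>t. h (t, x)) {0..1} (\<lambda>t. s (t, x))"
      by (rule flat_compose[OF s]) (use x(1) in \<open>auto intro!: continuous_intros\<close>)
    then have "flat G D (\<lambda>t. h (0, x)) {0..1} (\<lambda>t. s (t, x))"
      by (rule flat_cong) (rule x)
    from transport_flat[OF this] show ?thesis using c x(1) by (simp add: transport_const)
  qed
  have edge: "s (t, 1) = s (t, 0) \<otimes> transport G D r"
    if t: "t \<in> {0..1}" and r: "\<And>x. x \<in> {0..1} \<Longrightarrow> h (t, x) = r x" for t r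
  proof -
    have "flat G D (\<lambda>x. h (t, x)) {0..1} (\<lambda>x. s (t, x))"
      by (rule flat_compose[OF s]) (use t in \<open>auto intro!: continuous_intros\<close>)
    then have "flat G D r {0..1} (\<lambda>x. s (t, x))"
      by (rule flat_cong) (rule r)
    from transport_flat[OF this] show ?thesis .
  qed
  have pq: "path p" "path q" using assms homotopic_paths_imp_path by auto
  have "s (0, 0) \<otimes> transport G D p = s (0, 0) \<otimes> transport G D q"
  proof -
    have "s (0, 1) = s (0, 0) \<otimes> transport G D p" by (rule edge) (use h(2) in auto)
    moreover have "s (1, 1) = s (1, 0) \<otimes> transport G D q" by (rule edge) (use h(3) in auto)
    moreover have "s (1, 0) = s (0, 0)" by (rule side) (use h(4) in auto)
    moreover have "s (1, 1) = s (0, 1)" by (rule side) (use h(5) in auto)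
    ultimately show ?thesis by metis
  qed
  with c pq show ?thesis by (metis l_cancel transport_closed atLeastAtMost_iff order_refl zero_le_one)
qed

lemma transport_reversepath:
  assumes p: "path p"
  shows "transport G D (reversepath p) = inv transport G D p"
proof -
  obtain s where s: "flat G D p {0..1} s" "s 0 = \<one>" using flat_path[OF p] .
  have "flat G D (\<lambda>t. p (1 - t)) {0..1} (\<lambda>t. s (1 - t))"
    by (rule flat_compose[OF s(1)]) (auto intro!: continuous_intros)
  then have "flat G D (reversepath p) {0..1} (\<lambda>t. s (1 - t))"
    by (simp add: reversepath_def)
  from transport_flat[OF this] transport_eqI[OF s] s(2)
  have "transport G D p \<otimes> transport G D (reversepath p) = \<one>" by simp
  then have "inv (transport G D (reversepath p)) = transport G D p"
    by (rule inv_equality) (use p in simp_all)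
  then show ?thesis using p by (metis inv_inv path_reversepath transport_closed)
qed

end

text \<open>If \<open>s\<close> is flat for \<open>D\<close> along the path, then \<open>s\<close> times the inverse of \<open>e\<close> is flat for \<open>E\<close>.\<close>
lemma (in local_system) transport_gauge:
  assumes E: "local_system G E" and e [simp]: "\<And>p. e p \<in> carrier G"
    and DE: "\<And>p. \<forall>\<^sub>F q in nhds p. E p q = e p \<otimes> D p q \<otimes> inv e q"
    and \<gamma>: "path \<gamma>"
  shows "transport G E \<gamma> = e (pathstart \<gamma>) \<otimes> transport G D \<gamma> \<otimes> inv e (pathfinish \<gamma>)"
proof -
  interpret E: local_system G E by (rule E)
  obtain s where s: "flat G D \<gamma> {0..1} s" "s 0 = \<one>" using flat_path[OF \<gamma>] .
  define u where "u t = e (pathstart \<gamma>) \<otimes> s t \<otimes> inv e (\<gamma> t)" for t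
  have "flat G E \<gamma> {0..1} u"
    unfolding flat_def
  proof (intro ballI conjI)
    fix z :: real assume z: "z \<in> {0..1}"
    note sz = flatD[OF s(1) z]
    show "u z \<in> carrier G" using sz by (simp add: u_def)
    have "\<forall>\<^sub>F w in nhds z. w \<in> {0..1} \<longrightarrow> E (\<gamma> z) (\<gamma> w) = e (\<gamma> z) \<otimes> D (\<gamma> z) (\<gamma> w) \<otimes> inv e (\<gamma> w)"
      using \<gamma> z by (intro continuous_on_eventually_nhds[OF _ _ DE]) (auto simp: path_def)
    with sz(2) show "\<forall>\<^sub>F w in nhds z. w \<in> {0..1} \<longrightarrow> u w = u z \<otimes> E (\<gamma> z) (\<gamma> w)"
    proof eventually_elim
      case (elim w)
      show ?case
      proof
        assume w: "w \<in> {0..1}"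
        show "u w = u z \<otimes> E (\<gamma> z) (\<gamma> w)"
          unfolding u_def mp[OF elim(1) w] mp[OF elim(2) w]
          using sz(1) by (simp add: m_assoc group_cancel)
      qed
    qed
  qed
  from E.transport_flat[OF this] transport_eqI[OF s] s(2) \<gamma>
  have "e (pathstart \<gamma>) \<otimes> transport G D \<gamma> \<otimes> inv e (pathfinish \<gamma>) = transport G E \<gamma>"
    by (simp add: u_def pathstart_def pathfinish_def)
  then show ?thesis by simp
qed

section \<open>Twisted local systems\<close>

text \<open>The left structure of a bitorsor, recorded at the chosen point of each fibre by
  \<open>g \<cdot> u p = u p \<cdot> a p g\<close>. Replacing \<open>u p\<close> by \<open>u p \<cdot> D p q\<close> conjugates the automorphism.\<close>
locale twisted_local_system = local_system G D
  for G :: "('g, 'm) monoid_scheme" (structure) and D :: "'a::topological_space \<Rightarrow> 'a \<Rightarrow> 'g" +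
  fixes a :: "'a \<Rightarrow> 'g \<Rightarrow> 'g"
  assumes a_auto: "a p \<in> auto G"
    and a_twist: "\<forall>\<^sub>F q in nhds p. \<forall>g\<in>carrier G. a p g = D p q \<otimes> a q g \<otimes> inv D p q"
begin

lemma a_hom: "a p \<in> hom G G" using a_auto by (simp add: auto_def)

lemma a_closed [simp]: "g \<in> carrier G \<Longrightarrow> a p g \<in> carrier G"
  using a_hom by (auto simp: hom_def)

lemma a_mult: "g \<in> carrier G \<Longrightarrow> h \<in> carrier G \<Longrightarrow> a p (g \<otimes> h) = a p g \<otimes> a p h"
  using a_hom by (auto simp: hom_def)

lemma a_one [simp]: "a p \<one> = \<one>"
  using a_hom hom_one is_group by blast

lemma a_surj: "h \<in> carrier G \<Longrightarrow> \<exists>g\<in>carrier G. a p g = h"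
  using a_auto[of p] unfolding auto_def Bij_def bij_betw_def by (metis (mono_tags, lifting) IntD2 imageE mem_Collect_eq)

text \<open>For a flat section \<open>s\<close>, the conjugate of \<open>a g\<close> by \<open>s\<close> is locally constant along the path.\<close>
lemma twist_transport:
  assumes \<gamma>: "path \<gamma>" and g: "g \<in> carrier G"
  shows "a (pathstart \<gamma>) g = transport G D \<gamma> \<otimes> a (pathfinish \<gamma>) g \<otimes> inv transport G D \<gamma>"
proof -
  obtain s where s: "flat G D \<gamma> {0..1} s" "s 0 = \<one>" using flat_path[OF \<gamma>] .
  have "s 0 \<otimes> a (\<gamma> 0) g \<otimes> inv s 0 = s 1 \<otimes> a (\<gamma> 1) g \<otimes> inv s 1"
  proof (rule eventually_constant_on_connected[OF connected_Icc[of "0::real" 1]])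
    fix z :: real assume z: "z \<in> {0..1}"
    note sz = flatD[OF s(1) z]
    have "\<forall>\<^sub>F w in nhds z. w \<in> {0..1} \<longrightarrow>
        (\<forall>g\<in>carrier G. a (\<gamma> z) g = D (\<gamma> z) (\<gamma> w) \<otimes> a (\<gamma> w) g \<otimes> inv D (\<gamma> z) (\<gamma> w))"
      using \<gamma> z by (intro continuous_on_eventually_nhds[OF _ _ a_twist]) (auto simp: path_def)
    with sz(2) show "\<forall>\<^sub>F w in nhds z. w \<in> {0..1} \<longrightarrow>
        s w \<otimes> a (\<gamma> w) g \<otimes> inv s w = s z \<otimes> a (\<gamma> z) g \<otimes> inv s z"
    proof eventually_elim
      case (elim w)
      show ?case
      proof
        assume w: "w \<in> {0..1}"
        show "s w \<otimes> a (\<gamma> w) g \<otimes> inv s w = s z \<otimes> a (\<gamma> z) g \<otimes> inv s z"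
          unfolding mp[OF elim(1) w] bspec[OF mp[OF elim(2) w] g]
          using sz(1) g by (simp add: m_assoc inv_mult_group)
      qed
    qed
  qed auto
  with transport_eqI[OF s] s(2) g show ?thesis by (simp add: pathstart_def pathfinish_def)
qed

text \<open>Around a loop, \<open>a\<close> comes back to itself conjugated by the transport, and its values are all of \<open>G\<close>.\<close>
lemma transport_loop_central:
  assumes \<gamma>: "path \<gamma>" "pathfinish \<gamma> = pathstart \<gamma>" and g: "g \<in> carrier G"
  shows "transport G D \<gamma> \<otimes> g = g \<otimes> transport G D \<gamma>"
proof -
  obtain h where h: "h \<in> carrier G" "a (pathstart \<gamma>) h = g" using a_surj[OF g] by blast
  have "g = transport G D \<gamma> \<otimes> g \<otimes> inv transport G D \<gamma>"
    using twist_transport[OF \<gamma>(1) h(1)] \<gamma> h by simp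
  then have "g \<otimes> transport G D \<gamma> = transport G D \<gamma> \<otimes> g \<otimes> inv transport G D \<gamma> \<otimes> transport G D \<gamma>"
    by simp
  with g \<gamma> show ?thesis by (simp add: m_assoc)
qed

text \<open>Contracted product of bitorsors: if \<open>s\<close> is flat for \<open>D\<close> and \<open>t\<close> is flat for \<open>E\<close>, then \<open>s\<close> times
  the image of \<open>t\<close> under \<open>a\<close> is flat for \<open>F\<close>, because moving \<open>t\<close> past the factor \<open>D\<close> turns one value of
  \<open>a\<close> into the next.\<close>
lemma transport_product:
  assumes E: "local_system G E" and F: "local_system G F"
    and DEF: "\<And>p. \<forall>\<^sub>F q in nhds p. F p q = D p q \<otimes> a q (E p q)"
    and \<gamma>: "path \<gamma>"
  shows "transport G F \<gamma> = transport G D \<gamma> \<otimes> a (pathfinish \<gamma>) (transport G E \<gamma>)"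
proof -
  interpret E: local_system G E by (rule E)
  interpret F: local_system G F by (rule F)
  obtain s where s: "flat G D \<gamma> {0..1} s" "s 0 = \<one>" using flat_path[OF \<gamma>] .
  obtain t where t: "flat G E \<gamma> {0..1} t" "t 0 = \<one>" using E.flat_path[OF \<gamma>] .
  define u where "u x = s x \<otimes> a (\<gamma> x) (t x)" for x
  have "flat G F \<gamma> {0..1} u"
    unfolding flat_def
  proof (intro ballI conjI)
    fix z :: real assume z: "z \<in> {0..1}"
    note sz = flatD[OF s(1) z] and tz = flatD[OF t(1) z]
    show "u z \<in> carrier G" using sz tz by (simp add: u_def)
    have "\<forall>\<^sub>F w in nhds z. w \<in> {0..1} \<longrightarrow>
        (\<forall>g\<in>carrier G. a (\<gamma> z) g = D (\<gamma> z) (\<gamma> w) \<otimes> a (\<gamma> w) g \<otimes> inv D (\<gamma> z) (\<gamma> w))"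
      "\<forall>\<^sub>F w in nhds z. w \<in> {0..1} \<longrightarrow>
        F (\<gamma> z) (\<gamma> w) = D (\<gamma> z) (\<gamma> w) \<otimes> a (\<gamma> w) (E (\<gamma> z) (\<gamma> w))"
      using \<gamma> z by (intro continuous_on_eventually_nhds[OF _ _ a_twist]
          continuous_on_eventually_nhds[OF _ _ DEF]; simp add: path_def)+
    with sz(2) tz(2) show "\<forall>\<^sub>F w in nhds z. w \<in> {0..1} \<longrightarrow> u w = u z \<otimes> F (\<gamma> z) (\<gamma> w)"
    proof eventually_elim
      case (elim w)
      show ?case
      proof
        assume w: "w \<in> {0..1}"
        show "u w = u z \<otimes> F (\<gamma> z) (\<gamma> w)"
          unfolding u_def mp[OF elim(1) w] mp[OF elim(2) w] mp[OF elim(4) w]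
            bspec[OF mp[OF elim(3) w] tz(1)]
          using sz(1) tz(1) by (simp add: a_mult m_assoc group_cancel)
      qed
    qed
  qed
  from F.transport_flat[OF this] transport_eqI[OF s] E.transport_eqI[OF t] s(2) t(2) \<gamma>
  have "transport G D \<gamma> \<otimes> a (pathfinish \<gamma>) (transport G E \<gamma>) = transport G F \<gamma>"
    by (simp add: u_def pathstart_def pathfinish_def)
  then show ?thesis by simp
qed

end

section \<open>Homotopies of paths\<close>

text \<open>Linear interpolation between \<open>f\<close> and \<open>g\<close>. The parametrisations need not be monotone, so
  cancelling a path against its reverse is a case of this lemma.\<close>
lemma homotopic_paths_reparametrizations:
  fixes p :: "real \<Rightarrow> 'a::topological_space"
  assumes p: "path p"
    and f: "continuous_on {0..1} f" "f ` {0..1} \<subseteq> {0..1}"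
    and g: "continuous_on {0..1} g" "g ` {0..1} \<subseteq> {0..1}"
    and fg: "f 0 = g 0" "f 1 = g 1"
  shows "homotopic_paths UNIV (\<lambda>x. p (f x)) (\<lambda>x. p (g x))"
proof -
  define k where "k z = (1 - fst z) * f (snd z) + fst z * g (snd z)" for z :: "real \<times> real"
  have ck: "continuous_on ({0..1} \<times> {0..1}) k"
    unfolding k_def
    by (intro continuous_intros continuous_on_compose2[OF f(1)] continuous_on_compose2[OF g(1)]) auto
  have k: "k ` ({0..1} \<times> {0..1}) \<subseteq> {0..1}"
  proof clarify
    fix t x :: real assume tx: "t \<in> {0..1}" "x \<in> {0..1}"
    then have "f x \<in> {0..1}" "g x \<in> {0..1}" using f g by blast+
    with tx show "k (t, x) \<in> {0..1}"
      by (auto simp: k_def intro!: convex_bound_le add_nonneg_nonneg mult_nonneg_nonneg)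
  qed
  have "continuous_on ({0..1} \<times> {0..1}) (\<lambda>z. p (k z))"
    by (rule continuous_on_compose2[OF p[unfolded path_def] ck k])
  moreover have "k (0, x) = f x" "k (1, x) = g x" for x by (simp_all add: k_def)
  moreover have "k (t, 0) = f 0" "k (t, 1) = f 1" for t by (simp_all add: k_def fg algebra_simps)
  ultimately show ?thesis
    unfolding homotopic_paths
    by (intro exI[of _ "\<lambda>z. p (k z)"]) (simp add: pathstart_def pathfinish_def)
qed

lemma path_constant [simp]: "path (\<lambda>_. x)"
  by (simp add: path_def)

lemma homotopic_paths_reverse_join:
  fixes p :: "real \<Rightarrow> 'a::topological_space"
  assumes p: "path p"
  shows "homotopic_paths UNIV (reversepath p +++ p) (\<lambda>_. pathfinish p)"
proof -
  have "homotopic_paths UNIV (\<lambda>x. p \<bar>1 - 2 * x\<bar>) (\<lambda>x. p 1)"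
    by (rule homotopic_paths_reparametrizations[OF p, of _ "\<lambda>_. 1"])
       (auto intro!: continuous_intros)
  moreover have "(\<lambda>x. p \<bar>1 - 2 * x\<bar>) = reversepath p +++ p"
    by (auto simp: fun_eq_iff joinpaths_def reversepath_def abs_if)
  ultimately show ?thesis by (simp add: pathfinish_def)
qed

lemma homotopic_paths_const_join:
  fixes p :: "real \<Rightarrow> 'a::topological_space"
  assumes p: "path p"
  shows "homotopic_paths UNIV ((\<lambda>_. pathstart p) +++ p) p"
proof -
  have "homotopic_paths UNIV (\<lambda>x. p (max 0 (2 * x - 1))) (\<lambda>x. p x)"
    by (rule homotopic_paths_reparametrizations[OF p]) (auto intro!: continuous_intros)
  moreover have "(\<lambda>x. p (max 0 (2 * x - 1))) = (\<lambda>_. pathstart p) +++ p"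
    by (auto simp: fun_eq_iff joinpaths_def pathstart_def max.absorb1 max.absorb2)
  ultimately show ?thesis by simp
qed

lemma homotopic_paths_segments:
  fixes p :: "real \<Rightarrow> 'a::topological_space"
  assumes p: "path p" and uv: "u \<in> {0..1}" "v \<in> {0..1}"
  shows "homotopic_paths UNIV ((\<lambda>x. p (u * x)) +++ (\<lambda>x. p (u + (v - u) * x))) (\<lambda>x. p (v * x))"
proof -
  have "path ((\<lambda>x. u * x) +++ (\<lambda>x. u + (v - u) * x))"
    by (rule path_join_imp) (auto simp: path_def pathstart_def pathfinish_def intro!: continuous_intros)
  then have c: "continuous_on {0..1} ((\<lambda>x. u * x) +++ (\<lambda>x. u + (v - u) * x))"
    by (simp add: path_def)
  have affine: "a + (b - a) * x \<in> {0..1}" if "x \<in> {0..1}" "a \<in> {0..1}" "b \<in> {0..1}" for a b x :: real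
  proof -
    have "a + (b - a) * x = (1 - x) * a + x * b" by (simp add: algebra_simps)
    with that show ?thesis
      by (auto intro!: convex_bound_le add_nonneg_nonneg mult_nonneg_nonneg)
  qed
  have scale: "a * x \<in> {0..1}" if "x \<in> {0..1}" "a \<in> {0..1}" for a x :: real
    using affine[OF that(1), of 0 a] that(2) by simp
  have i: "((\<lambda>x. u * x) +++ (\<lambda>x. u + (v - u) * x)) ` {0..1} \<subseteq> {0..1}"
  proof (rule image_subsetI)
    fix x :: real assume x: "x \<in> {0..1}"
    show "((\<lambda>x. u * x) +++ (\<lambda>x. u + (v - u) * x)) x \<in> {0..1}"
    proof (cases "x \<le> 1/2")
      case True
      with x scale[of "2 * x" u] uv show ?thesis by (simp add: joinpaths_def)
    next
      case False
      with x affine[of "2 * x - 1" u v] uv show ?thesis by (simp add: joinpaths_def)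
    qed
  qed
  have "homotopic_paths UNIV (\<lambda>x. p (((\<lambda>x. u * x) +++ (\<lambda>x. u + (v - u) * x)) x)) (\<lambda>x. p (v * x))"
  proof (rule homotopic_paths_reparametrizations[OF p c i])
    show "continuous_on {0..1} (\<lambda>x. v * x)" by (intro continuous_intros)
    show "(\<lambda>x. v * x) ` {0..1} \<subseteq> {0..1}" using scale uv by blast
  qed (simp_all add: joinpaths_def)
  moreover have "(\<lambda>x. p (((\<lambda>x. u * x) +++ (\<lambda>x. u + (v - u) * x)) x))
      = (\<lambda>x. p (u * x)) +++ (\<lambda>x. p (u + (v - u) * x))"
    by (auto simp: fun_eq_iff joinpaths_def)
  ultimately show ?thesis by simp
qed

section \<open>Functors on paths and the fundamental group\<close>

text \<open>A functor to \<open>G\<close> on the fundamental groupoid, given on paths. It is what the transport of a local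
  system and a homomorphism on the fundamental group have in common.\<close>
locale path_functor = group G
  for G :: "('g, 'm) monoid_scheme" (structure) +
  fixes M :: "(real \<Rightarrow> 'a::topological_space) \<Rightarrow> 'g"
  assumes M_closed [simp]: "path p \<Longrightarrow> M p \<in> carrier G"
    and M_join: "path p \<Longrightarrow> path q \<Longrightarrow> pathfinish p = pathstart q \<Longrightarrow> M (p +++ q) = M p \<otimes> M q"
    and M_homotopic: "homotopic_paths UNIV p q \<Longrightarrow> M p = M q"
begin

lemma M_const [simp]: "M (\<lambda>_. x) = \<one>"
proof -
  have "(\<lambda>_. x) +++ (\<lambda>_. x) = (\<lambda>_. x)" by (simp add: joinpaths_def)
  with M_join[of "\<lambda>_. x" "\<lambda>_. x"] have "M (\<lambda>_. x) = M (\<lambda>_. x) \<otimes> M (\<lambda>_. x)"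
    by (simp add: pathstart_def pathfinish_def)
  then show ?thesis by (metis M_closed path_constant r_cancel_one)
qed

lemma M_reversepath: "path p \<Longrightarrow> M (reversepath p) = inv M p"
  using M_homotopic[OF homotopic_paths_reverse_join, of p] M_join[of "reversepath p" p]
  by (metis M_closed M_const inv_equality path_reversepath pathfinish_reversepath)

end

lemma (in local_system) path_functor_transport: "path_functor G (transport G D)"
  by unfold_locales (auto simp: transport_join intro: transport_homotopic)

abbreviation loops_at where
  "loops_at x0 \<equiv> {p. path p \<and> pathstart p = x0 \<and> pathfinish p = x0}"

lemma equiv_loop_homotopy: "equiv (loops_at x0) (loop_homotopy x0)"
proof (rule equivI)
  show "loop_homotopy x0 \<subseteq> loops_at x0 \<times> loops_at x0"
    by (auto simp: loop_homotopy_def dest: homotopic_paths_imp_path homotopic_paths_imp_pathstart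
        homotopic_paths_imp_pathfinish)
  show "refl_on (loops_at x0) (loop_homotopy x0)" by (auto simp: refl_on_def loop_homotopy_def)
  show "sym (loop_homotopy x0)"
    by (auto simp: sym_def loop_homotopy_def homotopic_paths_sym_eq
        dest: homotopic_paths_imp_pathstart homotopic_paths_imp_pathfinish)
  show "trans (loop_homotopy x0)"
    by (auto simp: trans_def loop_homotopy_def intro: homotopic_paths_trans)
qed

definition loop_class where "loop_class x0 p = loop_homotopy x0 `` {p}"

lemma loop_class_in_carrier: "p \<in> loops_at x0 \<Longrightarrow> loop_class x0 p \<in> carrier (fundamental_group x0)"
  by (auto simp: fundamental_group_def loop_class_def intro!: quotientI)

lemma fundamental_group_cases:
  assumes "A \<in> carrier (fundamental_group x0)"
  obtains p where "p \<in> loops_at x0" "A = loop_class x0 p"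
  using assms by (auto simp: fundamental_group_def loop_class_def elim!: quotientE)

lemma loop_class_eq_iff:
  assumes "p \<in> loops_at x0" "q \<in> loops_at x0"
  shows "loop_class x0 p = loop_class x0 q \<longleftrightarrow> homotopic_paths UNIV p q"
  unfolding loop_class_def using assms eq_equiv_class_iff[OF equiv_loop_homotopy assms]
  by (auto simp: loop_homotopy_def)

lemma loop_class_mult:
  assumes "p \<in> loops_at x0" "q \<in> loops_at x0"
  shows "loop_class x0 p \<otimes>\<^bsub>fundamental_group x0\<^esub> loop_class x0 q = loop_class x0 (p +++ q)"
proof -
  have "congruent2 (loop_homotopy x0) (loop_homotopy x0) (\<lambda>p q. loop_homotopy x0 `` {p +++ q})"
  proof (rule congruent2I')
    fix p p' q q' assume "(p, p') \<in> loop_homotopy x0" "(q, q') \<in> loop_homotopy x0"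
    then have "(p +++ q, p' +++ q') \<in> loop_homotopy x0"
      by (auto simp: loop_homotopy_def intro!: homotopic_paths_join)
    then show "loop_homotopy x0 `` {p +++ q} = loop_homotopy x0 `` {p' +++ q'}"
      by (rule equiv_class_eq[OF equiv_loop_homotopy])
  qed
  from UN_equiv_class2[OF equiv_loop_homotopy equiv_loop_homotopy this assms]
  show ?thesis by (simp add: fundamental_group_def loop_class_def)
qed

lemma fundamental_group_mult_closed:
  assumes "A \<in> carrier (fundamental_group x0)" "B \<in> carrier (fundamental_group x0)"
  shows "A \<otimes>\<^bsub>fundamental_group x0\<^esub> B \<in> carrier (fundamental_group x0)"
proof -
  obtain p where "p \<in> loops_at x0" "A = loop_class x0 p"
    using assms(1) by (rule fundamental_group_cases)
  moreover obtain q where "q \<in> loops_at x0" "B = loop_class x0 q"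
    using assms(2) by (rule fundamental_group_cases)
  ultimately show ?thesis by (simp add: loop_class_mult loop_class_in_carrier)
qed

text \<open>The value on an arbitrary representative: for a homotopy invariant \<open>M\<close> this is the induced map.\<close>
definition on_loop_classes where
  "on_loop_classes x0 M = (\<lambda>A\<in>carrier (fundamental_group x0). M (SOME p. p \<in> A))"

lemma (in path_functor) on_loop_classes_eq:
  assumes p: "p \<in> loops_at x0"
  shows "on_loop_classes x0 M (loop_class x0 p) = M p"
proof -
  have "p \<in> loop_class x0 p" using p by (auto simp: loop_class_def loop_homotopy_def)
  then have "(SOME q. q \<in> loop_class x0 p) \<in> loop_class x0 p" by (rule someI[of "\<lambda>q. q \<in> loop_class x0 p"])
  then have "M (SOME q. q \<in> loop_class x0 p) = M p"
    by (intro M_homotopic[symmetric]) (auto simp: loop_class_def loop_homotopy_def)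
  with p show ?thesis by (simp add: on_loop_classes_def loop_class_in_carrier)
qed

lemma (in path_functor) on_loop_classes_hom:
  assumes central: "\<And>p g. p \<in> loops_at x0 \<Longrightarrow> g \<in> carrier G \<Longrightarrow> M p \<otimes> g = g \<otimes> M p"
  shows "on_loop_classes x0 M \<in> carrier (hom_group (fundamental_group x0) (center_group G))"
proof -
  have "on_loop_classes x0 M \<in> hom (fundamental_group x0) (center_group G)"
  proof (rule homI)
    fix A assume "A \<in> carrier (fundamental_group x0)"
    then obtain p where p: "p \<in> loops_at x0" "A = loop_class x0 p" by (rule fundamental_group_cases)
    with central[of p] show "on_loop_classes x0 M A \<in> carrier (center_group G)"
      by (simp add: on_loop_classes_eq center_group_def)
  next
    fix A B assume AB: "A \<in> carrier (fundamental_group x0)" "B \<in> carrier (fundamental_group x0)"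
    obtain p where p: "p \<in> loops_at x0" "A = loop_class x0 p"
      using AB(1) by (rule fundamental_group_cases)
    obtain q where q: "q \<in> loops_at x0" "B = loop_class x0 q"
      using AB(2) by (rule fundamental_group_cases)
    note pq = p q
    then have "p +++ q \<in> loops_at x0" by auto
    with pq show "on_loop_classes x0 M (A \<otimes>\<^bsub>fundamental_group x0\<^esub> B)
        = on_loop_classes x0 M A \<otimes>\<^bsub>center_group G\<^esub> on_loop_classes x0 M B"
      by (simp add: loop_class_mult on_loop_classes_eq M_join center_group_def)
  qed
  then show ?thesis by (simp add: hom_group_def on_loop_classes_def)
qed

text \<open>Choose a path \<open>c x\<close> from the base point to every \<open>x\<close>, and close up a path \<open>p\<close> from \<open>x\<close> to \<open>y\<close> to
  the loop that runs through \<open>c x\<close>, \<open>p\<close> and the reverse of \<open>c y\<close>. In a composition the inner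
  detour cancels. For a loop \<open>p\<close> at the base point the detour conjugates by the value on \<open>c x0\<close>,
  which has no effect as the values are central.\<close>
lemma extend_to_path_functor:
  fixes G (structure) and x0 :: "'a::topological_space"
  assumes G: "group G"
    and conn: "\<And>x::'a. \<exists>p. path p \<and> pathstart p = x0 \<and> pathfinish p = x"
    and m: "m \<in> carrier (hom_group (fundamental_group x0) (center_group G))"
  obtains M where "path_functor G M"
    "\<And>p g. path p \<Longrightarrow> g \<in> carrier G \<Longrightarrow> M p \<otimes> g = g \<otimes> M p"
    "on_loop_classes x0 M = m"
proof -
  interpret group G by (rule G)
  from conn have "\<forall>x. \<exists>p. path p \<and> pathstart p = x0 \<and> pathfinish p = x" by blast
  from choice[OF this] obtain c where
    c: "\<And>x. path (c x)" "\<And>x. pathstart (c x) = x0" "\<And>x. pathfinish (c x) = x" by blast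
  define L where "L p = m (loop_class x0 p)" for p
  have L_closed: "L p \<in> carrier G" and L_central: "\<And>g. g \<in> carrier G \<Longrightarrow> L p \<otimes> g = g \<otimes> L p"
    if "p \<in> loops_at x0" for p
    using m loop_class_in_carrier[OF that]
    by (auto simp: hom_group_def hom_def center_group_def L_def Pi_iff)
  have L_join: "L (p +++ q) = L p \<otimes> L q" if "p \<in> loops_at x0" "q \<in> loops_at x0" for p q
    using m that loop_class_in_carrier[OF that(1)] loop_class_in_carrier[OF that(2)]
    by (simp add: hom_group_def hom_def center_group_def L_def flip: loop_class_mult)
  have L_homotopic: "L p = L q" if "homotopic_paths UNIV p q" "p \<in> loops_at x0" for p q
  proof -
    have "q \<in> loops_at x0"
      using that by (auto dest: homotopic_paths_imp_path homotopic_paths_imp_pathstart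
          homotopic_paths_imp_pathfinish)
    from loop_class_eq_iff[OF that(2) this] that(1) show ?thesis by (simp add: L_def)
  qed
  define l where "l p = c (pathstart p) +++ (p +++ reversepath (c (pathfinish p)))" for p
  have l_loop: "l p \<in> loops_at x0" if "path p" for p using that c by (simp add: l_def)
  have M: "path_functor G (\<lambda>p. L (l p))"
  proof unfold_locales
    fix p :: "real \<Rightarrow> 'a" assume "path p"
    then show "L (l p) \<in> carrier G" by (intro L_closed l_loop)
  next
    fix p q :: "real \<Rightarrow> 'a" assume pq: "path p" "path q" "pathfinish p = pathstart q"
    define C where "C = c (pathstart q)"
    define A where "A = c (pathstart p)"
    define B where "B = reversepath (c (pathfinish q))"
    have C: "path C" "pathstart C = x0" "pathfinish C = pathstart q" using c by (simp_all add: C_def)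
    have A: "path A" "pathstart A = x0" "pathfinish A = pathstart p" using c by (simp_all add: A_def)
    have B: "path B" "pathstart B = pathfinish q" "pathfinish B = x0" using c by (simp_all add: B_def)
    have "homotopic_paths UNIV (l p +++ l q) (l (p +++ q))"
    proof -
      have 0: "l p +++ l q = (A +++ (p +++ reversepath C)) +++ (C +++ (q +++ B))"
        by (simp add: l_def A_def B_def C_def pq)
      have 1: "homotopic_paths UNIV ((A +++ (p +++ reversepath C)) +++ (C +++ (q +++ B)))
         (A +++ ((p +++ reversepath C) +++ (C +++ (q +++ B))))"
        by (rule homotopic_paths_sym, rule homotopic_paths_assoc) (use pq A B C in auto)
      have 2: "homotopic_paths UNIV ((p +++ reversepath C) +++ (C +++ (q +++ B)))
         (p +++ (reversepath C +++ (C +++ (q +++ B))))"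
        by (rule homotopic_paths_sym, rule homotopic_paths_assoc) (use pq A B C in auto)
      have 3: "homotopic_paths UNIV (reversepath C +++ (C +++ (q +++ B))) 
          ((reversepath C +++ C) +++ (q +++ B))"
        by (rule homotopic_paths_assoc) (use pq A B C in auto)
      have 4: "homotopic_paths UNIV ((reversepath C +++ C) +++ (q +++ B))
          ((\<lambda>_. pathstart (q +++ B)) +++ (q +++ B))"
        using homotopic_paths_reverse_join[OF C(1)] C
        by (intro homotopic_paths_join) (use pq A B C in auto)
      have 5: "homotopic_paths UNIV ((\<lambda>_. pathstart (q +++ B)) +++ (q +++ B)) (q +++ B)"
        by (rule homotopic_paths_const_join) (use pq B in auto)
      have 6: "homotopic_paths UNIV (reversepath C +++ (C +++ (q +++ B))) (q +++ B)"
        using 3 4 5 by (meson homotopic_paths_trans)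
      have 7: "homotopic_paths UNIV (p +++ (reversepath C +++ (C +++ (q +++ B)))) (p +++ (q +++ B))"
        by (rule homotopic_paths_join[OF _ 6]) (use pq A B C in auto)
      have 8: "homotopic_paths UNIV (p +++ (q +++ B)) ((p +++ q) +++ B)"
        by (rule homotopic_paths_assoc) (use pq A B C in auto)
      have 9: "homotopic_paths UNIV ((p +++ reversepath C) +++ (C +++ (q +++ B))) ((p +++ q) +++ B)"
        using 2 7 8 by (meson homotopic_paths_trans)
      have "homotopic_paths UNIV (A +++ ((p +++ reversepath C) +++ (C +++ (q +++ B))))
         (A +++ ((p +++ q) +++ B))"
        by (rule homotopic_paths_join[OF _ 9]) (use pq A B C in auto)
      with 0 1 have "homotopic_paths UNIV (l p +++ l q) (A +++ ((p +++ q) +++ B))"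
        by (metis homotopic_paths_trans)
      then show ?thesis by (simp add: l_def A_def B_def pq)
    qed
    then have "L (l p +++ l q) = L (l (p +++ q))"
      by (rule L_homotopic) (use l_loop[OF pq(1)] l_loop[OF pq(2)] in auto)
    with L_join[OF l_loop[OF pq(1)] l_loop[OF pq(2)]]
    show "L (l (p +++ q)) = L (l p) \<otimes> L (l q)" by simp
  next
    fix p q :: "real \<Rightarrow> 'a" assume h: "homotopic_paths UNIV p q"
    then have e: "pathstart q = pathstart p" "pathfinish q = pathfinish p"
      by (simp_all add: homotopic_paths_imp_pathstart homotopic_paths_imp_pathfinish)
    have pq: "path p" "path q" using homotopic_paths_imp_path[OF h] by auto
    have "homotopic_paths UNIV (l p) (l q)"
      unfolding l_def e by (intro homotopic_paths_join h) (use c pq in auto)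
    then show "L (l p) = L (l q)" by (rule L_homotopic) (rule l_loop[OF pq(1)])
  qed
  interpret M: path_functor G "\<lambda>p. L (l p)" by (rule M)
  have Ll: "L (l p) = L p" if p: "p \<in> loops_at x0" for p
  proof -
    define C where "C = c x0"
    have C: "C \<in> loops_at x0" "reversepath C \<in> loops_at x0" using c by (auto simp: C_def)
    have "L (reversepath C +++ C) = L (\<lambda>_. x0)"
      by (rule L_homotopic) (use homotopic_paths_reverse_join[of C] C in auto)
    also have "\<dots> = \<one>"
    proof -
      have k: "(\<lambda>_. x0) \<in> loops_at x0" by (simp add: pathstart_def pathfinish_def)
      have "(\<lambda>_. x0) +++ (\<lambda>_. x0) = (\<lambda>_. x0)" by (simp add: joinpaths_def)
      with L_join[OF k k] L_closed[OF k] show ?thesis by (metis r_cancel_one)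
    qed
    finally have inv: "L (reversepath C) \<otimes> L C = \<one>" using L_join[OF C(2) C(1)] by simp
    have "L (l p) = L (C +++ (p +++ reversepath C))" using p by (simp add: l_def C_def)
    also have "\<dots> = L C \<otimes> (L p \<otimes> L (reversepath C))"
    proof -
      have "p +++ reversepath C \<in> loops_at x0" using p C by auto
      from L_join[OF C(1) this] L_join[OF p C(2)] show ?thesis by simp
    qed
    also have "\<dots> = L p \<otimes> (L (reversepath C) \<otimes> L C)"
      using L_central[OF C(1)] L_closed[OF p] L_closed[OF C(1)] L_closed[OF C(2)]
      by (simp add: m_assoc)
    finally show ?thesis using inv L_closed[OF p] by simp
  qed
  have "on_loop_classes x0 (\<lambda>p. L (l p)) A = m A" if A: "A \<in> carrier (fundamental_group x0)" for A
  proof -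
    obtain p where p: "p \<in> loops_at x0" "A = loop_class x0 p"
      using A by (rule fundamental_group_cases)
    show ?thesis unfolding p(2) M.on_loop_classes_eq[OF p(1)] Ll[OF p(1)] by (rule L_def)
  qed
  then have "on_loop_classes x0 (\<lambda>p. L (l p)) = m"
    using m by (intro extensionalityI[of _ "carrier (fundamental_group x0)"])
      (auto simp: on_loop_classes_def hom_group_def)
  moreover have "L (l p) \<otimes> g = g \<otimes> L (l p)" if "path p" "g \<in> carrier G" for p g
    using that L_central l_loop by blast
  ultimately show thesis using that M by blast
qed

section \<open>Automorphisms and outer automorphisms of a group\<close>

lemma carrier_AutoGroup: "carrier (AutoGroup G) = auto G"
  by (simp add: AutoGroup_def)

lemma mult_AutoGroup:
  "\<alpha> \<in> auto G \<Longrightarrow> \<beta> \<in> auto G \<Longrightarrow> \<alpha> \<otimes>\<^bsub>AutoGroup G\<^esub> \<beta> = compose (carrier G) \<alpha> \<beta>"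
  by (simp add: AutoGroup_def BijGroup_def auto_def)

lemma one_AutoGroup: "\<one>\<^bsub>AutoGroup G\<^esub> = (\<lambda>x\<in>carrier G. x)"
  by (simp add: AutoGroup_def BijGroup_def)

lemma auto_closed: "\<alpha> \<in> auto G \<Longrightarrow> g \<in> carrier G \<Longrightarrow> \<alpha> g \<in> carrier G"
  by (auto simp: auto_def hom_def)

lemma auto_mult:
  "\<alpha> \<in> auto G \<Longrightarrow> g \<in> carrier G \<Longrightarrow> h \<in> carrier G \<Longrightarrow> \<alpha> (g \<otimes>\<^bsub>G\<^esub> h) = \<alpha> g \<otimes>\<^bsub>G\<^esub> \<alpha> h"
  by (auto simp: auto_def hom_def)

lemma auto_eqI:
  "\<alpha> \<in> auto G \<Longrightarrow> \<beta> \<in> auto G \<Longrightarrow> (\<And>g. g \<in> carrier G \<Longrightarrow> \<alpha> g = \<beta> g) \<Longrightarrow> \<alpha> = \<beta>"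
  by (rule extensionalityI[of _ "carrier G"]) (auto simp: auto_def Bij_def)

lemma autoI:
  assumes "\<alpha> \<in> extensional (carrier G)"
    and "\<And>g. g \<in> carrier G \<Longrightarrow> \<alpha> g \<in> carrier G"
    and "\<And>g h. g \<in> carrier G \<Longrightarrow> h \<in> carrier G \<Longrightarrow> \<alpha> (g \<otimes>\<^bsub>G\<^esub> h) = \<alpha> g \<otimes>\<^bsub>G\<^esub> \<alpha> h"
    and "\<And>g. g \<in> carrier G \<Longrightarrow> \<beta> g \<in> carrier G"
    and "\<And>g. g \<in> carrier G \<Longrightarrow> \<beta> (\<alpha> g) = g"
    and "\<And>g. g \<in> carrier G \<Longrightarrow> \<alpha> (\<beta> g) = g"
  shows "\<alpha> \<in> auto G"
proof -
  have "bij_betw \<alpha> (carrier G) (carrier G)"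
    by (rule bij_betw_byWitness[of _ \<beta>]) (use assms in auto)
  with assms show ?thesis by (auto simp: auto_def Bij_def hom_def)
qed

context group
begin

lemma inner_aut_apply: "h \<in> carrier G \<Longrightarrow> inner_aut G g h = g \<otimes> h \<otimes> inv g"
  by (simp add: inner_aut_def)

lemma inner_aut_auto:
  assumes g: "g \<in> carrier G"
  shows "inner_aut G g \<in> auto G"
proof (rule autoI[where \<beta> = "\<lambda>h. inv g \<otimes> h \<otimes> g"])
  fix h assume "h \<in> carrier G"
  with g show "inv g \<otimes> inner_aut G g h \<otimes> g = h" "inner_aut G g (inv g \<otimes> h \<otimes> g) = h"
    by (simp_all add: inner_aut_apply m_assoc group_cancel)
next
  fix h k assume "h \<in> carrier G" "k \<in> carrier G"
  with g show "inner_aut G g (h \<otimes> k) = inner_aut G g h \<otimes> inner_aut G g k"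
    by (simp add: inner_aut_apply m_assoc group_cancel)
qed (use g in \<open>auto simp: inner_aut_def\<close>)

lemma inner_aut_mult:
  assumes g: "g \<in> carrier G" and h: "h \<in> carrier G"
  shows "inner_aut G g \<otimes>\<^bsub>AutoGroup G\<^esub> inner_aut G h = inner_aut G (g \<otimes> h)"
  unfolding mult_AutoGroup[OF inner_aut_auto[OF g] inner_aut_auto[OF h]]
  using assms by (auto simp: fun_eq_iff compose_def inner_aut_def m_assoc inv_mult_group)

lemma inner_aut_one: "inner_aut G \<one> = \<one>\<^bsub>AutoGroup G\<^esub>"
  by (auto simp: fun_eq_iff inner_aut_def one_AutoGroup)

lemma inner_aut_inv:
  assumes g: "g \<in> carrier G"
  shows "inv\<^bsub>AutoGroup G\<^esub> inner_aut G g = inner_aut G (inv g)"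
proof -
  interpret A: group "AutoGroup G" by (rule AutoGroup)
  show ?thesis
    by (rule A.inv_equality)
       (use g in \<open>simp_all add: inner_aut_mult inner_aut_one inner_aut_auto carrier_AutoGroup\<close>)
qed

text \<open>An automorphism \<open>\<alpha>\<close> conjugates the inner automorphism of \<open>g\<close> to that of \<open>\<alpha> g\<close>.\<close>
lemma inner_aut_normal: "inner_aut G ` carrier G \<lhd> AutoGroup G"
proof -
  interpret A: group "AutoGroup G" by (rule AutoGroup)
  have sub: "subgroup (inner_aut G ` carrier G) (AutoGroup G)"
  proof (rule A.subgroupI)
    show "inner_aut G ` carrier G \<subseteq> carrier (AutoGroup G)"
      by (auto simp: carrier_AutoGroup inner_aut_auto)
    show "inner_aut G ` carrier G \<noteq> {}" by auto
    show "inv\<^bsub>AutoGroup G\<^esub> \<alpha> \<in> inner_aut G ` carrier G" if "\<alpha> \<in> inner_aut G ` carrier G" for \<alpha>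
      using that by (auto simp: inner_aut_inv)
    show "\<alpha> \<otimes>\<^bsub>AutoGroup G\<^esub> \<beta> \<in> inner_aut G ` carrier G"
      if "\<alpha> \<in> inner_aut G ` carrier G" "\<beta> \<in> inner_aut G ` carrier G" for \<alpha> \<beta>
      using that by (auto simp: inner_aut_mult)
  qed
  show ?thesis
  proof (rule A.normal_invI[OF sub])
    fix \<alpha> \<nu> assume \<alpha>: "\<alpha> \<in> carrier (AutoGroup G)" and "\<nu> \<in> inner_aut G ` carrier G"
    then obtain g where g: "g \<in> carrier G" and \<nu>: "\<nu> = inner_aut G g" by auto
    from \<alpha> have \<alpha>': "\<alpha> \<in> auto G" by (simp add: carrier_AutoGroup)
    have \<alpha>g: "\<alpha> g \<in> carrier G" using auto_closed[OF \<alpha>' g] .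
    have inv: "\<alpha> (inv g) = inv \<alpha> g"
      using \<alpha>' g by (intro group_hom.hom_inv) (auto simp: group_hom_def group_hom_axioms_def auto_def)
    have eq: "\<alpha> \<otimes>\<^bsub>AutoGroup G\<^esub> \<nu> = inner_aut G (\<alpha> g) \<otimes>\<^bsub>AutoGroup G\<^esub> \<alpha>"
      unfolding \<nu> mult_AutoGroup[OF \<alpha>' inner_aut_auto[OF g]] mult_AutoGroup[OF inner_aut_auto[OF \<alpha>g] \<alpha>']
      using g \<alpha>' by (auto simp: fun_eq_iff compose_def inner_aut_apply auto_mult inv auto_closed)
    have "\<alpha> \<otimes>\<^bsub>AutoGroup G\<^esub> \<nu> \<otimes>\<^bsub>AutoGroup G\<^esub> inv\<^bsub>AutoGroup G\<^esub> \<alpha> = inner_aut G (\<alpha> g)"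
    proof -
      have "inner_aut G (\<alpha> g) \<in> carrier (AutoGroup G)"
        by (simp add: carrier_AutoGroup inner_aut_auto[OF \<alpha>g])
      with eq \<alpha> show ?thesis by (simp add: A.m_assoc)
    qed
    with \<alpha>g show "\<alpha> \<otimes>\<^bsub>AutoGroup G\<^esub> \<nu> \<otimes>\<^bsub>AutoGroup G\<^esub> inv\<^bsub>AutoGroup G\<^esub> \<alpha> \<in> inner_aut G ` carrier G"
      by simp
  qed
qed

lemma group_Out: "group (Out G)"
  unfolding Out_def by (rule normal.factorgroup_is_group[OF inner_aut_normal])

end

definition outer_class where
  "outer_class G \<alpha> = (inner_aut G ` carrier G) #>\<^bsub>AutoGroup G\<^esub> \<alpha>"

context group
begin

lemma carrier_Out: "carrier (Out G) = outer_class G ` auto G"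
  unfolding Out_def carrier_FactGroup by (simp add: outer_class_def[abs_def] carrier_AutoGroup)

lemma outer_class_mem_iff:
  assumes "\<alpha> \<in> auto G"
  shows "\<beta> \<in> outer_class G \<alpha> \<longleftrightarrow> (\<exists>g\<in>carrier G. \<beta> = inner_aut G g \<otimes>\<^bsub>AutoGroup G\<^esub> \<alpha>)"
  by (auto simp: outer_class_def r_coset_def)

lemma inner_aut_mult_eq_iff:
  assumes g: "g \<in> carrier G" and \<alpha>: "\<alpha> \<in> auto G" and \<beta>: "\<beta> \<in> auto G"
  shows "\<beta> = inner_aut G g \<otimes>\<^bsub>AutoGroup G\<^esub> \<alpha> \<longleftrightarrow> (\<forall>h\<in>carrier G. \<beta> h = g \<otimes> \<alpha> h \<otimes> inv g)"
proof
  assume "\<beta> = inner_aut G g \<otimes>\<^bsub>AutoGroup G\<^esub> \<alpha>"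
  then show "\<forall>h\<in>carrier G. \<beta> h = g \<otimes> \<alpha> h \<otimes> inv g"
    using \<alpha> by (simp add: mult_AutoGroup inner_aut_auto g compose_def inner_aut_apply auto_closed)
next
  interpret A: group "AutoGroup G" by (rule AutoGroup)
  assume *: "\<forall>h\<in>carrier G. \<beta> h = g \<otimes> \<alpha> h \<otimes> inv g"
  have "inner_aut G g \<otimes>\<^bsub>AutoGroup G\<^esub> \<alpha> \<in> auto G"
    using A.m_closed[of "inner_aut G g" \<alpha>] inner_aut_auto[OF g] \<alpha> by (simp add: carrier_AutoGroup)
  then show "\<beta> = inner_aut G g \<otimes>\<^bsub>AutoGroup G\<^esub> \<alpha>"
    by (rule auto_eqI[OF \<beta>])
       (use * \<alpha> in \<open>simp add: mult_AutoGroup inner_aut_auto g compose_def inner_aut_apply auto_closed\<close>)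
qed

lemma outer_class_eq_iff:
  assumes \<alpha>: "\<alpha> \<in> auto G" and \<beta>: "\<beta> \<in> auto G"
  shows "outer_class G \<alpha> = outer_class G \<beta> \<longleftrightarrow>
    (\<exists>g\<in>carrier G. \<forall>h\<in>carrier G. \<beta> h = g \<otimes> \<alpha> h \<otimes> inv g)" (is "?L \<longleftrightarrow> ?R")
proof -
  interpret A: group "AutoGroup G" by (rule AutoGroup)
  interpret N: normal "inner_aut G ` carrier G" "AutoGroup G" by (rule inner_aut_normal)
  have "?L \<longleftrightarrow> \<beta> \<in> outer_class G \<alpha>"
  proof
    assume ?L
    then show "\<beta> \<in> outer_class G \<alpha>"
      using A.rcos_self[OF _ N.subgroup_axioms, of \<beta>] \<beta> by (simp add: outer_class_def carrier_AutoGroup)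
  next
    assume "\<beta> \<in> outer_class G \<alpha>"
    then show ?L
      using A.repr_independence[OF _ _ N.subgroup_axioms, of \<beta> \<alpha>] \<alpha>
      by (simp add: outer_class_def carrier_AutoGroup)
  qed
  also have "\<dots> \<longleftrightarrow> ?R"
    using inner_aut_mult_eq_iff[OF _ \<alpha> \<beta>] by (auto simp: outer_class_mem_iff[OF \<alpha>])
  finally show ?thesis .
qed

lemma outer_class_mult:
  assumes "\<alpha> \<in> auto G" "\<beta> \<in> auto G"
  shows "outer_class G \<alpha> \<otimes>\<^bsub>Out G\<^esub> outer_class G \<beta> = outer_class G (\<alpha> \<otimes>\<^bsub>AutoGroup G\<^esub> \<beta>)"
  using normal.rcos_sum[OF inner_aut_normal, of \<alpha> \<beta>] assms
  by (simp add: Out_def outer_class_def carrier_AutoGroup)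

lemma outer_class_one: "outer_class G (\<one>\<^bsub>AutoGroup G\<^esub>) = \<one>\<^bsub>Out G\<^esub>"
proof -
  interpret A: group "AutoGroup G" by (rule AutoGroup)
  interpret N: normal "inner_aut G ` carrier G" "AutoGroup G" by (rule inner_aut_normal)
  show ?thesis unfolding Out_def outer_class_def using A.coset_mult_one[OF N.subset] by simp
qed

lemma comm_group_center: "comm_group (center_group G)"
proof (rule comm_groupI)
  fix x y assume "x \<in> carrier (center_group G)" "y \<in> carrier (center_group G)"
  then have xy: "x \<in> carrier G" "y \<in> carrier G"
    "\<And>g. g \<in> carrier G \<Longrightarrow> x \<otimes> g = g \<otimes> x" "\<And>g. g \<in> carrier G \<Longrightarrow> y \<otimes> g = g \<otimes> y"
    by (auto simp: center_group_def)
  have "x \<otimes> y \<otimes> g = g \<otimes> (x \<otimes> y)" if "g \<in> carrier G" for g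
  proof -
    have "x \<otimes> y \<otimes> g = x \<otimes> (y \<otimes> g)" using xy(1,2) that by (simp add: m_assoc)
    also have "\<dots> = x \<otimes> g \<otimes> y" unfolding xy(4)[OF that] using xy(1,2) that by (simp add: m_assoc)
    also have "\<dots> = g \<otimes> x \<otimes> y" unfolding xy(3)[OF that] ..
    finally show ?thesis using xy(1,2) that by (simp add: m_assoc)
  qed
  with xy(1,2) show "x \<otimes>\<^bsub>center_group G\<^esub> y \<in> carrier (center_group G)" by (simp add: center_group_def)
  show "x \<otimes>\<^bsub>center_group G\<^esub> y = y \<otimes>\<^bsub>center_group G\<^esub> x" using xy(2) xy(3)[OF xy(2)] by (simp add: center_group_def)
next
  fix x assume "x \<in> carrier (center_group G)"
  then have x: "x \<in> carrier G" "\<And>g. g \<in> carrier G \<Longrightarrow> x \<otimes> g = g \<otimes> x"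
    by (auto simp: center_group_def)
  have "inv x \<otimes> g = g \<otimes> inv x" if g: "g \<in> carrier G" for g
  proof -
    have "inv x \<otimes> g = inv x \<otimes> (g \<otimes> x) \<otimes> inv x" using x(1) g by (simp add: m_assoc)
    also have "\<dots> = g \<otimes> inv x" unfolding x(2)[OF g, symmetric] using x(1) g by (simp add: m_assoc group_cancel)
    finally show ?thesis .
  qed
  with x(1) show "\<exists>y\<in>carrier (center_group G). y \<otimes>\<^bsub>center_group G\<^esub> x = \<one>\<^bsub>center_group G\<^esub>"
    by (intro bexI[of _ "inv x"]) (auto simp: center_group_def)
next
  show "\<one>\<^bsub>center_group G\<^esub> \<in> carrier (center_group G)" by (simp add: center_group_def)
next
  fix x y z assume "x \<in> carrier (center_group G)" "y \<in> carrier (center_group G)"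
    "z \<in> carrier (center_group G)"
  then have "x \<in> carrier G" "y \<in> carrier G" "z \<in> carrier G"
    by (simp_all add: center_group_def)
  then show "x \<otimes>\<^bsub>center_group G\<^esub> y \<otimes>\<^bsub>center_group G\<^esub> z =
      x \<otimes>\<^bsub>center_group G\<^esub> (y \<otimes>\<^bsub>center_group G\<^esub> z)"
    by (simp add: center_group_def m_assoc)
next
  fix x assume "x \<in> carrier (center_group G)"
  then have "x \<in> carrier G" by (simp add: center_group_def)
  then show "\<one>\<^bsub>center_group G\<^esub> \<otimes>\<^bsub>center_group G\<^esub> x = x" by (simp add: center_group_def)
qed

lemma auto_center:
  assumes \<alpha>: "\<alpha> \<in> auto G" and z: "z \<in> carrier (center_group G)"
  shows "\<alpha> z \<in> carrier (center_group G)"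
proof -
  have "\<alpha> z \<otimes> g = g \<otimes> \<alpha> z" if g: "g \<in> carrier G" for g
  proof -
    obtain h where h: "h \<in> carrier G" "\<alpha> h = g"
      using \<alpha> g unfolding auto_def Bij_def bij_betw_def
      by (metis (mono_tags, lifting) IntD2 imageE mem_Collect_eq)
    from z have zG: "z \<in> carrier G" and "z \<otimes> h = h \<otimes> z"
      using h(1) by (auto simp: center_group_def)
    then have "\<alpha> (z \<otimes> h) = \<alpha> (h \<otimes> z)" by simp
    with auto_mult[OF \<alpha> zG h(1)] auto_mult[OF \<alpha> h(1) zG] show ?thesis by (simp add: h(2))
  qed
  with \<alpha> z show ?thesis by (simp add: center_group_def auto_closed)
qed

text \<open>The representative chosen in \<open>out_action\<close> differs from \<open>\<alpha>\<close> by an inner automorphism, which is the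
  identity on the center.\<close>
lemma out_action_outer_class:
  assumes \<alpha>: "\<alpha> \<in> auto G" and f: "f \<in> carrier (hom_group P (center_group G))"
  shows "out_action P (outer_class G \<alpha>) f = compose (carrier P) \<alpha> f"
proof -
  have "\<alpha> = inner_aut G \<one> \<otimes>\<^bsub>AutoGroup G\<^esub> \<alpha>"
  proof -
    interpret A: group "AutoGroup G" by (rule AutoGroup)
    show ?thesis using \<alpha> by (simp add: inner_aut_one carrier_AutoGroup)
  qed
  then have "\<alpha> \<in> outer_class G \<alpha>" unfolding outer_class_mem_iff[OF \<alpha>] by blast
  then have "(SOME \<beta>. \<beta> \<in> outer_class G \<alpha>) \<in> outer_class G \<alpha>"
    by (rule someI[of "\<lambda>\<beta>. \<beta> \<in> outer_class G \<alpha>"])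
  then obtain g where g: "g \<in> carrier G"
    "(SOME \<beta>. \<beta> \<in> outer_class G \<alpha>) = inner_aut G g \<otimes>\<^bsub>AutoGroup G\<^esub> \<alpha>"
    unfolding outer_class_mem_iff[OF \<alpha>] by blast
  have "(inner_aut G g \<otimes>\<^bsub>AutoGroup G\<^esub> \<alpha>) z = \<alpha> z" if z: "z \<in> carrier (center_group G)" for z
  proof -
    from auto_center[OF \<alpha> z] have az: "\<alpha> z \<in> carrier G" "g \<otimes> \<alpha> z = \<alpha> z \<otimes> g"
      using g(1) by (simp_all add: center_group_def)
    have "(inner_aut G g \<otimes>\<^bsub>AutoGroup G\<^esub> \<alpha>) z = g \<otimes> \<alpha> z \<otimes> inv g"
      using z \<alpha> az by (simp add: mult_AutoGroup inner_aut_auto g(1) compose_def inner_aut_apply center_group_def)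
    also have "\<dots> = \<alpha> z" unfolding az(2) using az(1) g(1) by (simp add: m_assoc)
    finally show ?thesis .
  qed
  moreover have "f x \<in> carrier (center_group G)" if "x \<in> carrier P" for x
    using f that by (auto simp: hom_group_def hom_def)
  ultimately show ?thesis unfolding out_action_def g(2) compose_def by (simp cong: restrict_cong)
qed

end

section \<open>The semidirect product\<close>

lemma group_hom_group:
  assumes A: "comm_group A"
    and P: "\<And>x y. x \<in> carrier P \<Longrightarrow> y \<in> carrier P \<Longrightarrow> x \<otimes>\<^bsub>P\<^esub> y \<in> carrier P"
  shows "group (hom_group P A)"
proof -
  interpret A: comm_group A by (rule A)
  have mult: "f \<otimes>\<^bsub>hom_group P A\<^esub> h = (\<lambda>x\<in>carrier P. f x \<otimes>\<^bsub>A\<^esub> h x)" for f h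
    by (simp add: hom_group_def)
  have mem: "f \<in> carrier (hom_group P A) \<longleftrightarrow> f \<in> extensional (carrier P) \<and>
      (\<forall>x\<in>carrier P. f x \<in> carrier A) \<and>
      (\<forall>x\<in>carrier P. \<forall>y\<in>carrier P. f (x \<otimes>\<^bsub>P\<^esub> y) = f x \<otimes>\<^bsub>A\<^esub> f y)" for f
    by (auto simp: hom_group_def hom_def)
  show ?thesis
  proof (rule groupI)
    fix f h assume "f \<in> carrier (hom_group P A)" "h \<in> carrier (hom_group P A)"
    then show "f \<otimes>\<^bsub>hom_group P A\<^esub> h \<in> carrier (hom_group P A)"
      unfolding mem mult by (simp add: P A.m_ac)
  next
    show "\<one>\<^bsub>hom_group P A\<^esub> \<in> carrier (hom_group P A)"
      unfolding mem by (simp add: hom_group_def P)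
  next
    fix f h k assume "f \<in> carrier (hom_group P A)" "h \<in> carrier (hom_group P A)"
      "k \<in> carrier (hom_group P A)"
    then show "f \<otimes>\<^bsub>hom_group P A\<^esub> h \<otimes>\<^bsub>hom_group P A\<^esub> k = f \<otimes>\<^bsub>hom_group P A\<^esub> (h \<otimes>\<^bsub>hom_group P A\<^esub> k)"
      unfolding mem mult by (simp add: fun_eq_iff A.m_assoc)
  next
    fix f assume f: "f \<in> carrier (hom_group P A)"
    then show "\<one>\<^bsub>hom_group P A\<^esub> \<otimes>\<^bsub>hom_group P A\<^esub> f = f"
      unfolding mem mult by (intro extensionalityI[of _ "carrier P"]) (auto simp: hom_group_def)
    from f have "(\<lambda>x\<in>carrier P. inv\<^bsub>A\<^esub> f x) \<in> carrier (hom_group P A)"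
      unfolding mem by (simp add: P A.inv_mult)
    moreover from f have "(\<lambda>x\<in>carrier P. inv\<^bsub>A\<^esub> f x) \<otimes>\<^bsub>hom_group P A\<^esub> f = \<one>\<^bsub>hom_group P A\<^esub>"
      unfolding mem mult by (simp add: fun_eq_iff hom_group_def)
    ultimately show "\<exists>h\<in>carrier (hom_group P A). h \<otimes>\<^bsub>hom_group P A\<^esub> f = \<one>\<^bsub>hom_group P A\<^esub>" by blast
  qed
qed

lemma group_semidirect:
  fixes \<theta> :: "'h \<Rightarrow> 'n \<Rightarrow> 'n"
  assumes N: "group N" and H: "group H"
    and act_hom: "\<And>h. h \<in> carrier H \<Longrightarrow> \<theta> h \<in> hom N N"
    and act_mult: "\<And>h k n. h \<in> carrier H \<Longrightarrow> k \<in> carrier H \<Longrightarrow> n \<in> carrier N \<Longrightarrow>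
      \<theta> (h \<otimes>\<^bsub>H\<^esub> k) n = \<theta> h (\<theta> k n)"
    and act_one: "\<And>n. n \<in> carrier N \<Longrightarrow> \<theta> \<one>\<^bsub>H\<^esub> n = n"
  shows "group (semidirect N H \<theta>)"
proof -
  interpret N: group N by (rule N)
  interpret H: group H by (rule H)
  have closed: "\<theta> h n \<in> carrier N" if "h \<in> carrier H" "n \<in> carrier N" for h n
    using act_hom[OF that(1)] that(2) by (auto simp: hom_def)
  have act_m: "\<theta> h (n \<otimes>\<^bsub>N\<^esub> k) = \<theta> h n \<otimes>\<^bsub>N\<^esub> \<theta> h k"
    if "h \<in> carrier H" "n \<in> carrier N" "k \<in> carrier N" for h n k
    using act_hom[OF that(1)] that by (auto simp: hom_def)
  show ?thesis
  proof (rule groupI)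
    fix x assume "x \<in> carrier (semidirect N H \<theta>)"
    then obtain n h where x: "x = (n, h)" "n \<in> carrier N" "h \<in> carrier H"
      by (auto simp: semidirect_def)
    then show "\<one>\<^bsub>semidirect N H \<theta>\<^esub> \<otimes>\<^bsub>semidirect N H \<theta>\<^esub> x = x"
      by (simp add: semidirect_def act_one)
    have "\<theta> (inv\<^bsub>H\<^esub> h) (inv\<^bsub>N\<^esub> n) \<otimes>\<^bsub>N\<^esub> \<theta> (inv\<^bsub>H\<^esub> h) n = \<one>\<^bsub>N\<^esub>"
    proof -
      have "\<theta> (inv\<^bsub>H\<^esub> h) \<one>\<^bsub>N\<^esub> = \<one>\<^bsub>N\<^esub>"
        using x by (intro hom_one[OF act_hom N N]) simp
      with x show ?thesis by (simp flip: act_m)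
    qed
    with x show "\<exists>y\<in>carrier (semidirect N H \<theta>). y \<otimes>\<^bsub>semidirect N H \<theta>\<^esub> x = \<one>\<^bsub>semidirect N H \<theta>\<^esub>"
      by (intro bexI[of _ "(\<theta> (inv\<^bsub>H\<^esub> h) (inv\<^bsub>N\<^esub> n), inv\<^bsub>H\<^esub> h)"]) (auto simp: semidirect_def closed)
  qed (auto simp: semidirect_def closed act_m act_mult N.m_assoc H.m_assoc)
qed

lemma (in group) group_semidirect_out:
  assumes P: "\<And>x y. x \<in> carrier P \<Longrightarrow> y \<in> carrier P \<Longrightarrow> x \<otimes>\<^bsub>P\<^esub> y \<in> carrier P"
  shows "group (semidirect (hom_group P (center_group G)) (Out G) (out_action P))"
proof (rule group_semidirect)
  let ?N = "hom_group P (center_group G)"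
  interpret A: group "AutoGroup G" by (rule AutoGroup)
  show "group ?N" by (rule group_hom_group[OF comm_group_center P])
  show "group (Out G)" by (rule group_Out)
  have f_closed: "f x \<in> carrier (center_group G)" if "f \<in> carrier ?N" "x \<in> carrier P" for f x
    using that by (auto simp: hom_group_def hom_def)
  have center_sub: "z \<in> carrier G" if "z \<in> carrier (center_group G)" for z
    using that by (simp add: center_group_def)
  have act: "compose (carrier P) \<alpha> f \<in> carrier ?N" if \<alpha>: "\<alpha> \<in> auto G" and f: "f \<in> carrier ?N" for \<alpha> f
  proof -
    have "compose (carrier P) \<alpha> f \<in> hom P (center_group G)"
    proof (rule homI)
      fix x y assume xy: "x \<in> carrier P" "y \<in> carrier P"
      from f xy have fm: "f (x \<otimes>\<^bsub>P\<^esub> y) = f x \<otimes> f y"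
        by (auto simp: hom_group_def hom_def center_group_def)
      have c: "f x \<in> carrier G" "f y \<in> carrier G"
        using f_closed[OF f] center_sub xy by blast+
      show "compose (carrier P) \<alpha> f (x \<otimes>\<^bsub>P\<^esub> y) =
          compose (carrier P) \<alpha> f x \<otimes>\<^bsub>center_group G\<^esub> compose (carrier P) \<alpha> f y"
        using xy P[OF xy] auto_mult[OF \<alpha> c] by (simp add: compose_def fm center_group_def)
    qed (simp add: compose_def auto_center \<alpha> f_closed[OF f])
    then show ?thesis by (simp add: hom_group_def compose_def)
  qed
  show "out_action P h \<in> hom ?N ?N" if h: "h \<in> carrier (Out G)" for h
  proof -
    obtain \<alpha> where \<alpha>: "\<alpha> \<in> auto G" "h = outer_class G \<alpha>" using h by (auto simp: carrier_Out)
    interpret N: group ?N by (rule group_hom_group[OF comm_group_center P])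
    show ?thesis unfolding \<alpha>(2)
    proof (rule homI)
      fix f k assume f: "f \<in> carrier ?N" and k: "k \<in> carrier ?N"
      have "\<alpha> (f x \<otimes> k x) = \<alpha> (f x) \<otimes> \<alpha> (k x)" if "x \<in> carrier P" for x
        using f_closed[OF f that] f_closed[OF k that]
        by (intro auto_mult[OF \<alpha>(1)]) (rule center_sub, assumption)+
      then show "out_action P (outer_class G \<alpha>) (f \<otimes>\<^bsub>?N\<^esub> k) =
          out_action P (outer_class G \<alpha>) f \<otimes>\<^bsub>?N\<^esub> out_action P (outer_class G \<alpha>) k"
        unfolding out_action_outer_class[OF \<alpha>(1) f] out_action_outer_class[OF \<alpha>(1) k]
          out_action_outer_class[OF \<alpha>(1) N.m_closed[OF f k]]
        by (simp add: fun_eq_iff compose_def hom_group_def center_group_def)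
    qed (simp add: out_action_outer_class[OF \<alpha>(1)] act[OF \<alpha>(1)])
  qed
  fix f assume f: "f \<in> carrier ?N"
  have "(\<lambda>x\<in>carrier G. x) \<in> auto G" by (rule id_in_auto)
  from out_action_outer_class[OF this f]
  have "out_action P \<one>\<^bsub>Out G\<^esub> f = compose (carrier P) (\<lambda>x\<in>carrier G. x) f"
    by (simp add: outer_class_one[symmetric] one_AutoGroup)
  also have "\<dots> = f"
    by (rule extensionalityI[of _ "carrier P"])
       (use f f_closed[OF f] center_sub in \<open>auto simp: hom_group_def compose_def\<close>)
  finally show "out_action P \<one>\<^bsub>Out G\<^esub> f = f" .
  fix h k assume "h \<in> carrier (Out G)" "k \<in> carrier (Out G)"
  then obtain \<alpha> \<beta> where \<alpha>: "\<alpha> \<in> auto G" "h = outer_class G \<alpha>" and \<beta>: "\<beta> \<in> auto G" "k = outer_class G \<beta>"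
    by (auto simp: carrier_Out)
  have ab: "\<alpha> \<otimes>\<^bsub>AutoGroup G\<^esub> \<beta> \<in> auto G"
    using A.m_closed[of \<alpha> \<beta>] \<alpha> \<beta> by (simp add: carrier_AutoGroup)
  show "out_action P (h \<otimes>\<^bsub>Out G\<^esub> k) f = out_action P h (out_action P k f)"
    unfolding \<alpha>(2) \<beta>(2) outer_class_mult[OF \<alpha>(1) \<beta>(1)] out_action_outer_class[OF ab f]
      out_action_outer_class[OF \<beta>(1) f] out_action_outer_class[OF \<alpha>(1) act[OF \<beta>(1) f]]
    using f_closed[OF f] center_sub by (simp add: fun_eq_iff compose_def mult_AutoGroup \<alpha>(1) \<beta>(1))
qed

section \<open>The constant sheaf and its automorphisms\<close>

lemma section_iff:
  "s \<in> carrier (sect (const_sheaf G) U) \<longleftrightarrow>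
    s \<in> extensional U \<and> (\<forall>q\<in>U. s q \<in> carrier G \<and> (\<forall>\<^sub>F r in nhds q. r \<in> U \<longrightarrow> s r = s q))"
proof -
  have "continuous_map (top_of_set U) (discrete_topology (carrier G)) s \<longleftrightarrow>
      (\<forall>q\<in>U. s q \<in> carrier G \<and> (\<forall>\<^sub>F r in nhds q. r \<in> U \<longrightarrow> s r = s q))" (is "?L \<longleftrightarrow> ?R")
  proof
    assume L: ?L
    show ?R
    proof (intro ballI conjI)
      fix q assume q: "q \<in> U"
      from L q show sq: "s q \<in> carrier G" by (auto simp: continuous_map_def)
      from L sq have "openin (top_of_set U) {x \<in> U. s x \<in> {s q}}"
        by (auto simp: continuous_map_def)
      then obtain T where T: "open T" "{x \<in> U. s x \<in> {s q}} = U \<inter> T"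
        by (auto simp: openin_open)
      have "\<forall>\<^sub>F r in nhds q. r \<in> T" using T q by (intro eventually_nhds_in_open) auto
      then show "\<forall>\<^sub>F r in nhds q. r \<in> U \<longrightarrow> s r = s q"
        by eventually_elim (use T in blast)
    qed
  next
    assume R: ?R
    have "openin (top_of_set U) {x \<in> U. s x \<in> V}" for V
    proof (subst openin_subopen, intro ballI)
      fix q assume q: "q \<in> {x \<in> U. s x \<in> V}"
      then have "\<forall>\<^sub>F r in nhds q. r \<in> U \<longrightarrow> s r = s q" using R by blast
      then obtain T where T: "open T" "q \<in> T" "\<forall>r\<in>T. r \<in> U \<longrightarrow> s r = s q"
        unfolding eventually_nhds by metis
      have "U \<inter> T \<subseteq> {x \<in> U. s x \<in> V}" using T(3) q by fastforce
      with q T openin_open_Int[OF T(1), of U]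
      show "\<exists>T. openin (top_of_set U) T \<and> q \<in> T \<and> T \<subseteq> {x \<in> U. s x \<in> V}" by blast
    qed
    with R show ?L by (auto simp: continuous_map_def)
  qed
  then show ?thesis by (simp add: const_sheaf_def)
qed

lemma sectionD:
  assumes "s \<in> carrier (sect (const_sheaf G) U)"
  shows "s \<in> extensional U" "q \<in> U \<Longrightarrow> s q \<in> carrier G"
    "q \<in> U \<Longrightarrow> \<forall>\<^sub>F r in nhds q. r \<in> U \<longrightarrow> s r = s q"
  using assms by (simp_all add: section_iff)

lemma section_mult:
  "s \<otimes>\<^bsub>sect (const_sheaf G) U\<^esub> t = (\<lambda>x\<in>U. s x \<otimes>\<^bsub>G\<^esub> t x)"
  by (simp add: const_sheaf_def)

lemma section_one: "\<one>\<^bsub>sect (const_sheaf G) U\<^esub> = (\<lambda>x\<in>U. \<one>\<^bsub>G\<^esub>)"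
  by (simp add: const_sheaf_def)

lemma section_restrict: "rs (const_sheaf G) U V s = restrict s V"
  by (simp add: const_sheaf_def)

lemma section_pointwise:
  assumes s: "s \<in> carrier (sect (const_sheaf G) U)" and t: "t \<in> carrier (sect (const_sheaf G) U')"
    and f: "\<And>a b. a \<in> carrier G \<Longrightarrow> b \<in> carrier G \<Longrightarrow> f a b \<in> carrier G"
    and V: "V \<subseteq> U" "V \<subseteq> U'"
  shows "(\<lambda>x\<in>V. f (s x) (t x)) \<in> carrier (sect (const_sheaf G) V)"
  unfolding section_iff
proof (intro conjI ballI)
  fix q assume q: "q \<in> V"
  with V have qU: "q \<in> U" "q \<in> U'" by auto
  show "(\<lambda>x\<in>V. f (s x) (t x)) q \<in> carrier G"
    using f sectionD(2)[OF s qU(1)] sectionD(2)[OF t qU(2)] q by simp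
  show "\<forall>\<^sub>F r in nhds q. r \<in> V \<longrightarrow> (\<lambda>x\<in>V. f (s x) (t x)) r = (\<lambda>x\<in>V. f (s x) (t x)) q"
    using sectionD(3)[OF s qU(1)] sectionD(3)[OF t qU(2)]
  proof eventually_elim
    case (elim r)
    show ?case
    proof
      assume "r \<in> V"
      with elim V have "s r = s q" "t r = t q" by blast+
      with q \<open>r \<in> V\<close> show "(\<lambda>x\<in>V. f (s x) (t x)) r = (\<lambda>x\<in>V. f (s x) (t x)) q" by simp
    qed
  qed
qed simp

lemma section_restrict_closed:
  assumes s: "s \<in> carrier (sect (const_sheaf G) U)" and V: "V \<subseteq> U"
  shows "restrict s V \<in> carrier (sect (const_sheaf G) V)"
  using section_pointwise[OF s s _ V V, of "\<lambda>a b. a"] by simp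

lemma section_const:
  assumes "g \<in> carrier G" shows "(\<lambda>_\<in>U. g) \<in> carrier (sect (const_sheaf G) U)"
  using assms by (auto simp: section_iff eventually_mono)

lemma (in group) group_section: "group (sect (const_sheaf G) U)"
proof (rule groupI)
  fix s t assume s: "s \<in> carrier (sect (const_sheaf G) U)" and t: "t \<in> carrier (sect (const_sheaf G) U)"
  show "s \<otimes>\<^bsub>sect (const_sheaf G) U\<^esub> t \<in> carrier (sect (const_sheaf G) U)"
    unfolding section_mult by (rule section_pointwise[OF s t]) auto
next
  show "\<one>\<^bsub>sect (const_sheaf G) U\<^esub> \<in> carrier (sect (const_sheaf G) U)"
    unfolding section_one by (rule section_const) simp
next
  fix s t u assume s: "s \<in> carrier (sect (const_sheaf G) U)"
    and t: "t \<in> carrier (sect (const_sheaf G) U)" and u: "u \<in> carrier (sect (const_sheaf G) U)"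
  show "s \<otimes>\<^bsub>sect (const_sheaf G) U\<^esub> t \<otimes>\<^bsub>sect (const_sheaf G) U\<^esub> u =
      s \<otimes>\<^bsub>sect (const_sheaf G) U\<^esub> (t \<otimes>\<^bsub>sect (const_sheaf G) U\<^esub> u)"
    unfolding section_mult
    by (simp add: fun_eq_iff m_assoc sectionD(2)[OF s] sectionD(2)[OF t] sectionD(2)[OF u])
next
  fix s assume s: "s \<in> carrier (sect (const_sheaf G) U)"
  show "\<one>\<^bsub>sect (const_sheaf G) U\<^esub> \<otimes>\<^bsub>sect (const_sheaf G) U\<^esub> s = s"
    unfolding section_mult section_one
    by (rule extensionalityI[OF _ sectionD(1)[OF s]]) (auto dest: sectionD(2)[OF s])
  have "(\<lambda>x\<in>U. inv s x) \<in> carrier (sect (const_sheaf G) U)"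
    using section_pointwise[OF s s, of "\<lambda>a b. inv a" U] by simp
  moreover have "(\<lambda>x\<in>U. inv s x) \<otimes>\<^bsub>sect (const_sheaf G) U\<^esub> s = \<one>\<^bsub>sect (const_sheaf G) U\<^esub>"
    unfolding section_mult section_one by (auto simp: fun_eq_iff dest: sectionD(2)[OF s])
  ultimately show "\<exists>t\<in>carrier (sect (const_sheaf G) U).
      t \<otimes>\<^bsub>sect (const_sheaf G) U\<^esub> s = \<one>\<^bsub>sect (const_sheaf G) U\<^esub>" by blast
qed

lemma (in group) section_inv:
  assumes s: "s \<in> carrier (sect (const_sheaf G) U)"
  shows "inv\<^bsub>sect (const_sheaf G) U\<^esub> s = (\<lambda>x\<in>U. inv s x)"
proof -
  interpret S: group "sect (const_sheaf G) U" by (rule group_section)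
  show ?thesis
  proof (rule S.inv_equality[OF _ s])
    show "(\<lambda>x\<in>U. inv s x) \<otimes>\<^bsub>sect (const_sheaf G) U\<^esub> s = \<one>\<^bsub>sect (const_sheaf G) U\<^esub>"
      unfolding section_mult section_one by (auto simp: fun_eq_iff dest: sectionD(2)[OF s])
    show "(\<lambda>x\<in>U. inv s x) \<in> carrier (sect (const_sheaf G) U)"
      using section_pointwise[OF s s, of "\<lambda>a b. inv a" U] by simp
  qed
qed

lemma aut_section_iff:
  "\<alpha> \<in> carrier (sect (aut_sheaf F) U) \<longleftrightarrow>
    \<alpha> \<in> extensional (opens_in U) \<and>
    (\<forall>V. open V \<longrightarrow> V \<subseteq> U \<longrightarrow> \<alpha> V \<in> auto (sect F V) \<and>
      (\<forall>W. open W \<longrightarrow> W \<subseteq> V \<longrightarrow> (\<forall>s\<in>carrier (sect F V). \<alpha> W (rs F V W s) = rs F V W (\<alpha> V s))))"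
  by (auto simp: aut_sheaf_def PiE_iff carrier_AutoGroup)

lemma aut_sectionD:
  assumes "\<alpha> \<in> carrier (sect (aut_sheaf F) U)"
  shows "\<alpha> \<in> extensional (opens_in U)"
    "open V \<Longrightarrow> V \<subseteq> U \<Longrightarrow> \<alpha> V \<in> auto (sect F V)"
    "open V \<Longrightarrow> V \<subseteq> U \<Longrightarrow> open W \<Longrightarrow> W \<subseteq> V \<Longrightarrow> s \<in> carrier (sect F V) \<Longrightarrow>
      \<alpha> W (rs F V W s) = rs F V W (\<alpha> V s)"
  using assms unfolding aut_section_iff by blast+

lemma aut_section_mult:
  "\<alpha> \<otimes>\<^bsub>sect (aut_sheaf F) U\<^esub> \<beta> = (\<lambda>V\<in>opens_in U. \<alpha> V \<otimes>\<^bsub>AutoGroup (sect F V)\<^esub> \<beta> V)"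
  by (simp add: aut_sheaf_def)

lemma aut_section_one:
  "\<one>\<^bsub>sect (aut_sheaf F) U\<^esub> = (\<lambda>V\<in>opens_in U. \<one>\<^bsub>AutoGroup (sect F V)\<^esub>)"
  by (simp add: aut_sheaf_def)

lemma aut_section_restrict: "rs (aut_sheaf F) U V \<alpha> = restrict \<alpha> (opens_in V)"
  by (simp add: aut_sheaf_def)

lemma aut_section_restrict_closed:
  assumes \<alpha>: "\<alpha> \<in> carrier (sect (aut_sheaf F) U)" and V: "V \<subseteq> U"
  shows "restrict \<alpha> (opens_in V) \<in> carrier (sect (aut_sheaf F) V)"
  unfolding aut_section_iff
proof (intro conjI allI impI ballI)
  fix W assume W: "open W" "W \<subseteq> V"
  with V show "restrict \<alpha> (opens_in V) W \<in> auto (sect F W)"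
    using aut_sectionD(2)[OF \<alpha>, of W] by simp
  fix Z s assume Z: "open Z" "Z \<subseteq> W" "s \<in> carrier (sect F W)"
  moreover from W Z V have "Z \<subseteq> V" "W \<subseteq> U" by auto
  ultimately show "restrict \<alpha> (opens_in V) Z (rs F W Z s) = rs F W Z (restrict \<alpha> (opens_in V) W s)"
    using aut_sectionD(3)[OF \<alpha>, of W Z s] W V by simp
qed simp


lemma (in group) aut_section_mult_apply:
  assumes \<alpha>: "\<alpha> \<in> carrier (sect (aut_sheaf (const_sheaf G)) U)"
    and \<beta>: "\<beta> \<in> carrier (sect (aut_sheaf (const_sheaf G)) U)"
    and V: "open V" "V \<subseteq> U" and s: "s \<in> carrier (sect (const_sheaf G) V)"
  shows "(\<alpha> \<otimes>\<^bsub>sect (aut_sheaf (const_sheaf G)) U\<^esub> \<beta>) V s = \<alpha> V (\<beta> V s)"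
  using aut_sectionD(2)[OF \<alpha> V] aut_sectionD(2)[OF \<beta> V] V s
  by (simp add: aut_section_mult mult_AutoGroup compose_def)

lemma (in group) aut_section_mult_closed:
  assumes \<alpha>: "\<alpha> \<in> carrier (sect (aut_sheaf (const_sheaf G)) U)"
    and \<beta>: "\<beta> \<in> carrier (sect (aut_sheaf (const_sheaf G)) U)"
  shows "\<alpha> \<otimes>\<^bsub>sect (aut_sheaf (const_sheaf G)) U\<^esub> \<beta> \<in> carrier (sect (aut_sheaf (const_sheaf G)) U)"
  unfolding aut_section_iff
proof (intro conjI allI impI ballI)
  show "\<alpha> \<otimes>\<^bsub>sect (aut_sheaf (const_sheaf G)) U\<^esub> \<beta> \<in> extensional (opens_in U)"
    by (simp add: aut_section_mult)
next
  fix V assume V: "open V" "V \<subseteq> U"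
  interpret A: group "AutoGroup (sect (const_sheaf G) V)" by (rule group.AutoGroup[OF group_section])
  have aV: "\<alpha> V \<in> auto (sect (const_sheaf G) V)" "\<beta> V \<in> auto (sect (const_sheaf G) V)"
    using aut_sectionD(2)[OF \<alpha> V] aut_sectionD(2)[OF \<beta> V] .
  then show "(\<alpha> \<otimes>\<^bsub>sect (aut_sheaf (const_sheaf G)) U\<^esub> \<beta>) V \<in> auto (sect (const_sheaf G) V)"
    using A.m_closed[of "\<alpha> V" "\<beta> V"] V by (simp add: carrier_AutoGroup aut_section_mult)
  fix W s assume W: "open W" "W \<subseteq> V" and s: "s \<in> carrier (sect (const_sheaf G) V)"
  with V have WU: "W \<subseteq> U" by blast
  have r: "restrict s W \<in> carrier (sect (const_sheaf G) W)" by (rule section_restrict_closed[OF s W(2)])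
  have bs: "\<beta> V s \<in> carrier (sect (const_sheaf G) V)" by (rule auto_closed[OF aV(2) s])
  show "(\<alpha> \<otimes>\<^bsub>sect (aut_sheaf (const_sheaf G)) U\<^esub> \<beta>) W (rs (const_sheaf G) V W s) =
      rs (const_sheaf G) V W ((\<alpha> \<otimes>\<^bsub>sect (aut_sheaf (const_sheaf G)) U\<^esub> \<beta>) V s)"
    using aut_sectionD(3)[OF \<alpha> V W bs] aut_sectionD(3)[OF \<beta> V W s]
    by (simp add: section_restrict aut_section_mult_apply[OF \<alpha> \<beta> V s]
        aut_section_mult_apply[OF \<alpha> \<beta> W(1) WU r])
qed

text \<open>The automorphism of the stalk \<open>G\<close> at \<open>q\<close> that \<open>\<alpha>\<close> induces, evaluated on constant sections over \<open>U\<close>.\<close>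
definition stalk where
  "stalk G U \<alpha> q = (\<lambda>g\<in>carrier G. \<alpha> U (\<lambda>_\<in>U. g) q)"

context group
begin

abbreviation C_sheaf :: "('x::topological_space, 'x \<Rightarrow> 'a) group_presheaf" where "C_sheaf \<equiv> const_sheaf G"

text \<open>Near \<open>q\<close>, the section \<open>s\<close> agrees with a constant one, and \<open>\<alpha>\<close> is compatible with restriction.\<close>
lemma stalk_apply:
  assumes \<alpha>: "\<alpha> \<in> carrier (sect (aut_sheaf C_sheaf) U)" and U: "open U"
    and V: "open V" "V \<subseteq> U" and s: "s \<in> carrier (sect C_sheaf V)" and q: "q \<in> V"
  shows "\<alpha> V s q = stalk G U \<alpha> q (s q)"
proof -
  obtain T where T: "open T" "q \<in> T" "\<forall>r\<in>T. r \<in> V \<longrightarrow> s r = s q"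
    using sectionD(3)[OF s q] unfolding eventually_nhds by metis
  define W where "W = T \<inter> V"
  have W: "open W" "W \<subseteq> V" "W \<subseteq> U" "q \<in> W" using T V q by (auto simp: W_def)
  have eq: "restrict s W = restrict (\<lambda>_\<in>U. s q) W"
  proof (rule restrict_ext)
    fix r assume r: "r \<in> W"
    have "s r = s q" by (rule T(3)[rule_format]) (use r in \<open>simp_all add: W_def\<close>)
    with r W(3) show "s r = (\<lambda>_\<in>U. s q) r" by auto
  qed
  have sq: "s q \<in> carrier G" by (rule sectionD(2)[OF s q])
  have "restrict (\<alpha> V s) W = restrict (\<alpha> U (\<lambda>_\<in>U. s q)) W"
    using aut_sectionD(3)[OF \<alpha> V W(1,2) s] aut_sectionD(3)[OF \<alpha> U order_refl W(1,3) section_const[OF sq]]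
    unfolding section_restrict eq by simp
  then have "\<alpha> V s q = \<alpha> U (\<lambda>_\<in>U. s q) q" using W(4) by (metis restrict_apply')
  with sq show ?thesis by (simp add: stalk_def)
qed

text \<open>If two constant sections have the same image at \<open>q\<close>, their images agree near \<open>q\<close>, and \<open>\<alpha>\<close> is
  injective on sections over a small neighbourhood. Surjectivity uses a section over all of \<open>U\<close>
  that \<open>\<alpha>\<close> maps to a given constant.\<close>
lemma stalk_auto:
  assumes \<alpha>: "\<alpha> \<in> carrier (sect (aut_sheaf C_sheaf) U)" and U: "open U" and q: "q \<in> U"
  shows "stalk G U \<alpha> q \<in> auto G"
proof -
  have aU: "\<alpha> U \<in> auto (sect C_sheaf U)" by (rule aut_sectionD(2)[OF \<alpha> U order_refl])
  have closed: "stalk G U \<alpha> q g \<in> carrier G" if g: "g \<in> carrier G" for g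
    using sectionD(2)[OF auto_closed[OF aU section_const[OF g]] q] g by (simp add: stalk_def)
  have mult: "stalk G U \<alpha> q (g \<otimes> h) = stalk G U \<alpha> q g \<otimes> stalk G U \<alpha> q h"
    if g: "g \<in> carrier G" and h: "h \<in> carrier G" for g h
  proof -
    have "(\<lambda>_\<in>U. g \<otimes> h) = (\<lambda>_\<in>U. g) \<otimes>\<^bsub>sect C_sheaf U\<^esub> (\<lambda>_\<in>U. h)"
      by (simp add: section_mult fun_eq_iff)
    with auto_mult[OF aU section_const[OF g] section_const[OF h]] g h q
    show ?thesis by (simp add: stalk_def section_mult)
  qed
  have inj: "inj_on (stalk G U \<alpha> q) (carrier G)"
  proof (rule inj_onI)
    fix g h assume g: "g \<in> carrier G" and h: "h \<in> carrier G" and eq: "stalk G U \<alpha> q g = stalk G U \<alpha> q h"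
    have "\<forall>\<^sub>F r in nhds q. r \<in> U \<longrightarrow> \<alpha> U (\<lambda>_\<in>U. g) r = \<alpha> U (\<lambda>_\<in>U. g) q"
      "\<forall>\<^sub>F r in nhds q. r \<in> U \<longrightarrow> \<alpha> U (\<lambda>_\<in>U. h) r = \<alpha> U (\<lambda>_\<in>U. h) q"
      using sectionD(3)[OF auto_closed[OF aU section_const[OF g]] q]
        sectionD(3)[OF auto_closed[OF aU section_const[OF h]] q] .
    then have "\<forall>\<^sub>F r in nhds q. r \<in> U \<longrightarrow> \<alpha> U (\<lambda>_\<in>U. g) r = \<alpha> U (\<lambda>_\<in>U. h) r"
      by eventually_elim (use eq g h in \<open>simp add: stalk_def\<close>)
    then obtain T where T: "open T" "q \<in> T" "\<forall>r\<in>T. r \<in> U \<longrightarrow> \<alpha> U (\<lambda>_\<in>U. g) r = \<alpha> U (\<lambda>_\<in>U. h) r"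
      unfolding eventually_nhds by metis
    define W where "W = U \<inter> T"
    have W: "open W" "W \<subseteq> U" "q \<in> W" using T U q by (auto simp: W_def)
    have aW: "\<alpha> W \<in> auto (sect C_sheaf W)" by (rule aut_sectionD(2)[OF \<alpha> W(1,2)])
    have res: "restrict (\<lambda>_\<in>U. k) W = (\<lambda>_\<in>W. k)" for k :: 'a
      using W(2) by (auto simp: fun_eq_iff)
    have "restrict (\<alpha> U (\<lambda>_\<in>U. g)) W = restrict (\<alpha> U (\<lambda>_\<in>U. h)) W"
      by (rule restrict_ext) (use T(3) in \<open>auto simp: W_def\<close>)
    then have eqW: "\<alpha> W (\<lambda>_\<in>W. g) = \<alpha> W (\<lambda>_\<in>W. h)"
      using aut_sectionD(3)[OF \<alpha> U order_refl W(1,2) section_const[OF g]]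
        aut_sectionD(3)[OF \<alpha> U order_refl W(1,2) section_const[OF h]]
      by (simp only: section_restrict res)
    have "inj_on (\<alpha> W) (carrier (sect C_sheaf W))"
      using aW by (simp add: auto_def Bij_def bij_betw_def)
    from inj_onD[OF this eqW section_const[OF g] section_const[OF h]]
    have "(\<lambda>_\<in>W. g) = (\<lambda>_\<in>W. h)" .
    with W(3) show "g = h" by (metis restrict_apply')
  qed
  have surj: "\<exists>g\<in>carrier G. stalk G U \<alpha> q g = k" if k: "k \<in> carrier G" for k
  proof -
    have img: "\<alpha> U ` carrier (sect C_sheaf U) = carrier (sect C_sheaf U)"
      using aU by (simp add: auto_def Bij_def bij_betw_def)
    have "(\<lambda>_\<in>U. k) \<in> \<alpha> U ` carrier (sect C_sheaf U)"
      unfolding img by (rule section_const[OF k])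
    then obtain s where s: "(\<lambda>_\<in>U. k) = \<alpha> U s" "s \<in> carrier (sect C_sheaf U)"
      by (rule imageE)
    have "stalk G U \<alpha> q (s q) = k"
      using stalk_apply[OF \<alpha> U U order_refl s(2) q] s(1)[symmetric] q by simp
    with sectionD(2)[OF s(2) q] show ?thesis by blast
  qed
  have "bij_betw (stalk G U \<alpha> q) (carrier G) (carrier G)"
    unfolding bij_betw_def using inj closed surj by blast
  moreover have "stalk G U \<alpha> q \<in> extensional (carrier G)" by (simp add: stalk_def)
  ultimately show ?thesis using closed mult by (auto simp: auto_def Bij_def hom_def)
qed

text \<open>The image of each constant section is locally constant, hence constant on the connected set \<open>N\<close>.
  Connectedness provides one neighbourhood that works for all elements of \<open>G\<close> at once.\<close>
lemma stalk_locally_constant: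
  assumes \<alpha>: "\<alpha> \<in> carrier (sect (aut_sheaf C_sheaf) U)" and U: "open U" and q: "q \<in> U"
    and N: "q \<in> interior N" "N \<subseteq> U" "path_connected N"
  shows "\<forall>\<^sub>F r in nhds q. stalk G U \<alpha> r = stalk G U \<alpha> q"
proof -
  have "stalk G U \<alpha> r = stalk G U \<alpha> q" if r: "r \<in> N" for r
  proof (rule extensionalityI[of _ "carrier G"])
    fix g assume g: "g \<in> carrier G"
    have "\<alpha> U (\<lambda>_\<in>U. g) \<in> carrier (sect C_sheaf U)"
      by (rule auto_closed[OF aut_sectionD(2)[OF \<alpha> U order_refl] section_const[OF g]])
    note a = sectionD(3)[OF this]
    have "\<alpha> U (\<lambda>_\<in>U. g) r = \<alpha> U (\<lambda>_\<in>U. g) q"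
    proof (rule eventually_constant_on_connected[OF path_connected_imp_connected[OF N(3)]])
      fix z assume "z \<in> N"
      with N have "z \<in> U" by blast
      from a[OF this] show "\<forall>\<^sub>F w in nhds z. w \<in> N \<longrightarrow> \<alpha> U (\<lambda>_\<in>U. g) w = \<alpha> U (\<lambda>_\<in>U. g) z"
        by eventually_elim (use N in blast)
    qed (use r N interior_subset in auto)
    with g show "stalk G U \<alpha> r g = stalk G U \<alpha> q g" by (simp add: stalk_def)
  qed (simp_all add: stalk_def)
  moreover have "\<forall>\<^sub>F r in nhds q. r \<in> interior N" using N by (intro eventually_nhds_in_open) auto
  ultimately show ?thesis using interior_subset by (auto elim!: eventually_mono)
qed

text \<open>An automorphism of the constant sheaf is determined by its stalks, so that equations between
  sections of the automorphism sheaf become equations in \<open>G\<close>.\<close>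
lemma aut_section_eq_iff:
  assumes \<alpha>: "\<alpha> \<in> carrier (sect (aut_sheaf C_sheaf) U)" and \<beta>: "\<beta> \<in> carrier (sect (aut_sheaf C_sheaf) U)"
    and U: "open U"
  shows "\<alpha> = \<beta> \<longleftrightarrow> (\<forall>q\<in>U. stalk G U \<alpha> q = stalk G U \<beta> q)"
proof (intro iffI ballI)
  assume eq: "\<forall>q\<in>U. stalk G U \<alpha> q = stalk G U \<beta> q"
  show "\<alpha> = \<beta>"
  proof (rule extensionalityI[OF aut_sectionD(1)[OF \<alpha>] aut_sectionD(1)[OF \<beta>]])
    fix V assume "V \<in> opens_in U"
    then have V: "open V" "V \<subseteq> U" by auto
    have aV: "\<alpha> V \<in> auto (sect C_sheaf V)" "\<beta> V \<in> auto (sect C_sheaf V)"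
      using aut_sectionD(2)[OF \<alpha> V] aut_sectionD(2)[OF \<beta> V] .
    show "\<alpha> V = \<beta> V"
    proof (rule auto_eqI[OF aV])
      fix s assume s: "s \<in> carrier (sect C_sheaf V)"
      show "\<alpha> V s = \<beta> V s"
      proof (rule extensionalityI[of _ V])
        show "\<alpha> V s \<in> extensional V" "\<beta> V s \<in> extensional V"
          by (rule sectionD(1)[OF auto_closed[OF aV(1) s]] sectionD(1)[OF auto_closed[OF aV(2) s]])+
        fix q assume q: "q \<in> V"
        with V eq show "\<alpha> V s q = \<beta> V s q"
          using stalk_apply[OF \<alpha> U V s q] stalk_apply[OF \<beta> U V s q] by auto
      qed
    qed
  qed
qed auto

lemma stalk_restrict:
  assumes \<alpha>: "\<alpha> \<in> carrier (sect (aut_sheaf C_sheaf) U)" and U: "open U"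
    and V: "open V" "V \<subseteq> U" and q: "q \<in> V"
  shows "stalk G V (restrict \<alpha> (opens_in V)) q = stalk G U \<alpha> q"
proof (rule extensionalityI[of _ "carrier G"])
  fix g assume g: "g \<in> carrier G"
  then show "stalk G V (restrict \<alpha> (opens_in V)) q g = stalk G U \<alpha> q g"
    using stalk_apply[OF \<alpha> U V section_const[OF g] q] q V by (simp add: stalk_def)
qed (simp_all add: stalk_def)

lemma stalk_mult:
  assumes \<alpha>: "\<alpha> \<in> carrier (sect (aut_sheaf C_sheaf) U)" and \<beta>: "\<beta> \<in> carrier (sect (aut_sheaf C_sheaf) U)"
    and U: "open U" and q: "q \<in> U"
  shows "stalk G U (\<alpha> \<otimes>\<^bsub>sect (aut_sheaf C_sheaf) U\<^esub> \<beta>) q = stalk G U \<alpha> q \<otimes>\<^bsub>AutoGroup G\<^esub> stalk G U \<beta> q"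
  unfolding mult_AutoGroup[OF stalk_auto[OF \<alpha> U q] stalk_auto[OF \<beta> U q]]
proof (rule extensionalityI[of _ "carrier G"])
  fix g assume g: "g \<in> carrier G"
  have b: "\<beta> U (\<lambda>_\<in>U. g) \<in> carrier (sect C_sheaf U)"
    by (rule auto_closed[OF aut_sectionD(2)[OF \<beta> U order_refl] section_const[OF g]])
  show "stalk G U (\<alpha> \<otimes>\<^bsub>sect (aut_sheaf C_sheaf) U\<^esub> \<beta>) q g =
      compose (carrier G) (stalk G U \<alpha> q) (stalk G U \<beta> q) g"
    using stalk_apply[OF \<alpha> U U order_refl b q] g
      aut_section_mult_apply[OF \<alpha> \<beta> U order_refl section_const[OF g]]
    by (simp add: stalk_def[of G U "\<alpha> \<otimes>\<^bsub>sect (aut_sheaf C_sheaf) U\<^esub> \<beta>"]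
        stalk_def[of G U \<beta>] compose_def)
qed (simp_all add: stalk_def compose_def)

lemma stalk_one:
  assumes U: "open U" and q: "q \<in> U"
  shows "stalk G U \<one>\<^bsub>sect (aut_sheaf C_sheaf) U\<^esub> q = \<one>\<^bsub>AutoGroup G\<^esub>"
  using assms by (auto simp: stalk_def fun_eq_iff aut_section_one one_AutoGroup section_const)

lemma bd_apply:
  assumes V: "open V" "V \<subseteq> U" and s: "s \<in> carrier (sect C_sheaf U)" and t: "t \<in> carrier (sect C_sheaf V)"
  shows "bd (ad_xmod C_sheaf) U s V t = (\<lambda>q\<in>V. s q \<otimes> t q \<otimes> inv s q)"
proof -
  have r: "restrict s V \<in> carrier (sect C_sheaf V)" by (rule section_restrict_closed[OF s V(2)])
  show ?thesis
    using V t by (auto simp: ad_xmod_def section_restrict inner_aut_def section_mult section_inv[OF r] fun_eq_iff)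
qed

lemma bd_closed:
  assumes s: "s \<in> carrier (sect C_sheaf U)"
  shows "bd (ad_xmod C_sheaf) U s \<in> carrier (sect (aut_sheaf C_sheaf) U)"
  unfolding aut_section_iff
proof (intro conjI allI impI ballI)
  show "bd (ad_xmod C_sheaf) U s \<in> extensional (opens_in U)" by (simp add: ad_xmod_def)
  fix V assume V: "open V" "V \<subseteq> U"
  then show "bd (ad_xmod C_sheaf) U s V \<in> auto (sect C_sheaf V)"
    using group.inner_aut_auto[OF group_section section_restrict_closed[OF s V(2)]]
    by (simp add: ad_xmod_def section_restrict)
  fix W t assume W: "open W" "W \<subseteq> V" and t: "t \<in> carrier (sect C_sheaf V)"
  have WU: "W \<subseteq> U" using W V by blast
  show "bd (ad_xmod C_sheaf) U s W (rs C_sheaf V W t) = rs C_sheaf V W (bd (ad_xmod C_sheaf) U s V t)"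
    unfolding bd_apply[OF V s t] section_restrict bd_apply[OF W(1) WU s section_restrict_closed[OF t W(2)]]
    using W by (auto simp: fun_eq_iff)
qed

lemma stalk_bd:
  assumes s: "s \<in> carrier (sect C_sheaf U)" and U: "open U" and q: "q \<in> U"
  shows "stalk G U (bd (ad_xmod C_sheaf) U s) q = inner_aut G (s q)"
  using q by (auto simp: stalk_def inner_aut_def fun_eq_iff bd_apply[OF U order_refl s] section_const)

definition const_aut :: "'x::topological_space set \<Rightarrow> ('a \<Rightarrow> 'a) \<Rightarrow> 'x set \<Rightarrow> ('x \<Rightarrow> 'a) \<Rightarrow> 'x \<Rightarrow> 'a" where
  "const_aut U \<alpha> = (\<lambda>V\<in>opens_in U. \<lambda>s\<in>carrier (sect C_sheaf V). \<lambda>q\<in>V. \<alpha> (s q))"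

lemma const_aut_closed:
  assumes \<alpha>: "\<alpha> \<in> auto G"
  shows "const_aut U \<alpha> \<in> carrier (sect (aut_sheaf C_sheaf) U)"
  unfolding aut_section_iff
proof (intro conjI allI impI ballI)
  show "const_aut U \<alpha> \<in> extensional (opens_in U)" by (simp add: const_aut_def)
  fix V assume V: "open V" "V \<subseteq> U"
  interpret A: group "AutoGroup G" by (rule AutoGroup)
  define \<beta> where "\<beta> = inv\<^bsub>AutoGroup G\<^esub> \<alpha>"
  have \<beta>: "\<beta> \<in> auto G" using A.inv_closed[of \<alpha>] \<alpha> by (simp add: \<beta>_def carrier_AutoGroup)
  have "\<alpha> \<otimes>\<^bsub>AutoGroup G\<^esub> \<beta> = \<one>\<^bsub>AutoGroup G\<^esub>" "\<beta> \<otimes>\<^bsub>AutoGroup G\<^esub> \<alpha> = \<one>\<^bsub>AutoGroup G\<^esub>"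
    using \<alpha> by (simp_all add: \<beta>_def carrier_AutoGroup)
  then have inv: "\<alpha> (\<beta> g) = g" "\<beta> (\<alpha> g) = g" if "g \<in> carrier G" for g
    using that \<alpha> \<beta> by (auto simp: mult_AutoGroup one_AutoGroup compose_def fun_eq_iff split: if_splits)
  have closed: "(\<lambda>q\<in>V. \<theta> (s q)) \<in> carrier (sect C_sheaf V)"
    if "\<theta> \<in> auto G" "s \<in> carrier (sect C_sheaf V)" for \<theta> s
    using section_pointwise[OF that(2) that(2), of "\<lambda>a b. \<theta> a" V] auto_closed[OF that(1)] by simp
  show "const_aut U \<alpha> V \<in> auto (sect C_sheaf V)"
  proof (rule autoI[where \<beta> = "\<lambda>s. \<lambda>q\<in>V. \<beta> (s q)"])
    show "const_aut U \<alpha> V \<in> extensional (carrier (sect C_sheaf V))"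
      using V by (simp add: const_aut_def)
    fix s assume s: "s \<in> carrier (sect C_sheaf V)"
    note sq = sectionD(2)[OF s]
    show "const_aut U \<alpha> V s \<in> carrier (sect C_sheaf V)"
      using closed[OF \<alpha> s] s V by (simp add: const_aut_def)
    show "(\<lambda>q\<in>V. \<beta> (s q)) \<in> carrier (sect C_sheaf V)" by (rule closed[OF \<beta> s])
    show "(\<lambda>q\<in>V. \<beta> (const_aut U \<alpha> V s q)) = s"
      by (rule extensionalityI[OF _ sectionD(1)[OF s]]) (use s V sq in \<open>auto simp: const_aut_def inv\<close>)
    show "const_aut U \<alpha> V (\<lambda>q\<in>V. \<beta> (s q)) = s"
      by (rule extensionalityI[OF _ sectionD(1)[OF s]])
         (use s V sq closed[OF \<beta> s] in \<open>auto simp: const_aut_def inv\<close>)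
    fix t assume t: "t \<in> carrier (sect C_sheaf V)"
    interpret S: group "sect C_sheaf V" by (rule group_section)
    have "\<alpha> (s q \<otimes> t q) = \<alpha> (s q) \<otimes> \<alpha> (t q)" if "q \<in> V" for q
      by (rule auto_mult[OF \<alpha> sq[OF that] sectionD(2)[OF t that]])
    with S.m_closed[OF s t] s t V
    show "const_aut U \<alpha> V (s \<otimes>\<^bsub>sect C_sheaf V\<^esub> t) =
        const_aut U \<alpha> V s \<otimes>\<^bsub>sect C_sheaf V\<^esub> const_aut U \<alpha> V t"
      by (simp add: const_aut_def section_mult fun_eq_iff)
  qed
  fix W s assume W: "open W" "W \<subseteq> V" and s: "s \<in> carrier (sect C_sheaf V)"
  then show "const_aut U \<alpha> W (rs C_sheaf V W s) = rs C_sheaf V W (const_aut U \<alpha> V s)"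
    using V section_restrict_closed[OF s W(2)]
    by (auto simp: const_aut_def section_restrict fun_eq_iff)
qed

lemma stalk_const_aut:
  assumes U: "open U" and q: "q \<in> U" and \<alpha>: "\<alpha> \<in> auto G"
  shows "stalk G U (const_aut U \<alpha>) q = \<alpha>"
  by (rule extensionalityI[of _ "carrier G"])
     (use assms in \<open>auto simp: stalk_def const_aut_def section_const auto_def Bij_def\<close>)

end

section \<open>Cocycles described on stalks\<close>

lemma ad_xmod_simps:
  "lower (ad_xmod F) = F" "upper (ad_xmod F) = aut_sheaf F" "act (ad_xmod F) U \<alpha> s = \<alpha> U s"
  by (simp_all add: ad_xmod_def)

context group
begin

lemma cocycles_iff:
  fixes c :: "('x::topological_space, 'x \<Rightarrow> 'a, 'x set \<Rightarrow> ('x \<Rightarrow> 'a) \<Rightarrow> 'x \<Rightarrow> 'a) cochain"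
  shows "c \<in> cocycles (ad_xmod C_sheaf) \<longleftrightarrow>
    pointed_cover (cov c) \<and>
    (\<forall>x. zer c x \<in> carrier (sect (aut_sheaf C_sheaf) (cov c x))) \<and>
    (\<forall>x y. trn c x y \<in> carrier (sect C_sheaf (cov c x \<inter> cov c y))) \<and>
    (\<forall>x y. \<forall>q\<in>cov c x \<inter> cov c y. \<forall>k\<in>carrier G.
      stalk G (cov c x) (zer c x) q k
        = trn c x y q \<otimes> stalk G (cov c y) (zer c y) q k \<otimes> inv trn c x y q) \<and>
    (\<forall>x y z. \<forall>q\<in>cov c x \<inter> cov c y \<inter> cov c z. trn c x y q \<otimes> trn c y z q = trn c x z q)"
    (is "?L \<longleftrightarrow> ?cov \<and> ?zer \<and> ?trn \<and> ?R1 \<and> ?R2")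
proof -
  let ?A = "aut_sheaf C_sheaf"
  let ?U = "cov c"
  define E1 where "E1 x y \<longleftrightarrow> (let W = ?U x \<inter> ?U y in
      rs ?A (?U x) W (zer c x)
        = bd (ad_xmod C_sheaf) W (trn c x y) \<otimes>\<^bsub>sect ?A W\<^esub> rs ?A (?U y) W (zer c y))" for x y
  define E2 where "E2 x y z \<longleftrightarrow> (let W = ?U x \<inter> ?U y \<inter> ?U z in
      rs C_sheaf (?U x \<inter> ?U y) W (trn c x y) \<otimes>\<^bsub>sect C_sheaf W\<^esub> rs C_sheaf (?U y \<inter> ?U z) W (trn c y z)
        = rs C_sheaf (?U x \<inter> ?U z) W (trn c x z))" for x y z
  have L: "?L \<longleftrightarrow> ?cov \<and> ?zer \<and> ?trn \<and> (\<forall>x y. E1 x y) \<and> (\<forall>x y z. E2 x y z)"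
    by (simp only: cocycles_def ad_xmod_simps E1_def E2_def mem_Collect_eq Let_def)
  have E1: "E1 x y \<longleftrightarrow> (\<forall>q\<in>?U x \<inter> ?U y. \<forall>k\<in>carrier G. stalk G (?U x) (zer c x) q k
        = trn c x y q \<otimes> stalk G (?U y) (zer c y) q k \<otimes> inv trn c x y q)"
    if c: ?cov ?zer ?trn for x y
  proof -
    define W where "W = ?U x \<inter> ?U y"
    have o: "open (?U x)" "open (?U y)" "open W" using c(1) by (auto simp: pointed_cover_def W_def)
    have sub: "W \<subseteq> ?U x" "W \<subseteq> ?U y" by (auto simp: W_def)
    have z: "zer c x \<in> carrier (sect ?A (?U x))" "zer c y \<in> carrier (sect ?A (?U y))"
      using c(2) by blast+
    have t: "trn c x y \<in> carrier (sect C_sheaf W)" using c(3) by (simp add: W_def)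
    note zx = aut_section_restrict_closed[OF z(1) sub(1)]
    note zy = aut_section_restrict_closed[OF z(2) sub(2)]
    have "E1 x y \<longleftrightarrow> (\<forall>q\<in>W. stalk G W (restrict (zer c x) (opens_in W)) q =
        stalk G W (bd (ad_xmod C_sheaf) W (trn c x y) \<otimes>\<^bsub>sect ?A W\<^esub> restrict (zer c y) (opens_in W)) q)"
      unfolding E1_def Let_def W_def[symmetric] aut_section_restrict
      by (rule aut_section_eq_iff[OF zx aut_section_mult_closed[OF bd_closed[OF t] zy] o(3)])
    also have "\<dots> \<longleftrightarrow> (\<forall>q\<in>W. \<forall>k\<in>carrier G. stalk G (?U x) (zer c x) q k
        = trn c x y q \<otimes> stalk G (?U y) (zer c y) q k \<otimes> inv trn c x y q)"
    proof (rule ball_cong[OF refl])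
      fix q assume q: "q \<in> W"
      then have qU: "q \<in> ?U x" "q \<in> ?U y" by (auto simp: W_def)
      show "stalk G W (restrict (zer c x) (opens_in W)) q =
          stalk G W (bd (ad_xmod C_sheaf) W (trn c x y) \<otimes>\<^bsub>sect ?A W\<^esub> restrict (zer c y) (opens_in W)) q
        \<longleftrightarrow> (\<forall>k\<in>carrier G. stalk G (?U x) (zer c x) q k
          = trn c x y q \<otimes> stalk G (?U y) (zer c y) q k \<otimes> inv trn c x y q)"
        unfolding stalk_mult[OF bd_closed[OF t] zy o(3) q] stalk_bd[OF t o(3) q]
          stalk_restrict[OF z(1) o(1) o(3) sub(1) q] stalk_restrict[OF z(2) o(2) o(3) sub(2) q]
        by (rule inner_aut_mult_eq_iff[OF sectionD(2)[OF t q] stalk_auto[OF z(2) o(2) qU(2)]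
              stalk_auto[OF z(1) o(1) qU(1)]])
    qed
    finally show ?thesis by (simp add: W_def)
  qed
  have E2: "E2 x y z \<longleftrightarrow> (\<forall>q\<in>?U x \<inter> ?U y \<inter> ?U z. trn c x y q \<otimes> trn c y z q = trn c x z q)" for x y z
    by (auto simp: E2_def Let_def section_restrict section_mult fun_eq_iff restrict_def)
  show ?thesis unfolding L by (intro conj_cong refl all_cong1 E1 E2)
qed

lemma cohomologous_iff:
  fixes c c' :: "('x::topological_space, 'x \<Rightarrow> 'a, 'x set \<Rightarrow> ('x \<Rightarrow> 'a) \<Rightarrow> 'x \<Rightarrow> 'a) cochain"
  assumes c: "c \<in> cocycles (ad_xmod C_sheaf)" and c': "c' \<in> cocycles (ad_xmod C_sheaf)"
  shows "(c, c') \<in> cohomologous (ad_xmod C_sheaf) \<longleftrightarrow>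
    (\<exists>W h. pointed_cover W \<and>
      (\<forall>x. W x \<subseteq> cov c x \<inter> cov c' x \<and> h x \<in> carrier (sect C_sheaf (W x)) \<and>
        (\<forall>q\<in>W x. \<forall>k\<in>carrier G. stalk G (cov c' x) (zer c' x) q k
          = h x q \<otimes> stalk G (cov c x) (zer c x) q k \<otimes> inv h x q)) \<and>
      (\<forall>x y. \<forall>q\<in>W x \<inter> W y. trn c' x y q = h x q \<otimes> trn c x y q \<otimes> inv h y q))"
proof -
  let ?A = "aut_sheaf C_sheaf"
  let ?U = "cov c" and ?U' = "cov c'"
  define E1 where "E1 W h x \<longleftrightarrow> rs ?A (?U' x) (W x) (zer c' x)
            = bd (ad_xmod C_sheaf) (W x) (h x) \<otimes>\<^bsub>sect ?A (W x)\<^esub> rs ?A (?U x) (W x) (zer c x)" for W h x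
  define E2 where "E2 W h x y \<longleftrightarrow> (let V = W x \<inter> W y in
          rs C_sheaf (?U' x \<inter> ?U' y) V (trn c' x y)
            = rs C_sheaf (W x) V (h x) \<otimes>\<^bsub>sect C_sheaf V\<^esub> rs C_sheaf (?U x \<inter> ?U y) V (trn c x y)
                \<otimes>\<^bsub>sect C_sheaf V\<^esub> inv\<^bsub>sect C_sheaf V\<^esub> (rs C_sheaf (W y) V (h y)))" for W h x y
  have L: "(c, c') \<in> cohomologous (ad_xmod C_sheaf) \<longleftrightarrow>
    (\<exists>W h. pointed_cover W \<and>
      (\<forall>x. W x \<subseteq> ?U x \<inter> ?U' x \<and> h x \<in> carrier (sect C_sheaf (W x)) \<and> E1 W h x) \<and>
      (\<forall>x y. E2 W h x y))"
    by (simp only: cohomologous_def ad_xmod_simps E1_def E2_def mem_Collect_eq Let_def case_prod_conv c c'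
        simp_thms)
  have oc: "open (?U x)" "open (?U' x)" "zer c x \<in> carrier (sect ?A (?U x))"
      "zer c' x \<in> carrier (sect ?A (?U' x))" for x
    using c c' unfolding cocycles_iff by (auto simp: pointed_cover_def)
  have E1: "E1 W h x \<longleftrightarrow> (\<forall>q\<in>W x. \<forall>k\<in>carrier G. stalk G (cov c' x) (zer c' x) q k
          = h x q \<otimes> stalk G (cov c x) (zer c x) q k \<otimes> inv h x q)"
    if "pointed_cover W" "W x \<subseteq> ?U x \<inter> ?U' x" "h x \<in> carrier (sect C_sheaf (W x))" for W h x
  proof -
    have o: "open (W x)" using that(1) by (simp add: pointed_cover_def)
    have sub: "W x \<subseteq> ?U x" "W x \<subseteq> ?U' x" using that(2) by auto
    note zx = aut_section_restrict_closed[OF oc(3) sub(1)]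
    note zx' = aut_section_restrict_closed[OF oc(4) sub(2)]
    have "E1 W h x \<longleftrightarrow> (\<forall>q\<in>W x. stalk G (W x) (restrict (zer c' x) (opens_in (W x))) q =
        stalk G (W x) (bd (ad_xmod C_sheaf) (W x) (h x) \<otimes>\<^bsub>sect ?A (W x)\<^esub> restrict (zer c x) (opens_in (W x))) q)"
      unfolding E1_def aut_section_restrict
      by (rule aut_section_eq_iff[OF zx' aut_section_mult_closed[OF bd_closed[OF that(3)] zx] o])
    also have "\<dots> \<longleftrightarrow> (\<forall>q\<in>W x. \<forall>k\<in>carrier G. stalk G (cov c' x) (zer c' x) q k
          = h x q \<otimes> stalk G (cov c x) (zer c x) q k \<otimes> inv h x q)"
    proof (rule ball_cong[OF refl])
      fix q assume q: "q \<in> W x"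
      then have qU: "q \<in> ?U x" "q \<in> ?U' x" using sub by auto
      show "stalk G (W x) (restrict (zer c' x) (opens_in (W x))) q =
          stalk G (W x) (bd (ad_xmod C_sheaf) (W x) (h x) \<otimes>\<^bsub>sect ?A (W x)\<^esub> restrict (zer c x) (opens_in (W x))) q
        \<longleftrightarrow> (\<forall>k\<in>carrier G. stalk G (cov c' x) (zer c' x) q k
          = h x q \<otimes> stalk G (cov c x) (zer c x) q k \<otimes> inv h x q)"
        unfolding stalk_mult[OF bd_closed[OF that(3)] zx o q] stalk_bd[OF that(3) o q]
          stalk_restrict[OF oc(3) oc(1) o sub(1) q] stalk_restrict[OF oc(4) oc(2) o sub(2) q]
        by (rule inner_aut_mult_eq_iff[OF sectionD(2)[OF that(3) q] stalk_auto[OF oc(3) oc(1) qU(1)]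
              stalk_auto[OF oc(4) oc(2) qU(2)]])
    qed
    finally show ?thesis .
  qed
  have E2: "E2 W h x y \<longleftrightarrow> (\<forall>q\<in>W x \<inter> W y. trn c' x y q = h x q \<otimes> trn c x y q \<otimes> inv h y q)"
    if "h y \<in> carrier (sect C_sheaf (W y))" for W h x y
  proof -
    have r: "restrict (h y) (W x \<inter> W y) \<in> carrier (sect C_sheaf (W x \<inter> W y))"
      by (rule section_restrict_closed[OF that]) auto
    show ?thesis
      unfolding E2_def Let_def section_restrict section_inv[OF r] section_mult
      by (auto simp: fun_eq_iff restrict_def)
  qed
  show ?thesis unfolding L by (intro ex_cong1 conj_cong refl all_cong1 E1 E2) blast+
qed

end

section \<open>The invariant of a cocycle\<close>

text \<open>The classes are the fibres of \<open>\<Psi>\<close>, and sending an element of \<open>B\<close> to its fibre is the isomorphism.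
  The group axioms are carried over from \<open>B\<close> along it.\<close>
lemma quotient_by_invariant:
  fixes B (structure) and \<Psi> :: "'c \<Rightarrow> 'b"
  assumes B: "group B"
    and \<Psi>: "\<Psi> ` C = carrier B"
    and r: "\<And>c d. (c, d) \<in> r \<longleftrightarrow> c \<in> C \<and> d \<in> C \<and> \<Psi> c = \<Psi> d"
    and mult: "\<And>c d. c \<in> C \<Longrightarrow> d \<in> C \<Longrightarrow> mlt c d \<in> C"
      "\<And>c d. c \<in> C \<Longrightarrow> d \<in> C \<Longrightarrow> \<Psi> (mlt c d) = \<Psi> c \<otimes> \<Psi> d"
    and one: "e \<in> C" "\<Psi> e = \<one>"
  defines "Q \<equiv> \<lparr>carrier = C // r, mult = (\<lambda>S T. \<Union>c\<in>S. \<Union>d\<in>T. r `` {mlt c d}), one = r `` {e}\<rparr>"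
  shows "group Q \<and> Q \<cong> B"
proof -
  interpret B: group B by (rule B)
  define f where "f b = {c \<in> C. \<Psi> c = b}" for b
  have cls: "r `` {c} = f (\<Psi> c)" if "c \<in> C" for c
    using that by (auto simp: r f_def)
  have carrier_Q: "carrier Q = f ` carrier B"
    unfolding \<Psi>[symmetric] by (auto simp: Q_def quotient_def cls)
  have nonempty: "\<exists>c\<in>C. \<Psi> c = b" if "b \<in> carrier B" for b
    using that unfolding \<Psi>[symmetric] by auto
  have f_mult: "f a \<otimes>\<^bsub>Q\<^esub> f b = f (a \<otimes> b)" if ab: "a \<in> carrier B" "b \<in> carrier B" for a b
  proof -
    have "r `` {mlt c d} = f (a \<otimes> b)" if "c \<in> f a" "d \<in> f b" for c d
      using that mult by (auto simp: f_def cls)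
    moreover have "f a \<noteq> {}" "f b \<noteq> {}" using nonempty[OF ab(1)] nonempty[OF ab(2)] by (auto simp: f_def)
    ultimately show ?thesis by (auto simp: Q_def)
  qed
  have hom: "f \<in> hom B Q" by (rule homI) (auto simp: carrier_Q f_mult)
  have "inj_on f (carrier B)"
  proof (rule inj_onI)
    fix a b assume a: "a \<in> carrier B" and eq: "f a = f b"
    obtain c where "c \<in> f a" using nonempty[OF a] by (auto simp: f_def)
    with eq show "a = b" by (auto simp: f_def)
  qed
  then have "f \<in> iso B Q" using hom by (simp add: iso_def bij_betw_def carrier_Q)
  then have iso: "B \<cong> Q" by (auto simp: is_iso_def)
  have "Q = Q\<lparr>carrier := f ` carrier B, one := f \<one>\<rparr>"
    using carrier_Q cls[OF one(1)] one(2) by (simp add: Q_def)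
  with B.hom_imp_img_group[OF hom] have "group Q" by metis
  with B.iso_sym[OF iso] show ?thesis by simp
qed

type_synonym ('x, 'g) bitorsor_cocycle =
  "('x, 'x \<Rightarrow> 'g, 'x set \<Rightarrow> ('x \<Rightarrow> 'g) \<Rightarrow> 'x \<Rightarrow> 'g) cochain"

text \<open>The transition function between the charts at \<open>p\<close> and at \<open>q\<close>, evaluated at \<open>q\<close>. The value
  outside the chart at \<open>p\<close> is a default.\<close>
definition local_transition where
  "local_transition G c p q = (if q \<in> cov c p then trn c p q q else \<one>\<^bsub>G\<^esub>)"

definition local_frame where
  "local_frame G c p = stalk G (cov c p) (zer c p) p"

locale group_on_space = group G
  for G :: "('g, 'm) monoid_scheme" (structure) +
  fixes x0 :: "'x::topological_space"
  assumes connected_space: "connected (UNIV :: 'x set)"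
    and local_1_connected: "locally_relatively_1_connected TYPE('x)"
begin

abbreviation Cocycles :: "('x, 'g) bitorsor_cocycle set" where
  "Cocycles \<equiv> cocycles (ad_xmod (const_sheaf G))"

abbreviation loop_group :: "(real \<Rightarrow> 'x) set monoid" where
  "loop_group \<equiv> fundamental_group x0"

lemma path_connected_nbhd:
  fixes x :: 'x
  assumes "open N" "x \<in> N"
  obtains P where "x \<in> interior P" "P \<subseteq> N" "path_connected P"
  using assms local_1_connected unfolding locally_relatively_1_connected_def by metis

lemma path_from_base: "\<exists>p. path p \<and> pathstart p = x0 \<and> pathfinish p = (x::'x)"
proof -
  define f where "f x = (\<exists>p. path p \<and> pathstart p = x0 \<and> pathfinish p = x)" for x
  have "f x0 = f x"
  proof (rule eventually_constant_on_connected[OF connected_space])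
    fix z :: 'x
    obtain P where P: "z \<in> interior P" "path_connected P" using path_connected_nbhd[of UNIV z] by auto
    have "f w = f z" if w: "w \<in> P" for w
    proof -
      have zP: "z \<in> P" using P interior_subset by auto
      obtain r where r: "path r" "pathstart r = z" "pathfinish r = w"
        using P(2)[unfolded path_connected_def, rule_format, OF zP w] by (elim exE conjE)
      show ?thesis
      proof
        assume "f w"
        then obtain p where "path p" "pathstart p = x0" "pathfinish p = w" by (auto simp: f_def)
        with r show "f z" unfolding f_def by (intro exI[of _ "p +++ reversepath r"]) simp
      next
        assume "f z"
        then obtain p where "path p" "pathstart p = x0" "pathfinish p = z" by (auto simp: f_def)
        with r show "f w" unfolding f_def by (intro exI[of _ "p +++ r"]) simp
      qed
    qed
    moreover have "\<forall>\<^sub>F w in nhds z. w \<in> interior P" using P by (intro eventually_nhds_in_open) auto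
    ultimately show "\<forall>\<^sub>F w in nhds z. w \<in> UNIV \<longrightarrow> f w = f z"
      using interior_subset by (auto elim!: eventually_mono)
  qed auto
  moreover have "f x0" unfolding f_def
    by (intro exI[of _ "\<lambda>_. x0"]) (simp add: pathstart_def pathfinish_def)
  ultimately show ?thesis by (simp add: f_def)
qed

lemma cocycleD:
  assumes "c \<in> Cocycles"
  shows "open (cov c x)" "x \<in> cov c x"
    "zer c x \<in> carrier (sect (aut_sheaf (const_sheaf G)) (cov c x))"
    "trn c x y \<in> carrier (sect (const_sheaf G) (cov c x \<inter> cov c y))"
    "q \<in> cov c x \<Longrightarrow> q \<in> cov c y \<Longrightarrow> trn c x y q \<in> carrier G"
    "q \<in> cov c x \<Longrightarrow> q \<in> cov c y \<Longrightarrow> k \<in> carrier G \<Longrightarrow> stalk G (cov c x) (zer c x) q k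
        = trn c x y q \<otimes> stalk G (cov c y) (zer c y) q k \<otimes> inv trn c x y q"
    "q \<in> cov c x \<Longrightarrow> q \<in> cov c y \<Longrightarrow> q \<in> cov c z \<Longrightarrow> trn c x y q \<otimes> trn c y z q = trn c x z q"
    "q \<in> cov c x \<Longrightarrow> stalk G (cov c x) (zer c x) q \<in> auto G"
proof -
  note c = assms[unfolded cocycles_iff]
  show o: "open (cov c x)" "x \<in> cov c x" using c by (auto simp: pointed_cover_def)
  show z: "zer c x \<in> carrier (sect (aut_sheaf (const_sheaf G)) (cov c x))" using c by blast
  show t: "trn c x y \<in> carrier (sect (const_sheaf G) (cov c x \<inter> cov c y))" using c by blast
  show "trn c x y q \<in> carrier G" if "q \<in> cov c x" "q \<in> cov c y"
    using sectionD(2)[OF t] that by blast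
  show "stalk G (cov c x) (zer c x) q k
        = trn c x y q \<otimes> stalk G (cov c y) (zer c y) q k \<otimes> inv trn c x y q"
    if "q \<in> cov c x" "q \<in> cov c y" "k \<in> carrier G" using c that by blast
  show "trn c x y q \<otimes> trn c y z q = trn c x z q"
    if "q \<in> cov c x" "q \<in> cov c y" "q \<in> cov c z" using c that by blast
  show "stalk G (cov c x) (zer c x) q \<in> auto G" if "q \<in> cov c x"
    by (rule stalk_auto[OF z o(1) that])
qed

lemma trn_refl:
  assumes c: "c \<in> Cocycles" and q: "q \<in> cov c x"
  shows "trn c x x q = \<one>"
  using cocycleD(7)[OF c q q q] cocycleD(5)[OF c q q] by simp

lemma eventually_cov: "c \<in> Cocycles \<Longrightarrow> q \<in> cov c x \<Longrightarrow> \<forall>\<^sub>F r in nhds q. r \<in> cov c x"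
  using cocycleD(1) by (rule eventually_nhds_in_open)

text \<open>The cocycle law at the point \<open>r\<close> relates \<open>trn c p q r\<close>, \<open>trn c q r r\<close> and \<open>trn c p r r\<close>. Local
  constancy replaces the first by its value at \<open>q\<close>.\<close>
lemma local_system_transition:
  assumes c: "c \<in> Cocycles"
  shows "local_system G (local_transition G c)"
proof unfold_locales
  fix p q
  show "local_transition G c p q \<in> carrier G"
    using cocycleD(5)[OF c, of q p q] cocycleD(2)[OF c] by (simp add: local_transition_def)
  show "local_transition G c p p = \<one>"
    using trn_refl[OF c cocycleD(2)[OF c]] by (simp add: local_transition_def)
  show "\<forall>\<^sub>F q in nhds p. \<forall>\<^sub>F r in nhds q. local_transition G c p r =
      local_transition G c p q \<otimes> local_transition G c q r"
    using eventually_cov[OF c cocycleD(2)[OF c], of p]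
  proof eventually_elim
    case (elim q)
    have qq: "q \<in> cov c p \<inter> cov c q" using elim cocycleD(2)[OF c] by simp
    show ?case
      using eventually_cov[OF c elim] eventually_cov[OF c cocycleD(2)[OF c], of q]
        sectionD(3)[OF cocycleD(4)[OF c] qq]
    proof eventually_elim
      case (elim r)
      then have r: "trn c p q r = trn c p q q" by simp
      have "trn c p q q \<otimes> trn c q r r = trn c p r r"
        using cocycleD(7)[OF c elim(1,2) cocycleD(2)[OF c]] unfolding r .
      then show ?case using elim qq by (simp add: local_transition_def)
    qed
  qed
qed

lemma twisted_local_system_frame:
  assumes c: "c \<in> Cocycles"
  shows "twisted_local_system G (local_transition G c) (local_frame G c)"
proof -
  interpret local_system G "local_transition G c" by (rule local_system_transition[OF c])
  show ?thesis
  proof unfold_locales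
    fix p
    show "local_frame G c p \<in> auto G"
      unfolding local_frame_def by (rule cocycleD(8)[OF c cocycleD(2)[OF c]])
    obtain P where P: "p \<in> interior P" "P \<subseteq> cov c p" "path_connected P"
      using path_connected_nbhd[OF cocycleD(1,2)[OF c]] .
    show "\<forall>\<^sub>F q in nhds p. \<forall>g\<in>carrier G. local_frame G c p g =
        local_transition G c p q \<otimes> local_frame G c q g \<otimes> inv local_transition G c p q"
      using stalk_locally_constant[OF cocycleD(3,1,2)[OF c] P] eventually_cov[OF c cocycleD(2)[OF c], of p]
    proof eventually_elim
      case (elim q)
      show ?case
      proof
        fix g assume g: "g \<in> carrier G"
        show "local_frame G c p g =
          local_transition G c p q \<otimes> local_frame G c q g \<otimes> inv local_transition G c p q"
          using cocycleD(6)[OF c elim(2) cocycleD(2)[OF c] g] elim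
          by (simp add: local_frame_def local_transition_def)
      qed
    qed
  qed
qed

definition invariant :: "('x, 'g) bitorsor_cocycle \<Rightarrow> ((real \<Rightarrow> 'x) set \<Rightarrow> 'g) \<times> ('g \<Rightarrow> 'g) set" where
  "invariant c = (on_loop_classes x0 (transport G (local_transition G c)), outer_class G (local_frame G c x0))"

abbreviation target where
  "target \<equiv> semidirect (hom_group loop_group (center_group G)) (Out G) (out_action loop_group)"

lemma group_target: "group target"
  by (rule group_semidirect_out) (rule fundamental_group_mult_closed)

lemma monodromy_hom:
  assumes c: "c \<in> Cocycles"
  shows "on_loop_classes x0 (transport G (local_transition G c)) \<in> carrier (hom_group loop_group (center_group G))"
proof -
  interpret twisted_local_system G "local_transition G c" "local_frame G c"
    by (rule twisted_local_system_frame[OF c])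
  show ?thesis
    by (rule path_functor.on_loop_classes_hom[OF path_functor_transport])
       (simp add: transport_loop_central)
qed

lemma invariant_closed:
  assumes c: "c \<in> Cocycles"
  shows "invariant c \<in> carrier target"
  using monodromy_hom[OF c] cocycleD(8)[OF c cocycleD(2)[OF c], of x0]
  by (simp add: invariant_def semidirect_def carrier_Out local_frame_def)

section \<open>The product of cocycles\<close>

abbreviation cocycle_prod :: "('x, 'g) bitorsor_cocycle \<Rightarrow> ('x, 'g) bitorsor_cocycle \<Rightarrow> ('x, 'g) bitorsor_cocycle" where
  "cocycle_prod \<equiv> cocycle_mult (ad_xmod (const_sheaf G))"

lemma cov_cocycle_prod: "cov (cocycle_prod c d) x = cov c x \<inter> cov d x"
  by (simp add: cocycle_mult_def Let_def)

lemma zer_cocycle_prod: "zer (cocycle_prod c d) x =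
    restrict (zer c x) (opens_in (cov c x \<inter> cov d x))
      \<otimes>\<^bsub>sect (aut_sheaf (const_sheaf G)) (cov c x \<inter> cov d x)\<^esub>
    restrict (zer d x) (opens_in (cov c x \<inter> cov d x))"
  unfolding cocycle_mult_def Let_def ad_xmod_simps aut_section_restrict by simp

lemma stalk_cocycle_prod:
  assumes c: "c \<in> Cocycles" and d: "d \<in> Cocycles" and q: "q \<in> cov c x" "q \<in> cov d x"
  shows "zer (cocycle_prod c d) x \<in> carrier (sect (aut_sheaf (const_sheaf G)) (cov c x \<inter> cov d x))"
    "stalk G (cov c x \<inter> cov d x) (zer (cocycle_prod c d) x) q =
      stalk G (cov c x) (zer c x) q \<otimes>\<^bsub>AutoGroup G\<^esub> stalk G (cov d x) (zer d x) q"
proof -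
  have o: "open (cov c x \<inter> cov d x)" using cocycleD(1)[OF c] cocycleD(1)[OF d] by (rule open_Int)
  note rc = aut_section_restrict_closed[OF cocycleD(3)[OF c] Int_lower1]
  note rd = aut_section_restrict_closed[OF cocycleD(3)[OF d] Int_lower2]
  show "zer (cocycle_prod c d) x \<in> carrier (sect (aut_sheaf (const_sheaf G)) (cov c x \<inter> cov d x))"
    unfolding zer_cocycle_prod by (rule aut_section_mult_closed[OF rc rd])
  have q': "q \<in> cov c x \<inter> cov d x" using q by simp
  show "stalk G (cov c x \<inter> cov d x) (zer (cocycle_prod c d) x) q =
      stalk G (cov c x) (zer c x) q \<otimes>\<^bsub>AutoGroup G\<^esub> stalk G (cov d x) (zer d x) q"
    unfolding zer_cocycle_prod stalk_mult[OF rc rd o q']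
      stalk_restrict[OF cocycleD(3,1)[OF c] o Int_lower1 q']
      stalk_restrict[OF cocycleD(3,1)[OF d] o Int_lower2 q'] ..
qed

lemma trn_cocycle_prod:
  assumes c: "c \<in> Cocycles" and d: "d \<in> Cocycles"
  shows "trn (cocycle_prod c d) x y \<in> carrier (sect (const_sheaf G) (cov (cocycle_prod c d) x \<inter> cov (cocycle_prod c d) y))"
    "q \<in> cov c x \<Longrightarrow> q \<in> cov d x \<Longrightarrow> q \<in> cov c y \<Longrightarrow> q \<in> cov d y \<Longrightarrow>
      trn (cocycle_prod c d) x y q = trn c x y q \<otimes> stalk G (cov c y) (zer c y) q (trn d x y q)"
proof -
  define W where "W = cov (cocycle_prod c d) x \<inter> cov (cocycle_prod c d) y"
  have W_eq: "W = (cov c x \<inter> cov d x) \<inter> (cov c y \<inter> cov d y)" by (simp add: W_def cov_cocycle_prod)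
  have o: "open W" unfolding W_eq using cocycleD(1)[OF c] cocycleD(1)[OF d] by (intro open_Int)
  have sub: "W \<subseteq> cov c y" "W \<subseteq> cov c x \<inter> cov c y" "W \<subseteq> cov d x \<inter> cov d y" by (auto simp: W_eq)
  have k: "restrict (trn d x y) W \<in> carrier (sect (const_sheaf G) W)"
    by (rule section_restrict_closed[OF cocycleD(4)[OF d] sub(3)])
  have g: "restrict (trn c x y) W \<in> carrier (sect (const_sheaf G) W)"
    by (rule section_restrict_closed[OF cocycleD(4)[OF c] sub(2)])
  have ak: "zer c y W (restrict (trn d x y) W) \<in> carrier (sect (const_sheaf G) W)"
    by (rule auto_closed[OF aut_sectionD(2)[OF cocycleD(3)[OF c] o sub(1)] k])
  have trn: "trn (cocycle_prod c d) x y = restrict (trn c x y) W \<otimes>\<^bsub>sect (const_sheaf G) W\<^esub>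
      zer c y W (restrict (trn d x y) W)"
    unfolding W_eq cocycle_mult_def Let_def ad_xmod_simps aut_section_restrict section_restrict
    using o by (auto simp: W_eq)
  show "trn (cocycle_prod c d) x y \<in> carrier (sect (const_sheaf G) (cov (cocycle_prod c d) x \<inter> cov (cocycle_prod c d) y))"
    unfolding trn W_def[symmetric] by (rule monoid.m_closed[OF group.is_monoid[OF group_section] g ak])
  assume "q \<in> cov c x" "q \<in> cov d x" "q \<in> cov c y" "q \<in> cov d y"
  then have q: "q \<in> W" by (simp add: W_eq)
  show "trn (cocycle_prod c d) x y q = trn c x y q \<otimes> stalk G (cov c y) (zer c y) q (trn d x y q)"
    using stalk_apply[OF cocycleD(3,1)[OF c] o sub(1) k q] q by (simp add: trn section_mult)
qed

lemma cocycle_prod_closed: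
  assumes c: "c \<in> Cocycles" and d: "d \<in> Cocycles"
  shows "cocycle_prod c d \<in> Cocycles"
  unfolding cocycles_iff
proof (intro conjI allI ballI)
  show "pointed_cover (cov (cocycle_prod c d))"
    using cocycleD(1,2)[OF c] cocycleD(1,2)[OF d] by (auto simp: pointed_cover_def cov_cocycle_prod)
  fix x
  show "zer (cocycle_prod c d) x \<in> carrier (sect (aut_sheaf (const_sheaf G)) (cov (cocycle_prod c d) x))"
    unfolding cov_cocycle_prod by (rule stalk_cocycle_prod(1)[OF c d cocycleD(2)[OF c] cocycleD(2)[OF d]])
  fix y
  show "trn (cocycle_prod c d) x y \<in> carrier (sect (const_sheaf G) (cov (cocycle_prod c d) x \<inter> cov (cocycle_prod c d) y))"
    by (rule trn_cocycle_prod(1)[OF c d])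
  {
    fix q k assume "q \<in> cov (cocycle_prod c d) x \<inter> cov (cocycle_prod c d) y" and k: "k \<in> carrier G"
    then have q: "q \<in> cov c x" "q \<in> cov d x" "q \<in> cov c y" "q \<in> cov d y" by (auto simp: cov_cocycle_prod)
    define a where "a = stalk G (cov c y) (zer c y) q"
    define b where "b = stalk G (cov d y) (zer d y) q"
    define a' where "a' = stalk G (cov c x) (zer c x) q"
    define b' where "b' = stalk G (cov d x) (zer d x) q"
    define g where "g = trn c x y q"
    define t where "t = trn d x y q"
    have auto: "a \<in> auto G" "b \<in> auto G" "a' \<in> auto G" "b' \<in> auto G"
      unfolding a_def b_def a'_def b'_def
      by (rule cocycleD(8)[OF c q(3)] cocycleD(8)[OF d q(4)] cocycleD(8)[OF c q(1)] cocycleD(8)[OF d q(2)])+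
    have gt: "g \<in> carrier G" "t \<in> carrier G"
      unfolding g_def t_def by (rule cocycleD(5)[OF c q(1,3)] cocycleD(5)[OF d q(2,4)])+
    have a': "a' h = g \<otimes> a h \<otimes> inv g" if "h \<in> carrier G" for h
      unfolding a_def a'_def g_def by (rule cocycleD(6)[OF c q(1,3) that])
    have b': "b' k = t \<otimes> b k \<otimes> inv t"
      unfolding b_def b'_def t_def by (rule cocycleD(6)[OF d q(2,4) k])
    have cl: "b k \<in> carrier G" "a t \<in> carrier G" "a (b k) \<in> carrier G"
      using auto gt k by (simp_all add: auto_closed)
    have inv: "a (inv t) = inv (a t)"
      using auto(1) gt by (intro group_hom.hom_inv) (auto simp: group_hom_def group_hom_axioms_def auto_def)
    have "a' (b' k) = g \<otimes> (a t \<otimes> a (b k) \<otimes> inv (a t)) \<otimes> inv g"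
      using gt cl by (simp add: a' b' auto_mult[OF auto(1)] inv)
    also have "\<dots> = (g \<otimes> a t) \<otimes> a (b k) \<otimes> inv (g \<otimes> a t)"
      using gt cl by (simp add: m_assoc inv_mult_group)
    finally have "a' (b' k) = (g \<otimes> a t) \<otimes> a (b k) \<otimes> inv (g \<otimes> a t)" .
    then show "stalk G (cov (cocycle_prod c d) x) (zer (cocycle_prod c d) x) q k
        = trn (cocycle_prod c d) x y q \<otimes> stalk G (cov (cocycle_prod c d) y) (zer (cocycle_prod c d) y) q k
            \<otimes> inv trn (cocycle_prod c d) x y q"
      unfolding cov_cocycle_prod stalk_cocycle_prod(2)[OF c d q(1,2)] stalk_cocycle_prod(2)[OF c d q(3,4)] trn_cocycle_prod(2)[OF c d q]
        a_def[symmetric] b_def[symmetric] a'_def[symmetric] b'_def[symmetric] g_def[symmetric] t_def[symmetric]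
      using auto k by (simp add: mult_AutoGroup compose_def)
  }
  fix z q assume "q \<in> cov (cocycle_prod c d) x \<inter> cov (cocycle_prod c d) y \<inter> cov (cocycle_prod c d) z"
  then have q: "q \<in> cov c x" "q \<in> cov d x" "q \<in> cov c y" "q \<in> cov d y" "q \<in> cov c z" "q \<in> cov d z"
    by (auto simp: cov_cocycle_prod)
  define a where "a = stalk G (cov c z) (zer c z) q"
  have a: "a \<in> auto G" unfolding a_def by (rule cocycleD(8)[OF c q(5)])
  note t1 = cocycleD(5)[OF d q(2,4)] and t2 = cocycleD(5)[OF d q(4,6)]
  note g1 = cocycleD(5)[OF c q(1,3)] and g2 = cocycleD(5)[OF c q(3,5)]
  have "trn (cocycle_prod c d) x y q \<otimes> trn (cocycle_prod c d) y z q
      = trn c x y q \<otimes> (trn c y z q \<otimes> a (trn d x y q) \<otimes> inv trn c y z q) \<otimes> (trn c y z q \<otimes> a (trn d y z q))"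
    unfolding trn_cocycle_prod(2)[OF c d q(1-4)] trn_cocycle_prod(2)[OF c d q(3-6)] cocycleD(6)[OF c q(3,5) t1] a_def ..
  also have "\<dots> = (trn c x y q \<otimes> trn c y z q) \<otimes> (a (trn d x y q) \<otimes> a (trn d y z q))"
    using g1 g2 auto_closed[OF a t1] auto_closed[OF a t2] by (simp add: m_assoc group_cancel)
  also have "\<dots> = trn c x z q \<otimes> a (trn d x z q)"
    unfolding cocycleD(7)[OF c q(1,3,5)] auto_mult[OF a t1 t2, symmetric] cocycleD(7)[OF d q(2,4,6)] ..
  also have "\<dots> = trn (cocycle_prod c d) x z q"
    unfolding trn_cocycle_prod(2)[OF c d q(1,2,5,6)] a_def ..
  finally show "trn (cocycle_prod c d) x y q \<otimes> trn (cocycle_prod c d) y z q = trn (cocycle_prod c d) x z q" .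
qed

text \<open>The factor \<open>local_frame G c q\<close> in the product of the transition functions is what makes
  \<open>transport_product\<close> applicable.\<close>
lemma invariant_mult:
  assumes c: "c \<in> Cocycles" and d: "d \<in> Cocycles"
  shows "invariant (cocycle_prod c d) = invariant c \<otimes>\<^bsub>target\<^esub> invariant d"
proof -
  interpret c: twisted_local_system G "local_transition G c" "local_frame G c"
    by (rule twisted_local_system_frame[OF c])
  interpret d: twisted_local_system G "local_transition G d" "local_frame G d"
    by (rule twisted_local_system_frame[OF d])
  interpret cd: twisted_local_system G "local_transition G (cocycle_prod c d)" "local_frame G (cocycle_prod c d)"
    by (rule twisted_local_system_frame[OF cocycle_prod_closed[OF c d]])
  have "\<forall>\<^sub>F q in nhds p. local_transition G (cocycle_prod c d) p q =
      local_transition G c p q \<otimes> local_frame G c q (local_transition G d p q)" for p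
    using eventually_cov[OF c cocycleD(2)[OF c], of p] eventually_cov[OF d cocycleD(2)[OF d], of p]
  proof eventually_elim
    case (elim q)
    then show ?case
      using trn_cocycle_prod(2)[OF c d elim cocycleD(2)[OF c] cocycleD(2)[OF d]]
      by (simp add: local_transition_def local_frame_def cov_cocycle_prod)
  qed
  note T = c.transport_product[OF d.local_system_axioms cd.local_system_axioms this]
  have frame: "local_frame G (cocycle_prod c d) x0 = local_frame G c x0 \<otimes>\<^bsub>AutoGroup G\<^esub> local_frame G d x0"
    unfolding local_frame_def cov_cocycle_prod
    by (rule stalk_cocycle_prod(2)[OF c d cocycleD(2)[OF c] cocycleD(2)[OF d]])
  let ?m = "\<lambda>c. on_loop_classes x0 (transport G (local_transition G c))"
  have "?m (cocycle_prod c d) = ?m c \<otimes>\<^bsub>hom_group loop_group (center_group G)\<^esub>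
      out_action loop_group (outer_class G (local_frame G c x0)) (?m d)"
    unfolding out_action_outer_class[OF c.a_auto monodromy_hom[OF d]]
  proof (rule extensionalityI[of _ "carrier loop_group"])
    fix A assume A: "A \<in> carrier loop_group"
    then obtain p where p: "p \<in> loops_at x0" "A = loop_class x0 p" by (rule fundamental_group_cases)
    have "?m (cocycle_prod c d) A = ?m c A \<otimes> local_frame G c x0 (?m d A)"
      unfolding p(2)
        path_functor.on_loop_classes_eq[OF c.path_functor_transport p(1)]
        path_functor.on_loop_classes_eq[OF d.path_functor_transport p(1)]
        path_functor.on_loop_classes_eq[OF cd.path_functor_transport p(1)]
      using T[of p] p(1) by simp
    with A show "?m (cocycle_prod c d) A = (?m c \<otimes>\<^bsub>hom_group loop_group (center_group G)\<^esub>
        compose (carrier loop_group) (local_frame G c x0) (?m d)) A"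
      by (simp add: hom_group_def center_group_def compose_def)
  qed (simp_all add: hom_group_def on_loop_classes_def)
  then show ?thesis
    by (simp add: invariant_def semidirect_def frame outer_class_mult[OF c.a_auto d.a_auto])
qed

section \<open>The unit cocycle\<close>

abbreviation unit_cocycle :: "('x, 'g) bitorsor_cocycle" where
  "unit_cocycle \<equiv> cocycle_one (ad_xmod (const_sheaf G))"

lemma aut_one_closed:
  "\<one>\<^bsub>sect (aut_sheaf (const_sheaf G)) U\<^esub> \<in> carrier (sect (aut_sheaf (const_sheaf G)) (U :: 'x set))"
  unfolding aut_section_iff
proof (intro conjI allI impI ballI)
  fix V assume V: "open V" "V \<subseteq> U"
  show "\<one>\<^bsub>sect (aut_sheaf (const_sheaf G)) U\<^esub> V \<in> auto (sect (const_sheaf G) V)"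
    using V group.id_in_auto[OF group_section] by (simp add: aut_section_one one_AutoGroup)
  fix W s assume W: "open W" "W \<subseteq> V" and s: "s \<in> carrier (sect (const_sheaf G) V)"
  then have "W \<subseteq> U" using V by auto
  with W V s section_restrict_closed[OF s W(2)]
  show "\<one>\<^bsub>sect (aut_sheaf (const_sheaf G)) U\<^esub> W (rs (const_sheaf G) V W s) =
      rs (const_sheaf G) V W (\<one>\<^bsub>sect (aut_sheaf (const_sheaf G)) U\<^esub> V s)"
    by (simp add: aut_section_one one_AutoGroup section_restrict)
qed (simp add: aut_section_one)

lemma unit_cocycle_closed: "unit_cocycle \<in> Cocycles" and invariant_one: "invariant unit_cocycle = \<one>\<^bsub>target\<^esub>"
proof -
  have sel: "cov unit_cocycle x = UNIV" "zer unit_cocycle x = \<one>\<^bsub>sect (aut_sheaf (const_sheaf G)) UNIV\<^esub>"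
    "trn unit_cocycle x y = (\<lambda>_. \<one>)" for x y
    by (simp_all add: cocycle_one_def ad_xmod_simps section_one restrict_def)
  have st: "stalk G UNIV \<one>\<^bsub>sect (aut_sheaf (const_sheaf G)) UNIV\<^esub> q = \<one>\<^bsub>AutoGroup G\<^esub>" for q :: 'x
    by (rule stalk_one) auto
  show unit_cocycle: "unit_cocycle \<in> Cocycles"
    unfolding cocycles_iff sel st
    using section_const[of \<one> G "UNIV :: 'x set"] aut_one_closed[of UNIV]
    by (simp add: pointed_cover_def one_AutoGroup restrict_def)
  interpret twisted_local_system G "local_transition G unit_cocycle" "local_frame G unit_cocycle"
    by (rule twisted_local_system_frame[OF unit_cocycle])
  have D: "local_transition G unit_cocycle p q = \<one>" for p q by (simp add: local_transition_def sel)
  have "transport G (local_transition G unit_cocycle) p = \<one>" for p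
    by (rule transport_eqI[where s = "\<lambda>_. \<one>", simplified]) (simp add: flat_def D)
  then have "on_loop_classes x0 (transport G (local_transition G unit_cocycle)) =
      \<one>\<^bsub>hom_group loop_group (center_group G)\<^esub>"
    by (simp add: on_loop_classes_def hom_group_def center_group_def)
  moreover have "local_frame G unit_cocycle x0 = \<one>\<^bsub>AutoGroup G\<^esub>"
    by (simp add: local_frame_def sel st)
  ultimately show "invariant unit_cocycle = \<one>\<^bsub>target\<^esub>"
    by (simp add: invariant_def semidirect_def outer_class_one)
qed

end

section \<open>Classification of cocycles\<close>

context group_on_space
begin

text \<open>A coboundary \<open>h\<close> changes the local system by the gauge transformation \<open>e x = h x x\<close>. The transport
  around a loop is conjugated by \<open>e x0\<close>, and it is central.\<close>
lemma cohomologous_imp_invariant_eq: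
  assumes cc: "(c, c') \<in> cohomologous (ad_xmod (const_sheaf G))"
  shows "c \<in> Cocycles" "c' \<in> Cocycles" "invariant c = invariant c'"
proof -
  show c: "c \<in> Cocycles" and c': "c' \<in> Cocycles" using cc by (auto simp: cohomologous_def)
  obtain W h where W: "pointed_cover W"
    and h: "\<And>x. h x \<in> carrier (sect (const_sheaf G) (W x))" "\<And>x. W x \<subseteq> cov c x \<inter> cov c' x"
    and h_zer: "\<And>x q k. q \<in> W x \<Longrightarrow> k \<in> carrier G \<Longrightarrow> stalk G (cov c' x) (zer c' x) q k
          = h x q \<otimes> stalk G (cov c x) (zer c x) q k \<otimes> inv h x q"
    and h_trn: "\<And>x y q. q \<in> W x \<Longrightarrow> q \<in> W y \<Longrightarrow> trn c' x y q = h x q \<otimes> trn c x y q \<otimes> inv h y q"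
  proof -
    obtain W h where Wh: "pointed_cover W \<and>
      (\<forall>x. W x \<subseteq> cov c x \<inter> cov c' x \<and> h x \<in> carrier (sect (const_sheaf G) (W x)) \<and>
        (\<forall>q\<in>W x. \<forall>k\<in>carrier G. stalk G (cov c' x) (zer c' x) q k
          = h x q \<otimes> stalk G (cov c x) (zer c x) q k \<otimes> inv h x q)) \<and>
      (\<forall>x y. \<forall>q\<in>W x \<inter> W y. trn c' x y q = h x q \<otimes> trn c x y q \<otimes> inv h y q)"
      using cc unfolding cohomologous_iff[OF c c'] by (elim exE)
    show thesis by (rule that[of W h]) (use Wh in blast)+
  qed
  have W': "open (W x)" "x \<in> W x" for x using W by (auto simp: pointed_cover_def)
  interpret c: twisted_local_system G "local_transition G c" "local_frame G c"
    by (rule twisted_local_system_frame[OF c])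
  interpret c': twisted_local_system G "local_transition G c'" "local_frame G c'"
    by (rule twisted_local_system_frame[OF c'])
  define e where "e x = h x x" for x
  have e: "e x \<in> carrier G" for x unfolding e_def by (rule sectionD(2)[OF h(1) W'(2)])
  have "\<forall>\<^sub>F q in nhds p. local_transition G c' p q = e p \<otimes> local_transition G c p q \<otimes> inv e q" for p
    using eventually_nhds_in_open[OF W', of p] sectionD(3)[OF h(1) W'(2), of p]
  proof eventually_elim
    case (elim q)
    then have "q \<in> cov c p" "q \<in> cov c' p" "h p q = h p p" using h(2) by auto
    with h_trn[OF elim(1) W'(2)] show ?case by (simp add: local_transition_def e_def)
  qed
  note T = c.transport_gauge[OF c'.local_system_axioms e this]
  have "transport G (local_transition G c') p = transport G (local_transition G c) p"
    if p: "p \<in> loops_at x0" for p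
  proof -
    have "transport G (local_transition G c') p = e x0 \<otimes> transport G (local_transition G c) p \<otimes> inv e x0"
      using T[of p] p by simp
    also have "\<dots> = transport G (local_transition G c) p \<otimes> e x0 \<otimes> inv e x0"
      using c.transport_loop_central[of p "e x0"] p e by simp
    finally show ?thesis using p e by (simp add: m_assoc)
  qed
  note TT = this
  have "on_loop_classes x0 (transport G (local_transition G c)) =
      on_loop_classes x0 (transport G (local_transition G c'))"
  proof (rule extensionalityI[of _ "carrier loop_group"])
    fix A assume "A \<in> carrier loop_group"
    then obtain p where p: "p \<in> loops_at x0" "A = loop_class x0 p" by (rule fundamental_group_cases)
    show "on_loop_classes x0 (transport G (local_transition G c)) A =
      on_loop_classes x0 (transport G (local_transition G c')) A"
      unfolding p(2)
        path_functor.on_loop_classes_eq[OF c.path_functor_transport p(1)]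
        path_functor.on_loop_classes_eq[OF c'.path_functor_transport p(1)]
      by (rule TT[OF p(1), symmetric])
  qed (simp_all add: on_loop_classes_def)
  moreover have "outer_class G (local_frame G c x0) = outer_class G (local_frame G c' x0)"
    unfolding outer_class_eq_iff[OF c.a_auto c'.a_auto]
    using h_zer[OF W'(2), of _ x0] e[of x0] by (auto simp: local_frame_def e_def)
  ultimately show "invariant c = invariant c'" by (simp add: invariant_def)
qed

text \<open>A gauge transformation in the preferred trivialisations determines a coboundary on whole charts:
  in the chart at \<open>x\<close>, its value at \<open>q\<close> is found by passing from the chart at \<open>x\<close> to the one at \<open>q\<close>,
  applying \<open>e q\<close>, and passing back.\<close>
lemma local_gauge_imp_cohomologous:
  assumes c: "c \<in> Cocycles" and c': "c' \<in> Cocycles" and e: "\<And>p. e p \<in> carrier G"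
    and trans: "\<And>p. \<forall>\<^sub>F q in nhds p. local_transition G c' p q = e p \<otimes> local_transition G c p q \<otimes> inv e q"
    and frame: "\<And>p k. k \<in> carrier G \<Longrightarrow> local_frame G c' p k = e p \<otimes> local_frame G c p k \<otimes> inv e p"
  shows "(c, c') \<in> cohomologous (ad_xmod (const_sheaf G))"
  unfolding cohomologous_iff[OF c c']
proof (intro exI conjI allI ballI)
  define W where "W x = cov c x \<inter> cov c' x" for x
  define h where "h x = (\<lambda>q\<in>W x. trn c' x q q \<otimes> e q \<otimes> inv trn c x q q)" for x
  note self = cocycleD(2)[OF c] cocycleD(2)[OF c']
  have trn: "trn c x y q \<in> carrier G" "trn c' x y q \<in> carrier G" if "q \<in> W x" "q \<in> W y" for x y q
    using that cocycleD(5)[OF c] cocycleD(5)[OF c'] by (auto simp: W_def)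
  have selfW: "q \<in> W q" for q using self by (simp add: W_def)
  have mult: "trn c x y q \<otimes> trn c y z q = trn c x z q" "trn c' x y q \<otimes> trn c' y z q = trn c' x z q"
    if "q \<in> W x" "q \<in> W y" "q \<in> W z" for x y z q
    using that cocycleD(7)[OF c] cocycleD(7)[OF c'] by (auto simp: W_def)
  show "pointed_cover W"
    using cocycleD(1,2)[OF c] cocycleD(1,2)[OF c'] by (auto simp: pointed_cover_def W_def)
  fix x
  show "W x \<subseteq> cov c x \<inter> cov c' x" by (simp add: W_def)
  have h_apply: "h x q = trn c' x q q \<otimes> e q \<otimes> inv trn c x q q" if "q \<in> W x" for x q
    using that by (simp add: h_def)
  show "h x \<in> carrier (sect (const_sheaf G) (W x))"
    unfolding section_iff
  proof (intro conjI ballI)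
    show "h x \<in> extensional (W x)" by (simp add: h_def)
    fix q assume q: "q \<in> W x"
    show "h x q \<in> carrier G" using trn[OF q selfW] e by (simp add: h_apply q)
    have q': "q \<in> cov c x \<inter> cov c q" "q \<in> cov c' x \<inter> cov c' q" using q self by (auto simp: W_def)
    have "\<forall>\<^sub>F r in nhds q. r \<in> W q"
      using eventually_cov[OF c self(1)] eventually_cov[OF c' self(2)] by eventually_elim (simp add: W_def)
    with trans[of q] sectionD(3)[OF cocycleD(4)[OF c] q'(1)] sectionD(3)[OF cocycleD(4)[OF c'] q'(2)]
    show "\<forall>\<^sub>F r in nhds q. r \<in> W x \<longrightarrow> h x r = h x q"
    proof eventually_elim
      case (elim r)
      show ?case
      proof
        assume r: "r \<in> W x"
        have rq: "r \<in> W q" by (rule elim(4))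
        have D: "trn c' q r r = e q \<otimes> trn c q r r \<otimes> inv e r"
          using elim(1) rq by (simp add: local_transition_def W_def)
        have "trn c x q r = trn c x q q" "trn c' x q r = trn c' x q q"
          using elim(2,3) r rq by (simp_all add: W_def)
        then have g: "trn c x r r = trn c x q q \<otimes> trn c q r r" "trn c' x r r = trn c' x q q \<otimes> trn c' q r r"
          using mult[OF r rq selfW] by simp_all
        show "h x r = h x q"
          unfolding h_apply[OF r] h_apply[OF q] g D
          using trn[OF q selfW] trn[OF rq selfW] e
          by (simp add: m_assoc inv_mult_group group_cancel)
      qed
    qed
  qed
  {
    fix q k assume q: "q \<in> W x" and k: "k \<in> carrier G"
    have q': "q \<in> cov c x" "q \<in> cov c' x" using q by (auto simp: W_def)
    have a: "local_frame G c q k \<in> carrier G"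
      unfolding local_frame_def by (rule auto_closed[OF cocycleD(8)[OF c self(1)] k])
    have 1: "stalk G (cov c x) (zer c x) q k = trn c x q q \<otimes> local_frame G c q k \<otimes> inv trn c x q q"
      using cocycleD(6)[OF c q'(1) self(1) k] by (simp add: local_frame_def)
    have 2: "stalk G (cov c' x) (zer c' x) q k = trn c' x q q \<otimes> local_frame G c' q k \<otimes> inv trn c' x q q"
      using cocycleD(6)[OF c' q'(2) self(2) k] by (simp add: local_frame_def)
    show "stalk G (cov c' x) (zer c' x) q k = h x q \<otimes> stalk G (cov c x) (zer c x) q k \<otimes> inv h x q"
      unfolding 1 2 frame[OF k] h_apply[OF q]
      using trn[OF q selfW] e a by (simp add: m_assoc inv_mult_group group_cancel)
  }
  fix y q assume "q \<in> W x \<inter> W y"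
  then have q: "q \<in> W x" "q \<in> W y" by auto
  show "trn c' x y q = h x q \<otimes> trn c x y q \<otimes> inv h y q"
    unfolding h_apply[OF q(1)] h_apply[OF q(2)] mult(1)[OF q selfW, symmetric] mult(2)[OF q selfW, symmetric]
    using trn[OF q] trn[OF q(1) selfW] trn[OF q(2) selfW] e
    by (simp add: m_assoc inv_mult_group group_cancel)
qed

text \<open>A gauge transformation that extends a given one at the base point has to commute with transport,
  which forces the definition of \<open>e\<close>. Changing the path multiplies both transports by the value on a
  loop; as the monodromies agree and are central, these factors cancel (\<open>e_path\<close>).\<close>
lemma invariant_eq_imp_cohomologous:
  assumes c: "c \<in> Cocycles" and c': "c' \<in> Cocycles" and eq: "invariant c = invariant c'"
  shows "(c, c') \<in> cohomologous (ad_xmod (const_sheaf G))"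
proof -
  interpret c: twisted_local_system G "local_transition G c" "local_frame G c"
    by (rule twisted_local_system_frame[OF c])
  interpret c': twisted_local_system G "local_transition G c'" "local_frame G c'"
    by (rule twisted_local_system_frame[OF c'])
  define T where "T = transport G (local_transition G c)"
  define T' where "T' = transport G (local_transition G c')"
  have T_closed [simp]: "path p \<Longrightarrow> T p \<in> carrier G" "path p \<Longrightarrow> T' p \<in> carrier G" for p
    by (simp_all add: T_def T'_def)
  obtain g where g [simp]: "g \<in> carrier G"
    and base: "\<And>k. k \<in> carrier G \<Longrightarrow> local_frame G c' x0 k = g \<otimes> local_frame G c x0 k \<otimes> inv g"
    using eq outer_class_eq_iff[OF c.a_auto c'.a_auto, of x0 x0] by (auto simp: invariant_def)
  have loops: "T' p = T p" if p: "p \<in> loops_at x0" for p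
  proof -
    have "on_loop_classes x0 T (loop_class x0 p) = on_loop_classes x0 T' (loop_class x0 p)"
      using eq by (simp add: invariant_def T_def T'_def)
    then show ?thesis
      unfolding T_def T'_def path_functor.on_loop_classes_eq[OF c.path_functor_transport p]
        path_functor.on_loop_classes_eq[OF c'.path_functor_transport p] by simp
  qed
  have "\<forall>x. \<exists>p. path p \<and> pathstart p = x0 \<and> pathfinish p = x" using path_from_base by blast
  from choice[OF this] obtain b where
    b: "\<And>x. path (b x)" "\<And>x. pathstart (b x) = x0" "\<And>x. pathfinish (b x) = x" by blast
  define e where "e x = inv T' (b x) \<otimes> g \<otimes> T (b x)" for x
  have e [simp]: "e x \<in> carrier G" for x by (simp add: e_def b)
  have e_path: "e x = inv T' p \<otimes> g \<otimes> T p" if p: "path p" "pathstart p = x0" "pathfinish p = x" for p x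
  proof -
    (* The transports along p and b x differ by the transport along the loop l, which is central and
       the same for both cocycles. *)
    define l where "l = p +++ reversepath (b x)"
    have l: "l \<in> loops_at x0" using p b by (simp add: l_def)
    have "T l = T p \<otimes> inv T (b x)"
      unfolding T_def l_def using p b by (simp add: c.transport_join c.transport_reversepath)
    then have 1: "T p = T l \<otimes> T (b x)" using p b by (simp add: m_assoc)
    have "T' l = T' p \<otimes> inv T' (b x)"
      unfolding T'_def l_def using p b by (simp add: c'.transport_join c'.transport_reversepath)
    then have 2: "T' p = T l \<otimes> T' (b x)" using p b by (simp add: m_assoc loops[OF l, symmetric])
    have "T l \<otimes> g = g \<otimes> T l" using l by (simp add: T_def c.transport_loop_central)
    then have "g \<otimes> (T l \<otimes> T (b x)) = T l \<otimes> (g \<otimes> T (b x))"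
      using l b by (simp add: m_assoc[symmetric])
    then show ?thesis
      unfolding 1 2 e_def using l b by (simp add: m_assoc inv_mult_group group_cancel)
  qed
  show ?thesis
  proof (rule local_gauge_imp_cohomologous[OF c c' e])
    fix p
    obtain N where N: "open N" "p \<in> N" "flat G (local_transition G c) (\<lambda>q. q) (UNIV \<inter> N) (\<lambda>q. local_transition G c p q)"
      using c.flat_local[OF continuous_on_id UNIV_I] .
    obtain N' where N': "open N'" "p \<in> N'" "flat G (local_transition G c') (\<lambda>q. q) (UNIV \<inter> N') (\<lambda>q. local_transition G c' p q)"
      using c'.flat_local[OF continuous_on_id UNIV_I] .
    obtain P where P: "p \<in> interior P" "P \<subseteq> N \<inter> N'" "path_connected P"
      using path_connected_nbhd[of "N \<inter> N'" p] N N' by auto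
    (* To compute e q, continue the path to p by a path r inside P, along which the transports are
       the transition functions. *)
    have "local_transition G c' p q = e p \<otimes> local_transition G c p q \<otimes> inv e q" if q: "q \<in> P" for q
    proof -
      have pP: "p \<in> P" using P interior_subset by auto
      obtain r where r: "path r" "path_image r \<subseteq> P" "pathstart r = p" "pathfinish r = q"
        using P(3)[unfolded path_connected_def, rule_format, OF pP q] by (elim exE conjE)
      have 1: "T r = local_transition G c p q"
        unfolding T_def r(4)[symmetric] by (rule c.transport_short[OF N(3)]) (use r P in auto)
      have 2: "T' r = local_transition G c' p q"
        unfolding T'_def r(4)[symmetric] by (rule c'.transport_short[OF N'(3)]) (use r P in auto)
      have 3: "T (b p +++ r) = T (b p) \<otimes> T r" "T' (b p +++ r) = T' (b p) \<otimes> T' r"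
        unfolding T_def T'_def using r b by (simp_all add: c.transport_join c'.transport_join)
      have eq: "e q = inv T' (b p +++ r) \<otimes> g \<otimes> T (b p +++ r)"
        by (rule e_path) (use r b in auto)
      show ?thesis
        unfolding 1[symmetric] 2[symmetric] eq 3 e_def[of p] using b r
        by (simp add: m_assoc inv_mult_group group_cancel)
    qed
    moreover have "\<forall>\<^sub>F q in nhds p. q \<in> interior P" using P by (intro eventually_nhds_in_open) auto
    ultimately show "\<forall>\<^sub>F q in nhds p. local_transition G c' p q = e p \<otimes> local_transition G c p q \<otimes> inv e q"
      using interior_subset by (auto elim!: eventually_mono)
    fix k assume k: "k \<in> carrier G"
    have 1: "local_frame G c x0 k = T (b p) \<otimes> local_frame G c p k \<otimes> inv T (b p)"
      using c.twist_transport[OF b(1) k, of p] by (simp add: T_def b)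
    have 2: "local_frame G c' x0 k = T' (b p) \<otimes> local_frame G c' p k \<otimes> inv T' (b p)"
      using c'.twist_transport[OF b(1) k, of p] by (simp add: T'_def b)
    have "local_frame G c' p k = inv T' (b p) \<otimes> local_frame G c' x0 k \<otimes> T' (b p)"
      unfolding 2 using k b by (simp add: m_assoc group_cancel)
    also have "\<dots> = e p \<otimes> local_frame G c p k \<otimes> inv e p"
      unfolding base[OF k] 1 e_def using k b by (simp add: m_assoc inv_mult_group group_cancel)
    finally show "local_frame G c' p k = e p \<otimes> local_frame G c p k \<otimes> inv e p" .
  qed
qed

lemma cohomologous_iff_invariant_eq:
  "(c, c') \<in> cohomologous (ad_xmod (const_sheaf G)) \<longleftrightarrow>
    c \<in> Cocycles \<and> c' \<in> Cocycles \<and> invariant c = invariant c'"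
  using cohomologous_imp_invariant_eq invariant_eq_imp_cohomologous by blast

text \<open>The sets \<open>N x\<close> are path connected neighbourhoods in which all loops are null-homotopic, and \<open>d x y\<close> is
  a path in \<open>N x\<close> from \<open>x\<close> to \<open>y\<close>. The transition function at \<open>q\<close> is the value of \<open>M\<close> on a path that goes
  from \<open>x\<close> to \<open>q\<close> in \<open>N x\<close> and then from \<open>q\<close> to \<open>y\<close> in \<open>N y\<close>. As it is central, the constant
  automorphism \<open>\<alpha>\<close> completes it to a cocycle. Its flat section along a path is the value of \<open>M\<close> on
  initial segments, so its transport is \<open>M\<close>.\<close>
lemma invariant_surj:
  assumes "b \<in> carrier target"
  shows "\<exists>c\<in>Cocycles. invariant c = b"
proof -
  obtain m \<alpha> where m: "m \<in> carrier (hom_group loop_group (center_group G))"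
    and \<alpha>: "\<alpha> \<in> auto G" and b: "b = (m, outer_class G \<alpha>)"
    using assms by (auto simp: semidirect_def carrier_Out)
  obtain M where M: "path_functor G M"
    and M_central: "\<And>p g. path p \<Longrightarrow> g \<in> carrier G \<Longrightarrow> M p \<otimes> g = g \<otimes> M p"
    and Mm: "on_loop_classes x0 M = m"
  proof (rule extend_to_path_functor[OF is_group path_from_base m])
    fix M assume "path_functor G M" "\<And>p g. path p \<Longrightarrow> g \<in> carrier G \<Longrightarrow> M p \<otimes> g = g \<otimes> M p"
      "on_loop_classes x0 M = m"
    then show thesis by (rule that)
  qed
  interpret M: path_functor G M by (rule M)
  have "\<forall>x. \<exists>U. x \<in> interior U \<and> path_connected U \<and>
        (\<forall>\<gamma>. path \<gamma> \<and> path_image \<gamma> \<subseteq> U \<and> pathfinish \<gamma> = pathstart \<gamma> \<longrightarrow>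
          homotopic_paths (UNIV :: 'x set) \<gamma> (\<lambda>_. pathstart \<gamma>))"
    using local_1_connected unfolding locally_relatively_1_connected_def
    by (metis open_UNIV UNIV_I)
  from choice[OF this] obtain N where N: "\<And>x::'x. x \<in> interior (N x)" "\<And>x. path_connected (N x)"
    and null: "\<And>x \<gamma>. path \<gamma> \<Longrightarrow> path_image \<gamma> \<subseteq> N x \<Longrightarrow> pathfinish \<gamma> = pathstart \<gamma> \<Longrightarrow>
      homotopic_paths UNIV \<gamma> (\<lambda>_. pathstart \<gamma>)"
    by blast
  have self: "x \<in> N x" for x using N(1) interior_subset by blast
  (* Two paths in N x with the same end points together form a null-homotopic loop. *)
  have same: "M p = M q" if "path p" "path q" "path_image p \<subseteq> N x" "path_image q \<subseteq> N x"
    "pathstart p = pathstart q" "pathfinish p = pathfinish q" for p q x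
  proof -
    have "M (p +++ reversepath q) = \<one>"
      using M.M_homotopic[OF null[of "p +++ reversepath q" x]] that
      by (simp add: subset_path_image_join)
    then have "M p \<otimes> inv M q = \<one>" using that by (simp add: M.M_join M.M_reversepath)
    then show ?thesis using that by (metis M.M_closed inv_closed inv_equality inv_inv)
  qed
  have "\<forall>x y. \<exists>p. y \<in> N x \<longrightarrow> path p \<and> path_image p \<subseteq> N x \<and> pathstart p = x \<and> pathfinish p = y"
    using N(2) self unfolding path_connected_def by blast
  then obtain d where d: "\<And>x y. y \<in> N x \<Longrightarrow> path (d x y)" "\<And>x y. y \<in> N x \<Longrightarrow> path_image (d x y) \<subseteq> N x"
    "\<And>x y. y \<in> N x \<Longrightarrow> pathstart (d x y) = x" "\<And>x y. y \<in> N x \<Longrightarrow> pathfinish (d x y) = y"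
    by metis
  have d_self: "M (d x x) = \<one>" for x
  proof -
    have "M (d x x) = M (\<lambda>_. x)"
      by (rule same[of _ _ x]) (use d[OF self] self in \<open>auto simp: pathstart_def pathfinish_def path_image_def\<close>)
    then show ?thesis by simp
  qed
  define U where "U x = interior (N x)" for x
  have U: "open (U x)" "x \<in> U x" "U x \<subseteq> N x" for x using N(1) interior_subset by (auto simp: U_def)
  define c :: "('x, 'g) bitorsor_cocycle" where "c = \<lparr>cov = U, zer = (\<lambda>x. const_aut (U x) \<alpha>),
    trn = (\<lambda>x y. \<lambda>q\<in>U x \<inter> U y. M (d x q +++ reversepath (d y q)))\<rparr>"
  have sel: "cov c = U" "zer c x = const_aut (U x) \<alpha>"
    "trn c x y = (\<lambda>q\<in>U x \<inter> U y. M (d x q +++ reversepath (d y q)))" for x y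
    by (simp_all add: c_def)
  have pth: "path (d x q +++ reversepath (d y q))" if "q \<in> U x" "q \<in> U y" for x y q
    using that U(3) d by (simp add: subset_iff)
  have dN: "path (d x q)" "pathfinish (d x q) = q" "pathstart (d x q) = x" "path_image (d x q) \<subseteq> N x"
    if "q \<in> U x" for x q
    using d[of q x] U(3) that by blast+
  have trn: "trn c x y q = M (d x q) \<otimes> inv M (d y q)" if "q \<in> U x" "q \<in> U y" for x y q
    using that dN[OF that(1)] dN[OF that(2)] by (simp add: sel M.M_join M.M_reversepath)
  have trn_closed: "trn c x y q \<in> carrier G" if "q \<in> U x" "q \<in> U y" for x y q
    using pth[OF that] that by (simp add: sel)
  have cocycle: "c \<in> Cocycles"
    unfolding cocycles_iff sel(1,2)
  proof (intro conjI allI ballI)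
    show "pointed_cover U" using U by (simp add: pointed_cover_def)
    fix x
    show "const_aut (U x) \<alpha> \<in> carrier (sect (aut_sheaf (const_sheaf G)) (U x))"
      by (rule const_aut_closed[OF \<alpha>])
    fix y
    show "trn c x y \<in> carrier (sect (const_sheaf G) (U x \<inter> U y))"
      unfolding section_iff
    proof (intro conjI ballI)
      show "trn c x y \<in> extensional (U x \<inter> U y)" by (simp add: sel)
      fix q assume "q \<in> U x \<inter> U y"
      then have q: "q \<in> U x" "q \<in> U y" by auto
      show "trn c x y q \<in> carrier G" by (rule trn_closed[OF q])
      obtain P where P: "q \<in> interior P" "P \<subseteq> U x \<inter> U y" "path_connected P"
        using path_connected_nbhd[of "U x \<inter> U y" q] U(1) q by auto
      have qP: "q \<in> P" using P interior_subset by auto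
      (* Moving from q to r inside P multiplies both factors of the transition function by M s, on
         the right, and these cancel. *)
      have "trn c x y r = trn c x y q" if r: "r \<in> P" for r
      proof -
        obtain s where s: "path s" "path_image s \<subseteq> P" "pathstart s = q" "pathfinish s = r"
          using P(3)[unfolded path_connected_def, rule_format, OF qP r] by (elim exE conjE)
        have rU: "r \<in> U x" "r \<in> U y" using r P by auto
        have step: "M (d z r) = M (d z q) \<otimes> M s" if z: "q \<in> U z" "r \<in> U z" "P \<subseteq> U z" for z
        proof -
          have "path_image s \<subseteq> N z" using s(2) z(3) U(3) by blast
          then have "M (d z r) = M (d z q +++ s)"
            using dN[OF z(1)] dN[OF z(2)] s by (intro same[of _ _ z]) (auto simp: subset_path_image_join)
          then show ?thesis using dN[OF z(1)] s by (simp add: M.M_join)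
        qed
        have "M (d x r) = M (d x q) \<otimes> M s" "M (d y r) = M (d y q) \<otimes> M s"
          using P(2) by (auto intro!: step q rU)
        then show ?thesis
          unfolding trn[OF rU] trn[OF q] using dN(1)[OF q(1)] dN(1)[OF q(2)] s(1)
          by (simp add: m_assoc inv_mult_group group_cancel)
      qed
      moreover have "\<forall>\<^sub>F r in nhds q. r \<in> interior P" using P by (intro eventually_nhds_in_open) auto
      ultimately show "\<forall>\<^sub>F r in nhds q. r \<in> U x \<inter> U y \<longrightarrow> trn c x y r = trn c x y q"
        using interior_subset by (auto elim!: eventually_mono)
    qed
    {
      fix q k assume "q \<in> U x \<inter> U y" and k: "k \<in> carrier G"
      then have q: "q \<in> U x" "q \<in> U y" by auto
      have "trn c x y q \<otimes> \<alpha> k = \<alpha> k \<otimes> trn c x y q"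
        using M_central[OF pth[OF q] auto_closed[OF \<alpha> k]] q by (simp add: sel)
      then have "\<alpha> k = trn c x y q \<otimes> \<alpha> k \<otimes> inv trn c x y q"
        using trn_closed[OF q] auto_closed[OF \<alpha> k] by (simp add: m_assoc)
      then show "stalk G (U x) (const_aut (U x) \<alpha>) q k =
          trn c x y q \<otimes> stalk G (U y) (const_aut (U y) \<alpha>) q k \<otimes> inv trn c x y q"
        unfolding stalk_const_aut[OF U(1) q(1) \<alpha>] stalk_const_aut[OF U(1) q(2) \<alpha>] .
    }
    fix z q assume "q \<in> U x \<inter> U y \<inter> U z"
    then have q: "q \<in> U x" "q \<in> U y" "q \<in> U z" by auto
    show "trn c x y q \<otimes> trn c y z q = trn c x z q"
      unfolding trn[OF q(1,2)] trn[OF q(2,3)] trn[OF q(1,3)]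
      using dN(1)[OF q(1)] dN(1)[OF q(2)] dN(1)[OF q(3)] by (simp add: m_assoc group_cancel)
  qed
  interpret c: twisted_local_system G "local_transition G c" "local_frame G c"
    by (rule twisted_local_system_frame[OF cocycle])
  have D: "local_transition G c p q = M (d p q)" if "q \<in> U p" for p q
    using that dN[OF that] U(2)[of q] trn[OF that U(2)] by (simp add: local_transition_def sel(1) d_self)
  have transport: "transport G (local_transition G c) \<gamma> = M \<gamma>" if \<gamma>: "path \<gamma>" for \<gamma>
  proof -
    (* The path below is the part of \<gamma> from 0 to t. *)
    define s where "s t = M (\<lambda>x. \<gamma> (t * x))" for t
    have sub: "path (\<lambda>x. \<gamma> (u + (v - u) * x))" "(\<lambda>x. u + (v - u) * x) ` {0..1} \<subseteq> closed_segment u v"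
      if "u \<in> {0..1}" "v \<in> {0..1}" for u v :: real
    proof -
      show seg: "(\<lambda>x. u + (v - u) * x) ` {0..1} \<subseteq> closed_segment u v"
      proof (rule image_subsetI)
        fix x :: real assume "x \<in> {0..1}"
        moreover have "u + (v - u) * x = (1 - x) *\<^sub>R u + x *\<^sub>R v" by (simp add: algebra_simps)
        ultimately show "u + (v - u) * x \<in> closed_segment u v" unfolding in_segment by auto
      qed
      have "closed_segment u v \<subseteq> {0..1}" using that by (intro closed_segment_subset convex_real_interval)
      with seg have "(\<lambda>x. u + (v - u) * x) ` {0..1} \<subseteq> {0..1}" by blast
      then show "path (\<lambda>x. \<gamma> (u + (v - u) * x))"
        unfolding path_def
        by (intro continuous_on_compose2[OF \<gamma>[unfolded path_def]]) (auto intro!: continuous_intros)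
    qed
    have "flat G (local_transition G c) \<gamma> {0..1} s"
      unfolding flat_def
    proof (intro ballI conjI)
      fix z :: real assume z: "z \<in> {0..1}"
      have ps: "path (\<lambda>x. \<gamma> (u * x))" if "u \<in> {0..1}" for u
        using sub(1)[of 0 u] that by simp
      show sz: "s z \<in> carrier G" unfolding s_def by (rule M.M_closed[OF ps[OF z]])
      have "\<forall>\<^sub>F w in nhds z. w \<in> {0..1} \<longrightarrow> \<gamma> w \<in> U (\<gamma> z)"
        using \<gamma> z U by (intro continuous_on_eventually_nhds eventually_nhds_in_open) (auto simp: path_def)
      then obtain S where S: "open S" "z \<in> S" "\<forall>w\<in>S. w \<in> {0..1} \<longrightarrow> \<gamma> w \<in> U (\<gamma> z)"
        unfolding eventually_nhds by metis
      then obtain r where r: "r > 0" "ball z r \<subseteq> S" by (meson open_contains_ball)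
      have "\<forall>\<^sub>F w in nhds z. w \<in> ball z r" using r by (intro eventually_nhds_in_open) auto
      then show "\<forall>\<^sub>F w in nhds z. w \<in> {0..1} \<longrightarrow> s w = s z \<otimes> local_transition G c (\<gamma> z) (\<gamma> w)"
      proof eventually_elim
        case (elim w)
        show ?case
        proof
          assume w: "w \<in> {0..1}"
          define e where "e x = \<gamma> (z + (w - z) * x)" for x
          have e: "path e" unfolding e_def by (rule sub(1)[OF z w])
          have ends: "pathstart e = \<gamma> z" "pathfinish e = \<gamma> w"
            by (simp_all add: e_def pathstart_def pathfinish_def)
          have "closed_segment z w \<subseteq> ball z r \<inter> {0..1}"
            using elim z w r by (intro closed_segment_subset convex_Int convex_ball convex_real_interval) auto
          with sub(2)[OF z w] r(2) S(3) have "path_image e \<subseteq> U (\<gamma> z)"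
            unfolding path_image_def e_def by blast
          then have img: "path_image e \<subseteq> N (\<gamma> z)" using U(3) by blast
          have wU: "\<gamma> w \<in> U (\<gamma> z)" using S(3) r(2) elim w by blast
          have "s w = M ((\<lambda>x. \<gamma> (z * x)) +++ e)"
            unfolding s_def e_def by (rule M.M_homotopic[OF homotopic_paths_segments[OF \<gamma> z w], symmetric])
          also have "\<dots> = s z \<otimes> M e"
            unfolding s_def by (rule M.M_join[OF ps[OF z] e]) (simp add: ends pathfinish_def)
          also have "M e = M (d (\<gamma> z) (\<gamma> w))"
            by (rule same[OF e _ img]) (use dN[OF wU] ends in auto)
          finally show "s w = s z \<otimes> local_transition G c (\<gamma> z) (\<gamma> w)" by (simp add: D[OF wU])
        qed
      qed
    qed
    from c.transport_eqI[OF this] show ?thesis by (simp add: s_def)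
  qed
  have "on_loop_classes x0 (transport G (local_transition G c)) = m"
  proof -
    have "on_loop_classes x0 (transport G (local_transition G c)) = on_loop_classes x0 M"
    proof (rule extensionalityI[of _ "carrier loop_group"])
      fix A assume "A \<in> carrier loop_group"
      then obtain p where p: "p \<in> loops_at x0" "A = loop_class x0 p" by (rule fundamental_group_cases)
      show "on_loop_classes x0 (transport G (local_transition G c)) A = on_loop_classes x0 M A"
        unfolding p(2) path_functor.on_loop_classes_eq[OF c.path_functor_transport p(1)]
          M.on_loop_classes_eq[OF p(1)]
        by (rule transport) (use p in simp)
    qed (simp_all add: on_loop_classes_def)
    with Mm show ?thesis by simp
  qed
  moreover have "local_frame G c x0 = \<alpha>"
    unfolding local_frame_def sel(1,2) by (rule stalk_const_aut[OF U(1,2) \<alpha>])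
  ultimately have "invariant c = b" by (simp add: invariant_def b)
  with cocycle show ?thesis by blast
qed

end

theorem proposition1p3p2:
  fixes x0 :: "'a::topological_space"
    and G :: "('g, 'm) monoid_scheme"
  assumes "connected (UNIV :: 'a set)"
    and "locally_relatively_1_connected TYPE('a)"
    and "group G"
  defines "A \<equiv> H0 (ad_xmod (const_sheaf G :: ('a, 'a \<Rightarrow> 'g) group_presheaf))"
    and "B \<equiv> semidirect (hom_group (fundamental_group x0) (center_group G)) (Out G)
                (out_action (fundamental_group x0))"
  shows "group A \<and> group B \<and> A \<cong> B"
proof -
  interpret group_on_space G x0
    using assms(1-3) by (simp add: group_on_space_def group_on_space_axioms_def)
  have "invariant ` Cocycles = carrier target"
    using invariant_closed invariant_surj by blast
  from quotient_by_invariant[OF group_target this cohomologous_iff_invariant_eq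
      cocycle_prod_closed invariant_mult unit_cocycle_closed invariant_one]
  have "group A \<and> A \<cong> B" unfolding A_def B_def H0_def .
  with group_target show ?thesis by (simp add: B_def)
qed

end
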